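(* Let $M\ge 1$ be an integer and let $\nu_1,\ldots,\nu_M\ge 0$ be fixed integers (with $\nu_0=0$). Let $K_n(x,y)$ be the correlation kernel of the squared singular values of the product of $M$ complex Ginibre matrices given by the double contour integral in the context. Let $x_0\in\left(0,\frac{(M+1)^{M+1}}{M^M}\right)$ and let $\varphi=\varphi(x_0)\in\left(0,\frac{\pi}{M+1}\right)$ be the unique number with $$x_0=\frac{(\sin((M+1)\varphi))^{M+1}}{\sin\varphi\,(\sin(M\varphi))^M}.$$ Set $$\rho(\varphi)=\frac{1}{\pi}\frac{(\sin\varphi)^2(\sin(M\varphi))^{M-1}}{(\sin((M+1)\varphi))^M}.$$ Then $$\lim_{n\to\infty}\frac{e^{-\pi\xi\cot\varphi}}{e^{-\pi\eta\cot\varphi}}\,\frac{n^{M-1}}{\rho(\varphi)}\,K_n\left(n^M\left(x_0+\frac{\xi}{n\rho(\varphi)}\right),\,n^M\left(x_0+\frac{\eta}{n\rho(\varphi)}\right)\right)=K_{\sin}(\xi,\eta)$$ uniformly for $\xi$ and $\eta$ in any compact subset of $\mathbb{R}$, where $K_{\sin}(x,y)=\frac{\sin\pi(x-y)}{\pi(x-y)}$ (equal to $1$ when $x=y$).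
   Context: Setting: $X_1,\ldots,X_M$ are independent complex random matrices, $X_j$ of size $N_j\times N_{j-1}$ with i.i.d. standard complex Gaussian entries (complex Ginibre matrices), where $N_0=n=\min\{N_0,\ldots,N_M\}$ and $\nu_j=N_j-N_0$ for $j=0,\ldots,M$ (so $\nu_0=0$, $\nu_j\ge0$). The squared singular values of $Y_M=X_M\cdots X_1$ form a determinantal point process on $(0,\infty)$ with correlation kernel, for $x,y>0$, $$K_n(x,y)=\frac{1}{(2\pi i)^2}\int_{-1/2-i\infty}^{-1/2+i\infty}ds\oint_{\Sigma}dt\,\prod_{j=0}^M\frac{\Gamma(s+\nu_j+1)}{\Gamma(t+\nu_j+1)}\,\frac{\Gamma(t-n+1)}{\Gamma(s-n+1)}\,\frac{x^t y^{-s-1}}{s-t},$$ where $\Sigma$ is a closed contour going around $0,1,\ldots,n-1$ once in the positive direction with $\operatorname{Re}t>-1/2$ for $t\in\Sigma$. This formula is taken as the definition of $K_n$. The map $\varphi\mapsto\frac{(\sin((M+1)\varphi))^{M+1}}{\sin\varphi(\sin(M\varphi))^M}$ is a strictly decreasing bijection from $(0,\pi/(M+1))$ onto $(0,(M+1)^{M+1}/M^M)$. For $\xi,\eta$ in a fixed compact set the arguments of $K_n$ are positive for all large $n$. *)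

theory Defs
  imports "HOL-Complex_Analysis.Complex_Analysis"
begin

text \<open>
  Winding number 1 renders ``going around $0,\dots,n-1$ once in the positive direction''.
  The contour is not required to be simple.
\<close>
definition encloses_once :: "nat \<Rightarrow> (real \<Rightarrow> complex) \<Rightarrow> bool" where
  "encloses_once n \<Sigma> \<longleftrightarrow>
     valid_path \<Sigma> \<and> pathfinish \<Sigma> = pathstart \<Sigma> \<and>
     (\<forall>t\<in>path_image \<Sigma>. Re t > - 1 / 2) \<and>
     (\<forall>k<n. of_nat k \<notin> path_image \<Sigma> \<and> winding_number \<Sigma> (of_nat k) = 1)"

lemma encloses_once_circlepath:
  assumes "n \<ge> 1"
  shows "encloses_once n (circlepath (of_real ((real n - 1) / 2)) (real n / 2 - 1 / 4))"
proof -
  define c r where "c = (real n - 1) / 2" and "r = real n / 2 - 1 / 4"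
  have r: "r > 0" using assms by (simp add: r_def)
  have in_ball: "norm (of_nat k - complex_of_real c) < r" if "k < n" for k
  proof -
    have "norm (of_nat k - complex_of_real c) = \<bar>real k - c\<bar>"
      by (metis norm_of_real of_real_diff of_real_of_nat_eq)
    moreover have "real k \<le> real n - 1" using that by linarith
    ultimately show ?thesis
      by (simp add: c_def r_def abs_if field_simps)
  qed
  have img: "path_image (circlepath (complex_of_real c) r) = sphere (of_real c) r"
    using r by simp
  have "Re t > - 1 / 2" if "t \<in> sphere (complex_of_real c) r" for t
  proof -
    have "norm (of_real c - t) = r" using that by (simp add: dist_norm)
    then have "\<bar>c - Re t\<bar> \<le> r"
      using abs_Re_le_cmod[of "of_real c - t"] by simp
    then have "c - Re t \<le> r" by linarith
    then show ?thesis by (simp add: c_def r_def field_simps)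
  qed
  moreover have "of_nat k \<notin> sphere (complex_of_real c) r" if "k < n" for k
    using in_ball[OF that] by (simp add: dist_norm norm_minus_commute)
  moreover have "winding_number (circlepath (of_real c) r) (of_nat k) = 1" if "k < n" for k
    using in_ball[OF that] by (rule winding_number_circlepath)
  ultimately show ?thesis
    unfolding encloses_once_def c_def[symmetric] r_def[symmetric] img by simp
qed

definition kernel_integrand ::
  "nat \<Rightarrow> (nat \<Rightarrow> nat) \<Rightarrow> nat \<Rightarrow> real \<Rightarrow> real \<Rightarrow> complex \<Rightarrow> complex \<Rightarrow> complex" where
  "kernel_integrand M \<nu> n x y s t =
     (\<Prod>j=0..M. Gamma (s + of_nat (\<nu> j) + 1) / Gamma (t + of_nat (\<nu> j) + 1)) *
     (Gamma (t - of_nat n + 1) / Gamma (s - of_nat n + 1)) *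
     (of_real x powr t * of_real y powr (- s - 1) / (s - t))"

text \<open>
  The outer integral runs over the line $s = -1/2 + iu$ with $u$ real, whence $ds = i\,du$.
  For $M \ge 1$ and $x, y > 0$ it converges absolutely, because after cancelling
  $\Gamma(s+\nu_0+1)/\Gamma(s-n+1)$, a polynomial as $\nu_0 = 0$, at least one exponentially
  decaying Gamma factor remains; so the Lebesgue integral is the intended one.
\<close>
definition ginibre_kernel ::
  "nat \<Rightarrow> (nat \<Rightarrow> nat) \<Rightarrow> nat \<Rightarrow> (real \<Rightarrow> complex) \<Rightarrow> real \<Rightarrow> real \<Rightarrow> complex" where
  "ginibre_kernel M \<nu> n \<Sigma> x y =
     1 / (2 * of_real pi * \<i>)\<^sup>2 *
     (LINT u|lborel. \<i> * contour_integral \<Sigma> (kernel_integrand M \<nu> n x y (Complex (- 1 / 2) u)))"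

definition rho :: "nat \<Rightarrow> real \<Rightarrow> real" where
  "rho M \<phi> = 1 / pi * ((sin \<phi>)\<^sup>2 * sin (real M * \<phi>) ^ (M - 1) / sin (real (M + 1) * \<phi>) ^ M)"

definition sine_kernel :: "real \<Rightarrow> real \<Rightarrow> real" where
  "sine_kernel x y = (if x = y then 1 else sin (pi * (x - y)) / (pi * (x - y)))"

end

(* Write the kernel as a double contour integral of G(s) H(t) / (s - t), where G collects the factors in
s, H those in t, and G(s) H(s) = x^s y^(-s-1).  In the scale s = n z the logarithm of G is n times the
phase (M+1) S(z) - S(z-1) - z ln x0 with S(z) = z Ln z - z, up to bounded factors, and the saddle points
are w = sin((M+1) phi) / sin(M phi) exp(i phi) and its conjugate.

The t-contour is deformed to the curve through w on which the derivative of the phase is real, and the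
s-line is moved to the vertical line through w.  The real part of the phase is minimal at w on the
curve and maximal at w on the line.  Moving the s-line across the curve picks up the integral of
x^s y^(-s-1) between the two saddle points, which is an elementary integral and gives the sine kernel
in the limit.  Since the curve and the line cross transversally, 1/(s - t) is bounded by a
product of an integrable function on the line and an integrable function on the curve, so the remaining
double integral factorises and tends to 0 by dominated convergence.  Hence only upper bounds for
ratios of Gamma functions are needed, and Stirling's formula up to constants suffices. *)
theory Submission
  imports Defs
begin

section \<open>Stirling's formula in the right half-plane up to bounded factors\<close>

text \<open>No contour is deformed literally. The integral over \<open>\<Sigma>\<close> is evaluated
  by residues at 0, ..., n-1. The resulting sum times the factors in s is holomorphic for Re s > -1,
  so the s-line moves freely. On the new line the same residue sum is rewritten as an integral over
  the saddle curve plus the residue at t = s, weighted by the winding number of the curve about s.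
  The scaled curve touches -1/2 and so is not an admissible \<open>\<Sigma>\<close>; the detour
  through residues makes this harmless. All Gamma factors are centred at u = s + 1/2: Gamma(u + 1/2)
  has the size of exp(Re S(u)) without the usual square root factor, so the phase is matched up to
  constants, uniformly on the closed half-plane Re u >= 0. Two places resist. Where Re u < n, the
  reflection formula brings in a cosine whose zeros must be avoided; the curve does so because there
  it stays in a sector away from the real axis. At the point 0 of the curve the powers coming from
  \<open>\<nu>\<close> degenerate, and the strict gap of the phase compensates them.\<close>

text \<open>At $z = 0$ the junk value of the logarithm is harmless: the product vanishes, which is the correct limit.\<close>

definition stirling_exponent :: "complex \<Rightarrow> complex" where
  "stirling_exponent z = z * Ln z - z"

lemma has_field_derivative_stirling_exponent:
  assumes "z \<notin> \<real>\<^sub>\<le>\<^sub>0"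
  shows "(stirling_exponent has_field_derivative Ln z) (at z within A)"
proof -
  have "z \<noteq> 0" using assms by auto
  then show ?thesis
    unfolding stirling_exponent_def
    by (auto intro!: derivative_eq_intros simp: assms)
qed

lemma norm_le_norm_add_of_real:
  fixes z :: complex
  assumes "Re z \<ge> 0" "r \<ge> 0"
  shows "norm z \<le> norm (z + of_real r)"
proof -
  have "(Re z)\<^sup>2 \<le> (Re z + r)\<^sup>2" using assms by (intro power_mono) auto
  then show ?thesis by (auto simp: cmod_def intro!: real_sqrt_le_mono)
qed

lemma nonpos_Reals_add_of_real:
  fixes z :: complex
  assumes "Re z \<ge> 0" "z \<noteq> 0" "r \<ge> 0"
  shows "z + of_real r \<notin> \<real>\<^sub>\<le>\<^sub>0"
  using assms by (auto simp: complex_nonpos_Reals_iff complex_eq_iff)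

text \<open>The difference of \<open>stirling_exponent\<close> is the integral of Ln over a unit
  step, and Ln at the centre is the midpoint rule. With c the centre, \<open>d\<close> and its
  derivative \<open>d1\<close> both vanish at 0, and the derivative of \<open>d1\<close> is of order
  1/|z|^2; two mean value estimates give the claim. The midpoint makes the error summable over unit
  steps, which is why all Gamma arguments are shifted by 1/2.\<close>

lemma midpoint_Ln:
  assumes "Re z \<ge> 0" "z \<noteq> 0"
  shows "norm (stirling_exponent (z + 1) - stirling_exponent z - Ln (z + 1/2))
           \<le> 1 / (norm z)\<^sup>2"
proof -
  define c where "c = z + 1/2"
  define K where "K = closed_segment 0 (1/2 :: complex)"
  have K: "\<exists>r. \<tau> = of_real r \<and> 0 \<le> r \<and> r \<le> 1/2" if tau: "\<tau> \<in> K" for \<tau>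
  proof -
    obtain u where "0 \<le> u" "u \<le> 1" "\<tau> = u *\<^sub>R (1/2)"
      using tau unfolding K_def closed_segment_def by auto
    then show ?thesis by (intro exI[of _ "u/2"]) (auto simp: scaleR_conv_of_real)
  qed
  have convK: "convex K" by (simp add: K_def)
  have inK: "0 \<in> K" "1/2 \<in> K" by (simp_all add: K_def)
  have plus: "c + \<tau> \<notin> \<real>\<^sub>\<le>\<^sub>0 \<and> c - \<tau> \<notin> \<real>\<^sub>\<le>\<^sub>0 \<and> norm z \<le> norm (c + \<tau>) \<and> norm z \<le> norm (c - \<tau>)"
    if tau: "\<tau> \<in> K" for \<tau>
  proof -
    obtain r where r: "\<tau> = of_real r" "0 \<le> r" "r \<le> 1/2" using K[OF tau] by auto
    have eq: "c + \<tau> = z + of_real (1/2 + r)" "c - \<tau> = z + of_real (1/2 - r)"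
      by (auto simp: c_def r)
    show ?thesis unfolding eq
      using nonpos_Reals_add_of_real[OF assms, of "1/2+r"] nonpos_Reals_add_of_real[OF assms, of "1/2-r"]
        norm_le_norm_add_of_real[OF assms(1), of "1/2+r"] norm_le_norm_add_of_real[OF assms(1), of "1/2-r"] r
      by (auto simp del: of_real_add of_real_diff)
  qed
  have nK: "norm \<tau> \<le> 1/2" if "\<tau> \<in> K" for \<tau>
    using K[OF that] by auto
  have zpos: "norm z > 0" using assms by simp
  define d1 where "d1 = (\<lambda>\<tau>. Ln (c + \<tau>) + Ln (c - \<tau>) - 2 * Ln c)"
  define d where "d = (\<lambda>\<tau>. stirling_exponent (c + \<tau>) - stirling_exponent (c - \<tau>) - 2 * \<tau> * Ln c)"
  have d1': "(d1 has_field_derivative (1 / (c + \<tau>) - 1 / (c - \<tau>))) (at \<tau> within K)" if "\<tau> \<in> K" for \<tau>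
    unfolding d1_def using plus[OF that]
    by (auto intro!: derivative_eq_intros simp: divide_simps)
  have d': "(d has_field_derivative d1 \<tau>) (at \<tau> within K)" if "\<tau> \<in> K" for \<tau>
  proof -
    have 1: "((\<lambda>\<tau>. stirling_exponent (c + \<tau>)) has_field_derivative Ln (c + \<tau>) * 1) (at \<tau> within K)"
      by (rule DERIV_chain2[OF has_field_derivative_stirling_exponent])
         (use plus[OF that] in \<open>auto intro!: derivative_eq_intros\<close>)
    have 2: "((\<lambda>\<tau>. stirling_exponent (c - \<tau>)) has_field_derivative Ln (c - \<tau>) * (-1)) (at \<tau> within K)"
      by (rule DERIV_chain2[OF has_field_derivative_stirling_exponent])
         (use plus[OF that] in \<open>auto intro!: derivative_eq_intros\<close>)
    show ?thesis unfolding d_def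
      by (rule derivative_eq_intros 1 2 refl)+ (simp add: d1_def)
  qed
  have b1: "norm (1 / (c + \<tau>) - 1 / (c - \<tau>)) \<le> 1 / (norm z)\<^sup>2" if "\<tau> \<in> K" for \<tau>
  proof -
    have nz: "c + \<tau> \<noteq> 0" "c - \<tau> \<noteq> 0" using plus[OF that] zpos by auto
    have "1 / (c + \<tau>) - 1 / (c - \<tau>) = - (2 * \<tau>) / ((c + \<tau>) * (c - \<tau>))"
      using nz by (simp add: field_simps)
    then have "norm (1 / (c + \<tau>) - 1 / (c - \<tau>)) = 2 * norm \<tau> / (norm (c + \<tau>) * norm (c - \<tau>))"
      by (simp add: norm_divide norm_mult)
    also have "\<dots> \<le> 1 / (norm z * norm z)"
      using nK[OF that] plus[OF that] zpos by (intro frac_le mult_mono mult_pos_pos) auto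
    finally show ?thesis by (simp add: power2_eq_square)
  qed
  have b2: "norm (d1 \<tau>) \<le> 1 / (norm z)\<^sup>2" if "\<tau> \<in> K" for \<tau>
  proof -
    have "norm (d1 \<tau> - d1 0) \<le> 1 / (norm z)\<^sup>2 * norm (\<tau> - 0)"
      by (rule field_differentiable_bound[OF convK d1' b1]) (use that inK in auto)
    also have "\<dots> \<le> 1 / (norm z)\<^sup>2 * 1" using nK[OF that] by (intro mult_left_mono) auto
    finally show ?thesis by (simp add: d1_def)
  qed
  have "norm (d (1/2) - d 0) \<le> 1 / (norm z)\<^sup>2 * norm (1/2 - 0 :: complex)"
    by (rule field_differentiable_bound[OF convK d' b2]) (use inK in auto)
  also have "\<dots> \<le> 1 / (norm z)\<^sup>2 * 1" by (intro mult_left_mono) auto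
  finally have "norm (d (1/2) - d 0) \<le> 1 / (norm z)\<^sup>2" by simp
  moreover have "d (1/2) - d 0 = stirling_exponent (z + 1) - stirling_exponent z - Ln (z + 1/2)"
    by (simp add: d_def c_def add.assoc)
  ultimately show ?thesis by simp
qed

lemma norm_Ln_le:
  assumes "z \<noteq> 0"
  shows "norm (Ln z) \<le> \<bar>ln (norm z)\<bar> + pi"
proof -
  have "norm (Ln z) \<le> \<bar>Re (Ln z)\<bar> + \<bar>Im (Ln z)\<bar>" by (rule cmod_le)
  moreover have "\<bar>Im (Ln z)\<bar> \<le> pi"
    using assms mpi_less_Im_Ln[of z] Im_Ln_le_pi[of z] by auto
  ultimately show ?thesis using assms by simp
qed

text \<open>The bound is 2 + 8 + 2, from \<open>r * \<bar>ln r\<bar>\<close>, \<open>r * pi\<close>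
  and \<open>r\<close> with r at most 2.\<close>

lemma norm_stirling_exponent_le:
  assumes "norm z \<le> 2"
  shows "norm (stirling_exponent z) \<le> 12"
proof (cases "z = 0")
  case False
  define r where "r = norm z"
  have r: "0 < r" "r \<le> 2" using False assms by (auto simp: r_def)
  have "r * \<bar>ln r\<bar> \<le> 2"
  proof (cases "r \<ge> 1")
    case True
    then have "\<bar>ln r\<bar> \<le> 1" using ln_le_minus_one[of r] r by auto
    then have "r * \<bar>ln r\<bar> \<le> 2 * 1" using r by (intro mult_mono) auto
    then show ?thesis by simp
  next
    case False
    then have "\<bar>ln r\<bar> = ln (1/r)" using r by (simp add: ln_div)
    also have "\<dots> \<le> 1/r - 1" using r by (intro ln_le_minus_one) auto
    finally have "r * \<bar>ln r\<bar> \<le> r * (1/r - 1)" using r by (intro mult_left_mono) auto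
    also have "\<dots> = 1 - r" using r by (simp add: field_simps)
    finally show ?thesis using r by simp
  qed
  moreover have "norm (stirling_exponent z) \<le> r * (\<bar>ln r\<bar> + pi) + r"
  proof -
    have "norm (stirling_exponent z) \<le> norm (z * Ln z) + norm z"
      unfolding stirling_exponent_def by (rule norm_triangle_ineq4)
    also have "norm (z * Ln z) \<le> r * (\<bar>ln r\<bar> + pi)"
      using norm_Ln_le[OF False] r by (simp add: norm_mult r_def mult_left_mono)
    finally show ?thesis by (simp add: r_def)
  qed
  moreover have "r * pi \<le> 2 * 4" using r pi_less_4 by (intro mult_mono) auto
  ultimately show ?thesis using r by (simp add: distrib_left)
qed (simp add: stirling_exponent_def)

text \<open>Needed for the first step of the telescoping sum, where 1/|z|^2 blows up as z approaches
  0. For |z| < 1 the three terms are at most 12, 12 and 1 + pi.\<close>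

lemma midpoint_Ln_bounded:
  assumes "Re z \<ge> 0"
  shows "norm (stirling_exponent (z + 1) - stirling_exponent z - Ln (z + 1/2)) \<le> 30"
proof (cases "norm z \<ge> 1")
  case True
  then have "1 / (norm z)\<^sup>2 \<le> 1" by (simp add: divide_simps)
  moreover have "z \<noteq> 0" using True by auto
  ultimately show ?thesis using midpoint_Ln[OF assms] by linarith
next
  case False
  have "norm (z + 1) \<le> 2" using False norm_triangle_ineq[of z 1] by simp
  then have 1: "norm (stirling_exponent (z + 1)) \<le> 12" "norm (stirling_exponent z) \<le> 12"
    using False by (auto intro!: norm_stirling_exponent_le)
  define r where "r = norm (z + 1/2)"
  have lo: "r \<ge> 1/2"
    using complex_Re_le_cmod[of "z + 1/2"] assms by (simp add: r_def)
  have hi: "r \<le> 2" using False norm_triangle_ineq[of z "1/2"] by (simp add: r_def)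
  have "ln (1/r) \<le> 1/r - 1" using lo by (intro ln_le_minus_one) auto
  moreover have "1/r \<le> 2" using lo by (simp add: field_simps)
  moreover have "ln (1/r) = - ln r" using lo by (simp add: ln_div)
  moreover have "ln r \<le> r - 1" using lo by (intro ln_le_minus_one) auto
  ultimately have "\<bar>ln r\<bar> \<le> 1" using hi by linarith
  moreover have "z + 1/2 \<noteq> 0" using lo by (auto simp: r_def)
  ultimately have "norm (Ln (z + 1/2)) \<le> 1 + pi" using norm_Ln_le[of "z+1/2"] by (auto simp: r_def)
  moreover have "norm (stirling_exponent (z + 1) - stirling_exponent z - Ln (z + 1/2))
     \<le> norm (stirling_exponent (z + 1)) + norm (stirling_exponent z) + norm (Ln (z + 1/2))"
    by norm
  ultimately show ?thesis using 1 pi_less_4 by linarith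
qed

lemma sum_inverse_squares_le: "(\<Sum>k=1..m. 1 / (real k)\<^sup>2) \<le> 2"
proof -
  have *: "(\<Sum>k=1..m. 1 / (real k)\<^sup>2) \<le> 2 - 1 / real m" if "m \<ge> 1"
    using that
  proof (induction m rule: dec_induct)
    case (step n)
    have "1 / real n - 1 / real (Suc n) = 1 / (real n * real (Suc n))"
      using step.hyps by (simp add: field_simps)
    also have "\<dots> \<ge> 1 / (real (Suc n))\<^sup>2"
      using step.hyps by (auto simp: power2_eq_square intro!: divide_left_mono mult_right_mono)
    finally have "1 / (real (Suc n))\<^sup>2 \<le> 1 / real n - 1 / real (Suc n)" .
    then show ?case using step by simp
  qed simp
  show ?thesis
  proof (cases "m \<ge> 1")
    case True
    have "1 / real m \<ge> 0" by simp
    then show ?thesis using *[OF True] by linarith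
  qed simp
qed

text \<open>The midpoint estimate telescopes over z, z + 1, ..., z + m. The first step costs 30 and
  step k at most 1/k^2, since |z + k| >= k; together 32, independent of m and z.\<close>

lemma ln_norm_pochhammer_half:
  assumes "Re z \<ge> 0"
  shows "\<bar>ln (norm (pochhammer (z + 1/2) (Suc m)))
           - (Re (stirling_exponent (z + of_nat (Suc m))) - Re (stirling_exponent z))\<bar> \<le> 32"
proof -
  define e where "e = (\<lambda>k. stirling_exponent (z + of_nat (Suc k)) - stirling_exponent (z + of_nat k)
       - Ln (z + of_nat k + 1/2))"
  have e0: "norm (e 0) \<le> 30" unfolding e_def using midpoint_Ln_bounded[OF assms] by simp
  have ek: "norm (e k) \<le> 1 / (real k)\<^sup>2" if "k \<ge> 1" for k
  proof -
    have *: "real k \<le> norm (z + of_nat k)"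
      using complex_Re_le_cmod[of "z + of_nat k"] assms by simp
    then have "z + of_nat k \<noteq> 0" using that by auto
    then have "norm (e k) \<le> 1 / (norm (z + of_nat k))\<^sup>2"
      using midpoint_Ln[of "z + of_nat k"] assms unfolding e_def
      by (simp add: add_ac)
    also have "\<dots> \<le> 1 / (real k)\<^sup>2" using * that
      by (intro frac_le power_mono) auto
    finally show ?thesis .
  qed
  have "norm (\<Sum>k\<le>m. e k) \<le> (\<Sum>k\<le>m. norm (e k))" by (rule norm_sum)
  also have "\<dots> = norm (e 0) + (\<Sum>k=1..m. norm (e k))"
    by (simp add: atMost_atLeast0 sum.atLeast_Suc_atMost)
  also have "\<dots> \<le> 30 + (\<Sum>k=1..m. 1 / (real k)\<^sup>2)"
    by (intro add_mono sum_mono e0) (use ek in auto)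
  also have "\<dots> \<le> 32" using sum_inverse_squares_le[of m] by simp
  finally have le: "norm (\<Sum>k\<le>m. e k) \<le> 32" .
  have nz: "z + of_nat k + 1/2 \<noteq> 0" for k
    using assms by (auto simp: complex_eq_iff)
  have "(\<Sum>k\<le>m. e k) = (stirling_exponent (z + of_nat (Suc m)) - stirling_exponent z)
            - (\<Sum>k\<le>m. Ln (z + of_nat k + 1/2))"
  proof -
    have "(\<Sum>k\<le>m. stirling_exponent (z + of_nat (Suc k)) - stirling_exponent (z + of_nat k))
       = stirling_exponent (z + of_nat (Suc m)) - stirling_exponent z"
      by (induction m) simp_all
    then show ?thesis by (simp add: e_def sum_subtractf)
  qed
  then have "Re (\<Sum>k\<le>m. e k) = (Re (stirling_exponent (z + of_nat (Suc m))) - Re (stirling_exponent z))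
            - (\<Sum>k\<le>m. ln (norm (z + of_nat k + 1/2)))"
    using nz by (simp del: of_nat_Suc)
  moreover have "ln (norm (pochhammer (z + 1/2) (Suc m))) = (\<Sum>k\<le>m. ln (norm (z + of_nat k + 1/2)))"
  proof -
    have "norm (pochhammer (z + 1/2) (Suc m)) = (\<Prod>k\<le>m. norm (z + of_nat k + 1/2))"
      by (simp add: pochhammer_Suc_prod prod_norm add_ac atMost_atLeast0 flip: prod_norm)
    then show ?thesis using nz by (simp add: ln_prod)
  qed
  ultimately show ?thesis using le abs_Re_le_cmod[of "\<Sum>k\<le>m. e k"] by linarith
qed

text \<open>Along the segment from m + 1 to z + m + 1 the function S(u) - u Ln m has derivative Ln u
  - Ln m, which is of order 1/m. This handles the normalisation in Gauss's product for
  Gamma.\<close>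

lemma stirling_exponent_shift:
  assumes "Re z \<ge> 0"
  shows "(\<lambda>m. stirling_exponent (z + of_nat (Suc m)) - stirling_exponent (of_nat (Suc m))
             - z * of_real (ln (real m))) \<longlonglongrightarrow> 0"
proof (rule Lim_null_comparison)
  show "\<forall>\<^sub>F m in sequentially. norm (stirling_exponent (z + of_nat (Suc m)) - stirling_exponent (of_nat (Suc m))
             - z * of_real (ln (real m))) \<le> (norm z + 1) / real m * norm z"
  proof (rule eventually_mono[OF eventually_gt_at_top[of 0]])
    fix m :: nat assume m: "0 < m"
    define K where "K = {u :: complex. Re u \<ge> m}"
    have convK: "convex K" unfolding K_def by (simp add: convex_halfspace_Re_ge)
    define K' where "K' = closed_segment (of_nat (Suc m)) (z + of_nat (Suc m))"
    have K': "\<exists>r. u = of_nat (Suc m) + of_real r * z \<and> 0 \<le> r \<and> r \<le> 1" if "u \<in> K'" for u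
      using that unfolding K'_def by (auto simp: in_segment algebra_simps scaleR_conv_of_real)
    have sub: "u \<in> K" if "u \<in> K'" for u
      using K'[OF that] assms by (auto simp: K_def)
    have L: "norm (Ln u - Ln (of_nat m)) \<le> 1 / real m * norm (u - of_nat m)" if "u \<in> K" for u
    proof (rule field_differentiable_bound[OF convK, of Ln "\<lambda>u. 1 / u"])
      show "(Ln has_field_derivative 1 / v) (at v within K)" if "v \<in> K" for v
        using that m by (auto intro!: derivative_eq_intros simp: K_def complex_nonpos_Reals_iff divide_simps)
      show "norm (1 / v) \<le> 1 / real m" if "v \<in> K" for v
      proof -
        have "real m \<le> norm v" using that complex_Re_le_cmod[of v] by (auto simp: K_def)
        then show ?thesis using m by (simp add: norm_divide divide_simps)
      qed
    qed (use that in \<open>auto simp: K_def\<close>)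
    have "norm ((stirling_exponent (z + of_nat (Suc m)) - (z + of_nat (Suc m)) * Ln (of_nat m))
      - (stirling_exponent (of_nat (Suc m)) - of_nat (Suc m) * Ln (of_nat m)))
       \<le> (norm z + 1) / real m * norm ((z + of_nat (Suc m)) - of_nat (Suc m))"
    proof (rule field_differentiable_bound[of K' "\<lambda>u. stirling_exponent u - u * Ln (of_nat m)" "\<lambda>u. Ln u - Ln (of_nat m)"])
      fix u assume u: "u \<in> K'"
      have "u \<notin> \<real>\<^sub>\<le>\<^sub>0" using sub[OF u] m by (auto simp: K_def complex_nonpos_Reals_iff)
      then show "((\<lambda>u. stirling_exponent u - u * Ln (of_nat m)) has_field_derivative Ln u - Ln (of_nat m)) (at u within K')"
        by (auto intro!: derivative_eq_intros has_field_derivative_stirling_exponent)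
      obtain r where r: "u = of_nat (Suc m) + of_real r * z" "0 \<le> r" "r \<le> 1" using K'[OF u] by auto
      have "norm (u - of_nat m) \<le> 1 + r * norm z"
        using norm_triangle_ineq[of 1 "of_real r * z"] r by (simp add: norm_mult)
      also have "\<dots> \<le> 1 + norm z" using r by (simp add: mult_left_le_one_le)
      finally have "1 / real m * norm (u - of_nat m) \<le> 1 / real m * (1 + norm z)"
        by (intro mult_left_mono) auto
      then show "norm (Ln u - Ln (of_nat m)) \<le> (norm z + 1) / real m"
        using L[OF sub[OF u]] by (simp add: add_ac)
    qed (auto simp: K'_def)
    moreover have "Ln (of_nat m) = of_real (ln (real m))"
      using m by (simp flip: Ln_of_nat)
    ultimately show "norm (stirling_exponent (z + of_nat (Suc m)) - stirling_exponent (of_nat (Suc m))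
             - z * of_real (ln (real m))) \<le> (norm z + 1) / real m * norm z"
      by (simp add: algebra_simps)
  qed
  show "(\<lambda>m. (norm z + 1) / real m * norm z) \<longlonglongrightarrow> 0"
    by (rule tendsto_mult_left_zero, rule real_tendsto_divide_at_top[OF tendsto_const filterlim_real_sequentially])
qed

text \<open>Gauss's product is compared at z + 1/2 and at 1/2, so the constant of Stirling's formula
  never has to be identified. Each of the two products contributes an error of 32.\<close>

theorem stirling_half_plane:
  assumes "Re z \<ge> 0"
  shows "\<bar>ln (norm (Gamma (z + 1/2))) - ln (norm (Gamma (1/2 :: complex))) - Re (stirling_exponent z)\<bar> \<le> 64"
proof -
  define q where "q = (\<lambda>z m. ln (norm (Gamma_series (z + 1/2 :: complex) m)))"
  define b where "b = (\<lambda>m. Re (stirling_exponent (z + of_nat (Suc m)) - stirling_exponent (of_nat (Suc m))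
             - z * of_real (ln (real m))))"
  have q: "q y m = ln (fact m) + (Re y + 1/2) * ln (real m) - ln (norm (pochhammer (y + 1/2) (Suc m)))"
    if "Re y \<ge> 0" for y m
  proof -
    have "y + 1/2 \<noteq> - of_nat k" for k using that by (auto simp: complex_eq_iff)
    then have nz: "pochhammer (y + 1/2) (Suc m) \<noteq> 0" by (metis pochhammer_eq_0_iff)
    then show ?thesis
      unfolding q_def Gamma_series_def
      by (simp add: norm_mult norm_divide ln_mult ln_div del: pochhammer_Suc)
  qed
  have S0: "stirling_exponent 0 = 0" by (simp add: stirling_exponent_def)
  have bnd: "\<bar>q z m - q 0 m - Re (stirling_exponent z) + b m\<bar> \<le> 64" for m
    using ln_norm_pochhammer_half[OF assms, of m] ln_norm_pochhammer_half[of 0 m]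
    by (simp add: q assms S0 b_def distrib_right del: pochhammer_Suc of_nat_Suc)
  have lim: "(\<lambda>m. q y m) \<longlonglongrightarrow> ln (norm (Gamma (y + 1/2)))" if "Re y \<ge> 0" for y
  proof -
    have "y + 1/2 \<notin> \<int>\<^sub>\<le>\<^sub>0" using that by (auto elim!: nonpos_Ints_cases simp: complex_eq_iff)
    then show ?thesis unfolding q_def
      by (intro tendsto_intros) (auto simp: Gamma_eq_zero_iff)
  qed
  have b: "b \<longlonglongrightarrow> 0"
    unfolding b_def using tendsto_Re[OF stirling_exponent_shift[OF assms]] by (simp del: of_nat_Suc)
  have "(\<lambda>m. \<bar>q z m - q 0 m - Re (stirling_exponent z) + b m\<bar>) \<longlonglongrightarrow>
     \<bar>ln (norm (Gamma (z + 1/2))) - ln (norm (Gamma (0 + 1/2 :: complex))) - Re (stirling_exponent z) + 0\<bar>"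
    by (intro tendsto_intros lim b assms) auto
  then show ?thesis
    using LIMSEQ_le_const2[of _ _ 64] bnd by fastforce
qed

lemma Gamma_half_bounds:
  obtains C where "C > 0"
    "\<And>z. Re z \<ge> 0 \<Longrightarrow> norm (Gamma (z + 1/2)) \<le> C * exp (Re (stirling_exponent z))"
    "\<And>z. Re z \<ge> 0 \<Longrightarrow> exp (Re (stirling_exponent z)) \<le> C * norm (Gamma (z + 1/2))"
proof -
  define L where "L = \<bar>ln (norm (Gamma (1/2 :: complex)))\<bar> + 64"
  have "norm (Gamma (z + 1/2)) \<le> exp L * exp (Re (stirling_exponent z)) \<and>
        exp (Re (stirling_exponent z)) \<le> exp L * norm (Gamma (z + 1/2))" if "Re z \<ge> 0" for z
  proof -
    have "z + 1/2 \<notin> \<int>\<^sub>\<le>\<^sub>0" using that by (auto elim!: nonpos_Ints_cases simp: complex_eq_iff)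
    then have pos: "norm (Gamma (z + 1/2)) > 0" by (simp add: Gamma_eq_zero_iff)
    have 1: "ln (norm (Gamma (z + 1/2))) \<le> L + Re (stirling_exponent z)"
      and 2: "Re (stirling_exponent z) \<le> L + ln (norm (Gamma (z + 1/2)))"
      using stirling_half_plane[OF that] unfolding L_def by linarith+
    have "norm (Gamma (z + 1/2)) = exp (ln (norm (Gamma (z + 1/2))))" using pos by simp
    also have "\<dots> \<le> exp (L + Re (stirling_exponent z))" using 1 by simp
    finally have a: "norm (Gamma (z + 1/2)) \<le> exp L * exp (Re (stirling_exponent z))" by (simp add: exp_add)
    have "exp (Re (stirling_exponent z)) \<le> exp (L + ln (norm (Gamma (z + 1/2))))" using 2 by simp
    also have "\<dots> = exp L * norm (Gamma (z + 1/2))" using pos by (simp add: exp_add)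
    finally show ?thesis using a by simp
  qed
  then show ?thesis using that[of "exp L"] by simp
qed

section \<open>Reflection into the left half-plane\<close>

lemma Re_stirling_exponent_uminus:
  assumes "Im u \<noteq> 0"
  shows "Re (stirling_exponent (- u)) = - Re (stirling_exponent u) - pi * \<bar>Im u\<bar>"
proof -
  have "u \<noteq> 0" using assms by auto
  \<comment> \<open>The jump of pi in the argument, multiplied by u, produces
    \<open>pi * \<bar>Im u\<bar>\<close>, exactly the growth rate of the cosine in the reflection
    formula.\<close>
  then have "Ln (- u) = Ln u - (if Im u > 0 then 1 else - 1) * \<i> * of_real pi"
    using assms by (subst Ln_minus) (auto simp: not_less)
  then have "stirling_exponent (- u) = - stirling_exponent u
      + (if Im u > 0 then 1 else - 1) * \<i> * of_real pi * u"
    unfolding stirling_exponent_def by (simp only:) (simp add: algebra_simps)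
  then show ?thesis
    using assms by (simp only:) auto
qed

lemma norm_cos_pi_le: "norm (cos (of_real pi * u)) \<le> exp (pi * \<bar>Im u\<bar>)"
proof -
  have "norm (cos (of_real pi * u)) = norm (exp (\<i> * (of_real pi * u)) + exp (- (\<i> * (of_real pi * u)))) / 2"
    by (simp add: cos_exp_eq norm_divide)
  also have "\<dots> \<le> (exp (- (pi * Im u)) + exp (pi * Im u)) / 2"
    by (intro divide_right_mono order.trans[OF norm_triangle_ineq]) (auto simp: norm_exp_eq_Re)
  also have "exp (- (pi * Im u)) \<le> exp (pi * \<bar>Im u\<bar>)"
    using abs_ge_minus_self[of "pi * Im u"] by (simp add: abs_mult)
  also have "exp (pi * Im u) \<le> exp (pi * \<bar>Im u\<bar>)"
    by simp
  finally show ?thesis by simp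
qed

lemma rGamma_half_reflection:
  "rGamma (u + 1/2) * of_real pi = Gamma (1/2 - u) * cos (of_real pi * u)"
  if "Re u < 0" for u :: complex
proof -
  have "1/2 - u \<notin> \<int>\<^sub>\<le>\<^sub>0" using that by (auto elim!: nonpos_Ints_cases simp: complex_eq_iff)
  then have nz: "Gamma (1/2 - u) \<noteq> 0" by (simp add: Gamma_eq_zero_iff)
  have "rGamma (u + 1/2) * rGamma (1 - (u + 1/2)) = sin (of_real pi * (u + 1/2)) / of_real pi"
    by (rule rGamma_reflection_complex)
  moreover have "1 - (u + 1/2) = 1/2 - u" by simp
  moreover have "sin (of_real pi * (u + 1/2)) = cos (of_real pi * u)"
    by (simp add: distrib_left sin_add)
  ultimately have "rGamma (u + 1/2) * rGamma (1/2 - u) * of_real pi = cos (of_real pi * u)"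
    by simp
  moreover have "rGamma (1/2 - u) * Gamma (1/2 - u) = 1"
    using nz unfolding rGamma_inverse_Gamma by simp
  ultimately show ?thesis by (metis mult.assoc mult.commute mult.right_neutral)
qed

text \<open>For Re u < 0 the reflection formula replaces 1/Gamma by Gamma(1/2 - u) cos(pi u); the
  growth of the cosine cancels the extra term of \<open>Re_stirling_exponent_uminus\<close>, so both
  half-planes obey the same bound.\<close>

lemma rGamma_half_upper:
  obtains C where "C > 0"
    "\<And>u. Im u \<noteq> 0 \<Longrightarrow> norm (rGamma (u + 1/2)) \<le> C * exp (- Re (stirling_exponent u))"
proof -
  obtain C where C: "C > 0"
    "\<And>z. Re z \<ge> 0 \<Longrightarrow> norm (Gamma (z + 1/2)) \<le> C * exp (Re (stirling_exponent z))"
    "\<And>z. Re z \<ge> 0 \<Longrightarrow> exp (Re (stirling_exponent z)) \<le> C * norm (Gamma (z + 1/2))"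
    by (rule Gamma_half_bounds) blast
  have "norm (rGamma (u + 1/2)) \<le> C * exp (- Re (stirling_exponent u))" if "Im u \<noteq> 0" for u
  proof (cases "Re u \<ge> 0")
    case True
    have "u + 1/2 \<notin> \<int>\<^sub>\<le>\<^sub>0" using True by (auto elim!: nonpos_Ints_cases simp: complex_eq_iff)
    then have "norm (Gamma (u + 1/2)) > 0" by (simp add: Gamma_eq_zero_iff)
    with C(3)[OF True] show ?thesis
      unfolding rGamma_inverse_Gamma norm_inverse exp_minus
      by (simp add: divide_simps mult.commute)
  next
    case False
    have "norm (Gamma (- u + 1/2)) * norm (cos (of_real pi * u))
        \<le> (C * exp (Re (stirling_exponent (- u)))) * exp (pi * \<bar>Im u\<bar>)"
      using C False norm_cos_pi_le C(2)[of "- u"] by (intro mult_mono) auto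
    also have "\<dots> = C * exp (- Re (stirling_exponent u))"
      by (simp add: Re_stirling_exponent_uminus[OF that] exp_diff)
    finally have "norm (rGamma (u + 1/2) * of_real pi) \<le> C * exp (- Re (stirling_exponent u))"
      using rGamma_half_reflection[of u] False by (simp add: norm_mult)
    then have "norm (rGamma (u + 1/2)) * 1 \<le> C * exp (- Re (stirling_exponent u))"
      using pi_gt3 mult_left_mono[of 1 pi "norm (rGamma (u + 1/2))"] by (simp add: norm_mult)
    then show ?thesis by simp
  qed
  then show ?thesis using that C(1) by blast
qed

text \<open>In the left half-plane 1/Gamma(u + 1/2) vanishes at the zeros of cos(pi u). The
  condition with \<open>K\<close> says that the cosine has its full exponential size at u.\<close>

lemma rGamma_half_lower:
  assumes "K > 0"
  obtains C where "C > 0"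
    "\<And>u. Re u \<ge> 0 \<or> Im u \<noteq> 0 \<and> exp (pi * \<bar>Im u\<bar>) \<le> K * norm (cos (of_real pi * u)) \<Longrightarrow>
        exp (- Re (stirling_exponent u)) \<le> C * norm (rGamma (u + 1/2))"
proof -
  obtain C where C: "C > 0"
    "\<And>z. Re z \<ge> 0 \<Longrightarrow> norm (Gamma (z + 1/2)) \<le> C * exp (Re (stirling_exponent z))"
    "\<And>z. Re z \<ge> 0 \<Longrightarrow> exp (Re (stirling_exponent z)) \<le> C * norm (Gamma (z + 1/2))"
    by (rule Gamma_half_bounds) blast
  have 1: "exp (- Re (stirling_exponent u)) \<le> C * norm (rGamma (u + 1/2))" if "Re u \<ge> 0" for u
  proof -
    have "u + 1/2 \<notin> \<int>\<^sub>\<le>\<^sub>0" using that by (auto elim!: nonpos_Ints_cases simp: complex_eq_iff)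
    then have "norm (Gamma (u + 1/2)) > 0" by (simp add: Gamma_eq_zero_iff)
    with C(2)[OF that] show ?thesis
      unfolding rGamma_inverse_Gamma norm_inverse exp_minus
      by (simp add: divide_simps mult.commute)
  qed
  have 2: "exp (- Re (stirling_exponent u)) \<le> (C * K * pi) * norm (rGamma (u + 1/2))"
    if "Re u < 0" "Im u \<noteq> 0" "exp (pi * \<bar>Im u\<bar>) \<le> K * norm (cos (of_real pi * u))" for u
  proof -
    have "exp (- Re (stirling_exponent u)) = exp (Re (stirling_exponent (- u))) * exp (pi * \<bar>Im u\<bar>)"
      by (simp add: Re_stirling_exponent_uminus[OF that(2)] exp_diff)
    also have "\<dots> \<le> (C * norm (Gamma (- u + 1/2))) * (K * norm (cos (of_real pi * u)))"
      using C that C(3)[of "- u"] by (intro mult_mono) auto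
    also have "\<dots> = C * K * norm (Gamma (1/2 - u) * cos (of_real pi * u))"
      by (simp add: norm_mult)
    also have "\<dots> = C * K * pi * norm (rGamma (u + 1/2))"
      unfolding rGamma_half_reflection[OF that(1), symmetric] by (simp add: norm_mult)
    finally show ?thesis .
  qed
  show ?thesis
  proof (rule that[of "max C (C * K * pi)"])
    fix u assume u: "Re u \<ge> 0 \<or> Im u \<noteq> 0 \<and> exp (pi * \<bar>Im u\<bar>) \<le> K * norm (cos (of_real pi * u))"
    have "C * norm (rGamma (u + 1/2)) \<le> max C (C * K * pi) * norm (rGamma (u + 1/2))"
      "C * K * pi * norm (rGamma (u + 1/2)) \<le> max C (C * K * pi) * norm (rGamma (u + 1/2))"
      by (intro mult_right_mono; simp)+
    then show "exp (- Re (stirling_exponent u)) \<le> max C (C * K * pi) * norm (rGamma (u + 1/2))"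
      using 1[of u] 2[of u] u by (cases "Re u \<ge> 0") force+
  qed (use C in auto)
qed

text \<open>Excludes the zeros of the cosine in the reflection formula on the part of the contour where
  $\mathrm{Re}\, (z - 1)$ may be negative.\<close>

lemma norm_cos_pi_sector_ge:
  assumes "\<kappa> > 0"
  obtains K where "K > 0"
    "\<And>w n. Re w \<ge> 0 \<Longrightarrow> \<bar>Im w\<bar> \<ge> \<kappa> * Re w \<Longrightarrow>
       exp (pi * \<bar>Im w\<bar>) \<le> K * norm (cos (of_real pi * (w - of_nat n)))"
proof -
  \<comment> \<open>Below this height the sector forces Re w < 1/4, where the cosine of pi Re w is
    at least 1/2; above it the hyperbolic sine is comparable to the exponential.\<close>
  define k where "k = \<kappa> / 4"
  have k: "k > 0" using assms by (simp add: k_def)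
  define A where "A = (1 - exp (- 2 * pi * k)) / 2"
  have A: "A > 0" using k by (simp add: A_def)
  define K where "K = max (1 / A) (2 * exp (pi * k))"
  have "exp (pi * \<bar>Im w\<bar>) \<le> K * norm (cos (of_real pi * (w - of_nat n)))"
    if w: "Re w \<ge> 0" "\<bar>Im w\<bar> \<ge> \<kappa> * Re w" for w n
  proof -
    define y where "y = pi * \<bar>Im w\<bar>"
    define N where "N = norm (cos (of_real pi * (w - of_nat n)))"
    have y: "y \<ge> 0" by (simp add: y_def)
    \<comment> \<open>This is |cos(x + iy)|^2 = cos^2 x + sinh^2 y; the integer shift n only changes
      the sign of the cosine, hence K is uniform in n.\<close>
    have sq: "N\<^sup>2 = (cos (pi * Re w))\<^sup>2 + ((exp y - exp (- y)) / 2)\<^sup>2"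
    proof -
      have c: "(cos (pi * (Re w - real n)))\<^sup>2 = (cos (pi * Re w))\<^sup>2"
      proof -
        have "pi * (Re w - real n) = pi * Re w - pi * real n" by (simp add: algebra_simps)
        then show ?thesis by (simp add: cos_diff power_mult_distrib flip: power_mult)
      qed
      have e: "(exp (pi * Im w) - inverse (exp (pi * Im w)))\<^sup>2 = (exp y - exp (- y))\<^sup>2"
        by (cases "Im w \<ge> 0") (auto simp: y_def exp_minus power2_commute)
      show ?thesis unfolding N_def
        by (subst norm_cos_squared) (use c e in \<open>simp add: power_divide\<close>)
    qed
    have "exp y \<le> K * N"
    proof (cases "\<bar>Im w\<bar> \<ge> k")
      case True
      have "((exp y - exp (- y)) / 2)\<^sup>2 \<le> N\<^sup>2" using sq by simp
      then have "(exp y - exp (- y)) / 2 \<le> N"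
        by (rule power2_le_imp_le) (simp add: N_def)
      moreover have "A * exp y \<le> (exp y - exp (- y)) / 2"
      proof -
        have "exp (- 2 * y) \<le> exp (- 2 * pi * k)" using True k by (simp add: y_def)
        then have "exp (- 2 * y) * exp y \<le> exp (- 2 * pi * k) * exp y" by (intro mult_right_mono) auto
        then have "exp (- y) \<le> exp (- 2 * pi * k) * exp y" by (simp flip: exp_add)
        then show ?thesis by (simp add: A_def left_diff_distrib)
      qed
      ultimately have "A * exp y \<le> N" by linarith
      then have "exp y \<le> 1 / A * N" using A by (simp add: field_simps)
      also have "\<dots> \<le> K * N" by (intro mult_right_mono) (auto simp: K_def N_def)
      finally show ?thesis .
    next
      case False
      then have "\<kappa> * Re w < \<kappa> * (1/4)" using w by (simp add: k_def)
      then have "Re w < 1/4" using assms by simp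
      then have "cos (pi * Re w) \<ge> cos (pi / 3)" using w by (intro cos_monotone_0_pi_le) auto
      then have "(1/2)\<^sup>2 \<le> (cos (pi * Re w))\<^sup>2" by (intro power_mono) (auto simp: cos_60)
      then have "(1/2)\<^sup>2 \<le> N\<^sup>2" using sq by (smt (verit) zero_le_power2)
      then have N: "1/2 \<le> N" by (rule power2_le_imp_le) (simp add: N_def)
      have "exp y \<le> 2 * exp (pi * k) * (1/2)" using False by (simp add: y_def)
      also have "\<dots> \<le> K * N" using N A by (intro mult_mono) (auto simp: K_def le_max_iff_disj)
      finally show ?thesis .
    qed
    then show ?thesis by (simp add: y_def N_def)
  qed
  moreover have "K > 0" using A by (simp add: K_def less_max_iff_disj)
  ultimately show ?thesis using that by blast
qed

section \<open>The saddle point curve\<close>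

text \<open>The quotient $\sin (M\theta) / \sin \theta$, as a sum in order to be smooth at $0$.\<close>

definition sin_ratio :: "nat \<Rightarrow> real \<Rightarrow> real" where
  "sin_ratio M \<theta> = (\<Sum>j<M. cos ((real M - 1 - 2 * real j) * \<theta>))"

text \<open>For 0 < \<theta> < pi/(M+1) this is sin((M+1)\<theta>)/sin(M\<theta>) times cis
  \<theta>. The form chosen here is smooth through \<theta> = 0, closes up with the mirror image,
  and displays (M+1)\<theta> as the argument of z - 1.\<close>

definition saddle_curve :: "nat \<Rightarrow> real \<Rightarrow> complex" where
  "saddle_curve M \<theta> = 1 + cis (real (M + 1) * \<theta>) / of_real (sin_ratio M \<theta>)"

text \<open>The value x for which the point z of the curve with parameter \<theta> solves z^(M+1) =
  x (z - 1), the saddle point equation.\<close>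

definition bulk_param :: "nat \<Rightarrow> real \<Rightarrow> real" where
  "bulk_param M \<theta> = sin (real (M + 1) * \<theta>) ^ (M + 1) / (sin \<theta> * sin (real M * \<theta>) ^ M)"

definition phase :: "nat \<Rightarrow> real \<Rightarrow> complex \<Rightarrow> complex" where
  "phase M x z = of_nat (M + 1) * stirling_exponent z - stirling_exponent (z - 1) - z * of_real (ln x)"

text \<open>Product-to-sum turns each summand into a difference of sines with neighbouring
  frequencies, and the sum telescopes.\<close>

lemma sin_mult_sin_ratio: "sin \<theta> * sin_ratio M \<theta> = sin (real M * \<theta>)"
proof -
  define g where "g = (\<lambda>j. sin ((real M - 2 * real j) * \<theta>))"
  have "sin \<theta> * cos ((real M - 1 - 2 * real j) * \<theta>) = (g j - g (Suc j)) / 2" for j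
  proof -
    define B where "B = (real M - 1 - 2 * real j) * \<theta>"
    have "(real M - 2 * real j) * \<theta> = B + \<theta>" "(real M - 2 * real (Suc j)) * \<theta> = B - \<theta>"
      by (simp_all add: B_def algebra_simps)
    then have "g j - g (Suc j) = 2 * (sin \<theta> * cos B)"
      by (simp only: g_def sin_add sin_diff) simp
    then show ?thesis by (simp add: B_def)
  qed
  then have "sin \<theta> * sin_ratio M \<theta> = (\<Sum>j<M. (g j - g (Suc j)) / 2)"
    by (simp only: sin_ratio_def sum_distrib_left)
  also have "\<dots> = (g 0 - g M) / 2"
    by (subst sum_divide_distrib[symmetric]) (simp only: sum_lessThan_telescope')
  also have "\<dots> = sin (real M * \<theta>)"
    by (simp add: g_def)
  finally show ?thesis .
qed

lemma sin_ratio_minus [simp]: "sin_ratio M (- \<theta>) = sin_ratio M \<theta>"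
  by (simp add: sin_ratio_def)

lemma saddle_curve_minus: "saddle_curve M (- \<theta>) = cnj (saddle_curve M \<theta>)"
  by (simp add: saddle_curve_def cis_cnj)

lemma Im_Ln_upper:
  assumes "Im z > 0"
  shows "Im (Ln z) = pi / 2 - arctan (Re z / Im z)"
proof -
  define q where "q = Re z / Im z"
  have z: "z = of_real (Im z) * Complex q 1"
    using assms by (simp add: q_def complex_eq_iff)
  have sq: "sqrt (1 + q\<^sup>2) > 0" by (simp add: add_pos_nonneg)
  have "exp (of_real (ln (Im z * sqrt (1 + q\<^sup>2))) + \<i> * of_real (pi / 2 - arctan q)) =
      of_real (Im z * sqrt (1 + q\<^sup>2)) * cis (pi / 2 - arctan q)"
    using assms sq by (simp add: exp_add exp_of_real cis_conv_exp flip: exp_of_real del: exp_ln) (simp add: exp_of_real)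
  also have "\<dots> = z"
    using assms sq by (subst z) (simp add: complex_eq_iff cos_diff sin_diff sin_arctan cos_arctan)
  finally have "Ln z = of_real (ln (Im z * sqrt (1 + q\<^sup>2))) + \<i> * of_real (pi / 2 - arctan q)"
    using arctan_bounded[of q] by (intro Ln_unique) auto
  then show ?thesis by (simp add: q_def)
qed

lemma Ln_of_real_mult_cis:
  assumes "r > 0" "- pi < t" "t \<le> pi"
  shows "Ln (of_real r * cis t) = of_real (ln r) + \<i> * of_real t"
proof (rule Ln_unique)
  show "exp (of_real (ln r) + \<i> * of_real t) = of_real r * cis t"
    using assms by (simp add: exp_add cis_conv_exp exp_of_real)
qed (use assms in auto)

text \<open>The weak inequality for absolute values goes by induction with the addition formula;
  strictness comes from one last addition step, where |cos t| < 1.\<close>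

lemma sin_nat_mult_less:
  assumes "k \<ge> 2" "0 < t" "t < pi"
  shows "sin (real k * t) < real k * sin t"
proof -
  have st: "sin t > 0" using assms sin_gt_zero by auto
  have ct: "\<bar>cos t\<bar> < 1"
  proof -
    have "(sin t)\<^sup>2 > 0" using st by simp
    then have "(cos t)\<^sup>2 < 1" using sin_cos_squared_add[of t] by linarith
    then show ?thesis by (simp add: abs_square_less_1)
  qed
  have "\<bar>sin (real k * t)\<bar> \<le> real k * sin t" for k
  proof (induction k)
    case (Suc k)
    have "real (Suc k) * t = real k * t + t" by (simp add: algebra_simps)
    then have "\<bar>sin (real (Suc k) * t)\<bar> = \<bar>sin (real k * t) * cos t + cos (real k * t) * sin t\<bar>"
      by (simp only: sin_add)
    also have "\<dots> \<le> \<bar>sin (real k * t)\<bar> * \<bar>cos t\<bar> + \<bar>cos (real k * t)\<bar> * sin t"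
      using st by (intro order.trans[OF abs_triangle_ineq]) (simp add: abs_mult)
    also have "\<dots> \<le> (real k * sin t) * 1 + 1 * sin t"
      using Suc st by (intro add_mono mult_mono) auto
    finally show ?case by (simp add: distrib_right)
  qed simp
  note le = this
  obtain j where j: "k = Suc j" "j \<ge> 1" using assms by (cases k) auto
  have "sin (real k * t) = sin (real j * t) * cos t + cos (real j * t) * sin t"
    unfolding j by (simp add: distrib_right sin_add add.commute)
  also have "\<dots> \<le> \<bar>sin (real j * t)\<bar> * \<bar>cos t\<bar> + cos (real j * t) * sin t"
    by (simp flip: abs_mult)
  also have "\<dots> \<le> (real j * sin t) * \<bar>cos t\<bar> + 1 * sin t"
    using le[of j] st by (intro add_mono mult_right_mono) auto
  also have "\<dots> < (real j * sin t) * 1 + 1 * sin t"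
    using st ct j by (intro add_strict_right_mono mult_strict_left_mono) auto
  finally show ?thesis by (simp add: j distrib_right)
qed

text \<open>Near p the nonzero derivative gives slope |D|/2. Away from p monotonicity keeps |g x - g
  p| above a positive gap, and |x - p| is at most the length of the interval.\<close>

lemma strict_decreasing_linear_bound:
  fixes g :: "real \<Rightarrow> real"
  assumes p: "l < p" "p < u"
    and dec: "\<And>x y. l < x \<Longrightarrow> x < y \<Longrightarrow> y < u \<Longrightarrow> g y < g x"
    and der: "(g has_real_derivative D) (at p)" and D: "D \<noteq> 0"
  obtains c where "c > 0" "\<And>x. l < x \<Longrightarrow> x < u \<Longrightarrow> c * \<bar>x - p\<bar> \<le> \<bar>g x - g p\<bar>"
proof -
  have "((\<lambda>h. (g (p + h) - g p) / h) \<longlongrightarrow> D) (at 0)"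
    using der by (simp add: DERIV_def)
  then have "((\<lambda>h. \<bar>(g (p + h) - g p) / h\<bar>) \<longlongrightarrow> \<bar>D\<bar>) (at 0)"
    by (rule tendsto_rabs)
  then have "\<forall>\<^sub>F h in at 0. \<bar>(g (p + h) - g p) / h\<bar> > \<bar>D\<bar> / 2"
    by (rule order_tendstoD) (use D in auto)
  then obtain d0 where d0: "d0 > 0" "\<And>h. h \<noteq> 0 \<Longrightarrow> \<bar>h\<bar> < d0 \<Longrightarrow> \<bar>(g (p + h) - g p) / h\<bar> > \<bar>D\<bar> / 2"
    by (auto simp: eventually_at dist_real_def)
  define d where "d = Min {d0 / 2, (p - l) / 2, (u - p) / 2}"
  have d: "d > 0" "d < d0" "l < p - d" "p + d < u"
  proof -
    have 1: "d \<le> d0 / 2" "d \<le> (p - l) / 2" "d \<le> (u - p) / 2" unfolding d_def by (rule Min_le; simp)+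
    show "d < d0" using 1(1) d0(1) by linarith
    show "l < p - d" using 1(2) p(1) by (simp add: field_simps)
    show "p + d < u" using 1(3) p(2) by (simp add: field_simps)
  qed (use p d0 in \<open>auto simp: d_def\<close>)
  define m where "m = min (g (p - d) - g p) (g p - g (p + d))"
  have m: "m > 0" using dec[of "p - d" p] dec[of p "p + d"] d p by (auto simp: m_def)
  define c where "c = min (\<bar>D\<bar> / 2) (m / (u - l))"
  have c: "c > 0" using D m p by (auto simp: c_def)
  have "c * \<bar>x - p\<bar> \<le> \<bar>g x - g p\<bar>" if x: "l < x" "x < u" for x
  proof -
    consider "x = p" | "x \<noteq> p" "\<bar>x - p\<bar> \<le> d" | "x < p - d" | "x > p + d" by linarith
    then show ?thesis
    proof cases
      case 2
      have "\<bar>D\<bar> / 2 < \<bar>(g (p + (x - p)) - g p) / (x - p)\<bar>"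
        using 2 d by (intro d0(2)) auto
      then have "\<bar>D\<bar> / 2 * \<bar>x - p\<bar> \<le> \<bar>g x - g p\<bar>"
        using 2 by (simp add: abs_divide field_simps)
      moreover have "c * \<bar>x - p\<bar> \<le> \<bar>D\<bar> / 2 * \<bar>x - p\<bar>"
        unfolding c_def by (intro mult_right_mono min.cobounded1) auto
      ultimately show ?thesis by linarith
    next
      case 3
      have "c * \<bar>x - p\<bar> \<le> m / (u - l) * (u - l)"
        using m x p by (intro mult_mono) (auto simp: c_def)
      then have "c * \<bar>x - p\<bar> \<le> m" using p by simp
      moreover have "g (p - d) < g x" using dec[of x "p - d"] 3 x d p by auto
      ultimately show ?thesis unfolding m_def by linarith
    next
      case 4
      have "c * \<bar>x - p\<bar> \<le> m / (u - l) * (u - l)"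
        using m x p by (intro mult_mono) (auto simp: c_def)
      then have "c * \<bar>x - p\<bar> \<le> m" using p by simp
      moreover have "g x < g (p + d)" using dec[of "p + d" x] 4 x d p by auto
      ultimately show ?thesis unfolding m_def by linarith
    qed simp
  qed
  with c that show ?thesis by blast
qed

lemma has_field_derivative_phase:
  assumes "Im z > 0"
  shows "(phase M x has_field_derivative of_nat (M + 1) * Ln z - Ln (z - 1) - of_real (ln x)) (at z within A)"
proof -
  have "z \<notin> \<real>\<^sub>\<le>\<^sub>0" "z - 1 \<notin> \<real>\<^sub>\<le>\<^sub>0" using assms by (auto simp: complex_nonpos_Reals_iff)
  then have 1: "(stirling_exponent has_field_derivative Ln z) (at z within A)"
    by (intro has_field_derivative_stirling_exponent)
  have 2: "((\<lambda>z. stirling_exponent (z - 1)) has_field_derivative Ln (z - 1) * 1) (at z within A)"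
    by (rule DERIV_chain2[OF has_field_derivative_stirling_exponent])
       (use \<open>z - 1 \<notin> \<real>\<^sub>\<le>\<^sub>0\<close> in \<open>auto intro!: derivative_eq_intros\<close>)
  show ?thesis unfolding phase_def
    by (rule derivative_eq_intros 1 2 refl)+ simp
qed

section \<open>Geometry of the saddle curve: monotonicity and real phase derivative\<close>

locale factor_count =
  fixes M :: nat
  assumes M: "M \<ge> 1"
begin

definition \<theta>max :: real where "\<theta>max = pi / real (M + 1)"

lemma \<theta>max: "0 < \<theta>max" "\<theta>max \<le> pi / 2" "real (M + 1) * \<theta>max = pi"
proof -
  have "pi / real (M + 1) \<le> pi / 2" using M by (intro divide_left_mono) auto
  then show "0 < \<theta>max" "\<theta>max \<le> pi / 2" "real (M + 1) * \<theta>max = pi" by (auto simp: \<theta>max_def)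
qed

lemma angle_bounds:
  assumes "0 < \<theta>" "\<theta> < \<theta>max"
  shows "real (M + 1) * \<theta> < pi" "real M * \<theta> < pi" "\<theta> < pi / 2" "2 * \<theta> < pi"
proof -
  have "real (M + 1) * \<theta> < real (M + 1) * \<theta>max" using assms by (intro mult_strict_left_mono) auto
  then show "real (M + 1) * \<theta> < pi" unfolding \<theta>max(3) .
  moreover have "real (M + 1) * \<theta> = real M * \<theta> + \<theta>" by (simp add: distrib_right)
  ultimately show "real M * \<theta> < pi" using assms by linarith
qed (use assms \<theta>max in auto)

lemma sin_pos:
  assumes "0 < \<theta>" "\<theta> < \<theta>max"
  shows "sin \<theta> > 0" "cos \<theta> > 0" "sin (real M * \<theta>) > 0" "sin (real (M + 1) * \<theta>) > 0"
  using angle_bounds[OF assms] assms M by (auto intro!: sin_gt_zero cos_gt_zero)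

lemma sin_ratio_pos:
  assumes "\<bar>\<theta>\<bar> \<le> \<theta>max"
  shows "sin_ratio M \<theta> > 0"
proof -
  have pos: "sin_ratio M t > 0" if "0 < t" "t \<le> \<theta>max" for t
  proof -
    have "real M * t + t = real (M + 1) * t" by (simp add: distrib_right)
    also have "\<dots> \<le> real (M + 1) * \<theta>max" using that by (intro mult_left_mono) auto
    finally have "real M * t < pi" using \<theta>max that by simp
    then have "sin (real M * t) > 0" "sin t > 0"
      using that M \<theta>max by (auto intro!: sin_gt_zero)
    then show ?thesis using sin_mult_sin_ratio[of t M] by (metis zero_less_mult_pos)
  qed
  consider "\<theta> > 0" | "\<theta> < 0" | "\<theta> = 0" by linarith
  then show ?thesis
  proof cases
    case 2
    then show ?thesis using pos[of "- \<theta>"] assms by simp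
  next
    case 3
    then show ?thesis using M by (simp add: sin_ratio_def)
  qed (use pos assms in auto)
qed

text \<open>Law of sines in the triangle 0, 1, z, whose angles are \<theta> at 0, pi - (M+1)\<theta>
  at 1 and M\<theta> at z.\<close>

lemma saddle_curve_polar:
  assumes "0 < \<theta>" "\<theta> < \<theta>max"
  shows "saddle_curve M \<theta> = of_real (sin (real (M + 1) * \<theta>) / sin (real M * \<theta>)) * cis \<theta>"
    and "saddle_curve M \<theta> - 1 = of_real (sin \<theta> / sin (real M * \<theta>)) * cis (real (M + 1) * \<theta>)"
proof -
  note p = sin_pos[OF assms]
  have r: "sin_ratio M \<theta> = sin (real M * \<theta>) / sin \<theta>"
    using sin_mult_sin_ratio[of \<theta> M] p by (simp add: field_simps)
  show 2: "saddle_curve M \<theta> - 1 = of_real (sin \<theta> / sin (real M * \<theta>)) * cis (real (M + 1) * \<theta>)"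
    using p by (simp add: saddle_curve_def r)
  have e: "real (M + 1) * \<theta> = real M * \<theta> + \<theta>" by (simp add: distrib_right)
  define A where "A = real M * \<theta>"
  have "of_real (sin A) + of_real (sin \<theta>) * cis (A + \<theta>) = of_real (sin (A + \<theta>)) * cis \<theta>"
  proof -
    have "sin A + sin \<theta> * cos (A + \<theta>) = sin (A + \<theta>) * cos \<theta>"
      using sin_diff[of "A + \<theta>" \<theta>] by (simp add: algebra_simps)
    then show ?thesis by (simp add: complex_eq_iff)
  qed
  then have "1 + of_real (sin \<theta> / sin A) * cis (A + \<theta>) = of_real (sin (A + \<theta>) / sin A) * cis \<theta>"
    using p by (simp add: A_def field_simps)
  then show "saddle_curve M \<theta> = of_real (sin (real (M + 1) * \<theta>) / sin (real M * \<theta>)) * cis \<theta>"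
    using 2 unfolding e A_def by (simp add: algebra_simps)
qed

lemma Re_saddle_curve:
  assumes "0 < \<theta>" "\<theta> < \<theta>max"
  shows "Re (saddle_curve M \<theta>) = sin (real (M + 1) * \<theta>) * cos \<theta> / sin (real M * \<theta>)"
  by (simp add: saddle_curve_polar[OF assms])

lemma Im_saddle_curve:
  assumes "0 < \<theta>" "\<theta> < \<theta>max"
  shows "Im (saddle_curve M \<theta>) = sin (real (M + 1) * \<theta>) * sin \<theta> / sin (real M * \<theta>)"
  by (simp add: saddle_curve_polar[OF assms])

lemma saddle_curve_quadrant:
  assumes "0 < \<theta>" "\<theta> < \<theta>max"
  shows "Re (saddle_curve M \<theta>) > 0" "Im (saddle_curve M \<theta>) > 0"
  using sin_pos[OF assms] by (auto simp: Re_saddle_curve[OF assms] Im_saddle_curve[OF assms])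

lemma sin_ratio_has_derivative:
  "(sin_ratio M has_real_derivative
     (\<Sum>j<M. - sin ((real M - 1 - 2 * real j) * \<theta>) * (real M - 1 - 2 * real j))) (at \<theta> within A)"
  unfolding sin_ratio_def by (auto intro!: derivative_eq_intros sum.cong)

lemma saddle_curve_C1:
  obtains D where "\<And>\<theta>. \<bar>\<theta>\<bar> \<le> \<theta>max \<Longrightarrow> (saddle_curve M has_vector_derivative D \<theta>) (at \<theta>)"
    "continuous_on {-\<theta>max..\<theta>max} D"
proof -
  define sr' where "sr' = (\<lambda>\<theta>. (\<Sum>j<M. - sin ((real M - 1 - 2 * real j) * \<theta>) * (real M - 1 - 2 * real j)))"
  define D :: "real \<Rightarrow> complex" where
    "D = (\<lambda>\<theta>. of_real (1 / sin_ratio M \<theta>) * (of_real (real (M + 1)) * (\<i> * cis (real (M + 1) * \<theta>)))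
        + of_real (- sr' \<theta> / (sin_ratio M \<theta>)\<^sup>2) * cis (real (M + 1) * \<theta>))"
  show ?thesis
  proof (rule that[of D])
    fix \<theta> assume t: "\<bar>\<theta>\<bar> \<le> \<theta>max"
    have nz: "sin_ratio M \<theta> \<noteq> 0" using sin_ratio_pos[OF t] by simp
    have 1: "((\<lambda>\<theta>. 1 / sin_ratio M \<theta>) has_real_derivative - sr' \<theta> / (sin_ratio M \<theta>)\<^sup>2) (at \<theta>)"
      using nz sin_ratio_has_derivative[of \<theta>] unfolding sr'_def
      by (auto intro!: derivative_eq_intros simp: power2_eq_square)
    have 2: "((\<lambda>\<theta>. cis (real (M + 1) * \<theta>)) has_vector_derivative of_real (real (M + 1)) * (\<i> * cis (real (M + 1) * \<theta>))) (at \<theta>)"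
    proof -
      have "((\<lambda>z. exp (\<i> * of_real (real (M + 1)) * z)) has_field_derivative
          of_real (real (M + 1)) * (\<i> * cis (real (M + 1) * \<theta>))) (at (of_real \<theta>))"
        by (auto intro!: derivative_eq_intros simp: cis_conv_exp mult_ac)
      then show ?thesis
        using has_vector_derivative_real_field[of "\<lambda>z. exp (\<i> * of_real (real (M + 1)) * z)"]
        by (simp add: cis_conv_exp mult.assoc)
    qed
    have "((\<lambda>\<theta>. 1 + of_real (1 / sin_ratio M \<theta>) * cis (real (M + 1) * \<theta>)) has_vector_derivative D \<theta>) (at \<theta>)"
      using has_vector_derivative_add[OF has_vector_derivative_const[of 1]
         has_vector_derivative_mult[OF has_vector_derivative_of_real[OF 1] 2]]
      by (rule has_vector_derivative_eq_rhs) (simp only: D_def add_0)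
    moreover have "(\<lambda>\<theta>. 1 + of_real (1 / sin_ratio M \<theta>) * cis (real (M + 1) * \<theta>)) = saddle_curve M"
      by (simp add: saddle_curve_def fun_eq_iff)
    ultimately show "(saddle_curve M has_vector_derivative D \<theta>) (at \<theta>)" by simp
  next
    show "continuous_on {-\<theta>max..\<theta>max} D"
    proof -
      have 1: "continuous_on {-\<theta>max..\<theta>max} (sin_ratio M)" "continuous_on {-\<theta>max..\<theta>max} sr'"
        unfolding sr'_def sin_ratio_def by (intro continuous_intros)+
      have 2: "sin_ratio M \<theta> \<noteq> 0" if "\<theta> \<in> {-\<theta>max..\<theta>max}" for \<theta>
        using sin_ratio_pos[of \<theta>] that by (auto simp: abs_le_iff)
      show ?thesis
        unfolding D_def cis_conv_exp by (intro continuous_intros 1 ballI) (simp_all add: 2)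
    qed
  qed
qed

text \<open>Monotonicity of the real part makes the vertical line through the saddle points meet the
  curve nowhere else; the strict sign of the derivative makes the crossing transversal.\<close>

lemma Re_saddle_curve_derivative:
  assumes "0 < \<theta>" "\<theta> < \<theta>max"
  obtains D where "D < 0" "((\<lambda>\<theta>. Re (saddle_curve M \<theta>)) has_real_derivative D) (at \<theta>)"
proof -
  note p = sin_pos[OF assms]
  define N where "N = (cos (real (M + 1) * \<theta>) * real (M + 1) * cos \<theta> - sin (real (M + 1) * \<theta>) * sin \<theta>) * sin (real M * \<theta>)
     - sin (real (M + 1) * \<theta>) * cos \<theta> * (cos (real M * \<theta>) * real M)"
  have "((\<lambda>\<theta>. sin (real (M + 1) * \<theta>) * cos \<theta> / sin (real M * \<theta>)) has_real_derivative N / (sin (real M * \<theta>))\<^sup>2) (at \<theta>)"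
    using p unfolding N_def by (auto intro!: derivative_eq_intros simp: power2_eq_square algebra_simps)
  then have der: "((\<lambda>\<theta>. Re (saddle_curve M \<theta>)) has_real_derivative N / (sin (real M * \<theta>))\<^sup>2) (at \<theta>)"
    by (rule has_field_derivative_transform_within_open[of _ _ _ "{0<..<\<theta>max}"])
       (use assms Re_saddle_curve in auto)
  \<comment> \<open>Addition formulas collapse the numerator of the quotient rule to a difference
    whose sign is given by \<open>sin_nat_mult_less\<close> with k = M + 1 and t =
    2\<theta>.\<close>
  have "2 * N = sin (real (M + 1) * (2 * \<theta>)) - real (M + 1) * sin (2 * \<theta>)"
  proof -
    define A where "A = real M * \<theta>"
    have e: "real (M + 1) * \<theta> = A + \<theta>" "real (M + 1) * (2 * \<theta>) = 2 * (A + \<theta>)" by (auto simp: A_def algebra_simps)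
    have "\<theta> = (A + \<theta>) - A" by simp
    define B where "B = A + \<theta>"
    have t: "sin \<theta> = sin B * cos A - cos B * sin A" "cos \<theta> = cos B * cos A + sin B * sin A"
      using sin_diff[of B A] cos_diff[of B A] by (auto simp: B_def)
    have cA: "(cos A)\<^sup>2 = 1 - (sin A)\<^sup>2" "(cos B)\<^sup>2 = 1 - (sin B)\<^sup>2" by (simp_all add: cos_squared_eq)
    have "sin (2 * B) = 2 * sin B * cos B" by (rule sin_double)
    moreover have "N = (cos B * real (M + 1) * cos \<theta> - sin B * sin \<theta>) * sin A - sin B * cos \<theta> * (cos A * real M)"
      unfolding N_def e B_def A_def by simp
    moreover have "(cos B * real (M + 1) * cos \<theta> - sin B * sin \<theta>) * sin A - sin B * cos \<theta> * (cos A * real M)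
       = sin B * cos B - real (M + 1) * sin \<theta> * cos \<theta>"
    proof -
      have "sin B * cos B - real (M + 1) * sin \<theta> * cos \<theta> - ((cos B * real (M + 1) * cos \<theta> - sin B * sin \<theta>) * sin A - sin B * cos \<theta> * (cos A * real M))
       = sin B * cos B + sin B * sin \<theta> * sin A - sin B * cos \<theta> * cos A + real (M + 1) * cos \<theta> * (sin B * cos A - cos B * sin A - sin \<theta>)"
        by (simp add: algebra_simps)
      also have "\<dots> = sin B * (cos B + sin \<theta> * sin A - cos \<theta> * cos A)"
        using t by (simp add: algebra_simps)
      also have "\<dots> = 0" using cos_add[of A \<theta>] by (simp add: B_def algebra_simps)
      finally show ?thesis by simp
    qed
    ultimately show ?thesis unfolding e B_def[symmetric] by (simp add: sin_double)
  qed
  moreover have "sin (real (M + 1) * (2 * \<theta>)) < real (M + 1) * sin (2 * \<theta>)"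
    by (rule sin_nat_mult_less) (use M assms angle_bounds[OF assms] in auto)
  ultimately have "N < 0" by linarith
  then have "N / (sin (real M * \<theta>))\<^sup>2 < 0" using p by (simp add: divide_neg_pos)
  then show ?thesis using der that by blast
qed

lemma Re_saddle_curve_decreasing:
  assumes "0 < \<theta>" "\<theta> < \<theta>'" "\<theta>' < \<theta>max"
  shows "Re (saddle_curve M \<theta>') < Re (saddle_curve M \<theta>)"
proof (rule DERIV_neg_imp_decreasing[OF assms(2)])
  fix x assume x: "\<theta> \<le> x" "x \<le> \<theta>'"
  then have "0 < x" "x < \<theta>max" using assms by auto
  then show "\<exists>y. ((\<lambda>\<theta>. Re (saddle_curve M \<theta>)) has_real_derivative y) (at x) \<and> y < 0"
    using Re_saddle_curve_derivative[of x] by metis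
qed

lemma bulk_param_pos:
  assumes "0 < \<theta>" "\<theta> < \<theta>max"
  shows "bulk_param M \<theta> > 0"
  using sin_pos[OF assms] by (simp add: bulk_param_def)

lemma ln_bulk_param:
  assumes "0 < \<theta>" "\<theta> < \<theta>max"
  shows "ln (bulk_param M \<theta>) = real (M + 1) * ln (sin (real (M + 1) * \<theta>)) - ln (sin \<theta>) - real M * ln (sin (real M * \<theta>))"
  using sin_pos[OF assms] by (simp add: bulk_param_def ln_div ln_mult ln_realpow algebra_simps)

text \<open>In the cotangents p' of Mx and q' of x the derivative is a quotient with positive
  denominator p' + q', and its numerator completes to minus a sum of squares.\<close>

lemma ln_bulk_param_decreasing:
  assumes "0 < \<theta>" "\<theta> < \<theta>'" "\<theta>' < \<theta>max"
  shows "ln (bulk_param M \<theta>') < ln (bulk_param M \<theta>)"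
proof (rule DERIV_neg_imp_decreasing[OF assms(2)])
  fix x assume x: "\<theta> \<le> x" "x \<le> \<theta>'"
  then have x: "0 < x" "x < \<theta>max" using assms by auto
  note p = sin_pos[OF x]
  define A where "A = real M * x"
  have e: "real (M + 1) * x = A + x" by (simp add: A_def algebra_simps)
  define D where "D = real (M + 1) * (cos (real (M + 1) * x) * real (M + 1) / sin (real (M + 1) * x))
      - cos x / sin x - real M * (cos (real M * x) * real M / sin (real M * x))"
  have "((\<lambda>\<theta>. real (M + 1) * ln (sin (real (M + 1) * \<theta>)) - ln (sin \<theta>) - real M * ln (sin (real M * \<theta>)))
     has_real_derivative D) (at x)"
    using p unfolding D_def by (auto intro!: derivative_eq_intros simp: field_simps)
  then have der: "((\<lambda>\<theta>. ln (bulk_param M \<theta>)) has_real_derivative D) (at x)"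
    by (rule has_field_derivative_transform_within_open[of _ _ _ "{0<..<\<theta>max}"])
       (use x ln_bulk_param in auto)
  have "D < 0"
  proof -
    define m where "m = real M"
    define p' q' where "p' = cos A / sin A" and "q' = cos x / sin x"
    have sA: "sin A > 0" "sin x > 0" "sin (A + x) > 0"
      using p(1,3) p(4)[unfolded e] by (auto simp: A_def)
    have pq: "p' + q' > 0"
    proof -
      have "p' + q' = sin (A + x) / (sin A * sin x)"
        using sA by (simp add: p'_def q'_def sin_add field_simps)
      then show ?thesis using sA by simp
    qed
    have c: "cos (A + x) / sin (A + x) = (p' * q' - 1) / (p' + q')"
    proof -
      have nz: "sin A * cos x + cos A * sin x \<noteq> 0" using sA by (simp add: sin_add)
      have "p' * q' - 1 = cos (A + x) / (sin A * sin x)"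
        using sA by (simp add: p'_def q'_def cos_add field_simps)
      moreover have "p' + q' = sin (A + x) / (sin A * sin x)"
        using sA by (simp add: p'_def q'_def sin_add field_simps)
      ultimately show ?thesis using sA by simp
    qed
    have "D = (m + 1)\<^sup>2 * (cos (A + x) / sin (A + x)) - q' - m\<^sup>2 * p'"
      unfolding D_def e A_def[symmetric] q'_def p'_def m_def
      by (simp add: power2_eq_square add.commute mult_ac)
    also have "\<dots> = ((m + 1)\<^sup>2 * (p' * q' - 1) - (q' + m\<^sup>2 * p') * (p' + q')) / (p' + q')"
      using pq by (simp add: c field_simps)
    also have "(m + 1)\<^sup>2 * (p' * q' - 1) - (q' + m\<^sup>2 * p') * (p' + q') = - ((q' - m * p')\<^sup>2 + (m + 1)\<^sup>2)"
      by (simp add: power2_eq_square algebra_simps)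
    also have "\<dots> / (p' + q') < 0"
    proof (rule divide_neg_pos[OF _ pq])
      have "(m + 1)\<^sup>2 > 0" by (simp add: m_def add_nonneg_eq_0_iff)
      then show "- ((q' - m * p')\<^sup>2 + (m + 1)\<^sup>2) < 0" using zero_le_power2[of "q' - m * p'"] by linarith
    qed
    finally show ?thesis .
  qed
  then show "\<exists>y. ((\<lambda>\<theta>. ln (bulk_param M \<theta>)) has_real_derivative y) (at x) \<and> y < 0"
    using der by blast
qed

text \<open>The argument of z is \<theta> and that of z - 1 is (M+1)\<theta>, both within the
  principal range, so the imaginary parts cancel. This is the defining property of the
  curve.\<close>

lemma phase_derivative_on_curve:
  assumes "0 < \<theta>" "\<theta> < \<theta>max"
  shows "of_nat (M + 1) * Ln (saddle_curve M \<theta>) - Ln (saddle_curve M \<theta> - 1) = of_real (ln (bulk_param M \<theta>))"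
proof -
  note p = sin_pos[OF assms] and b = angle_bounds[OF assms]
  have "Ln (saddle_curve M \<theta>) = of_real (ln (sin (real (M + 1) * \<theta>) / sin (real M * \<theta>))) + \<i> * of_real \<theta>"
    unfolding saddle_curve_polar(1)[OF assms] using p b assms by (intro Ln_of_real_mult_cis) auto
  moreover have "Ln (saddle_curve M \<theta> - 1) = of_real (ln (sin \<theta> / sin (real M * \<theta>))) + \<i> * of_real (real (M + 1) * \<theta>)"
    unfolding saddle_curve_polar(2)[OF assms] using p b assms
    by (intro Ln_of_real_mult_cis) (auto intro: order.strict_trans[of _ 0])
  moreover have "real (M + 1) * ln (sin (real (M + 1) * \<theta>) / sin (real M * \<theta>)) - ln (sin \<theta> / sin (real M * \<theta>)) = ln (bulk_param M \<theta>)"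
    using p unfolding ln_bulk_param[OF assms] by (simp add: ln_div algebra_simps)
  ultimately show ?thesis
    by (simp only: complex_eq_iff) simp
qed

end

section \<open>The curve as a closed contour and its winding numbers\<close>

context factor_count
begin

lemma saddle_curve_endpoints: "saddle_curve M \<theta>max = 0" "saddle_curve M (- \<theta>max) = 0"
proof -
  have e: "real M * \<theta>max = pi - \<theta>max"
    using \<theta>max(3) by (simp add: algebra_simps)
  have "sin \<theta>max > 0" using \<theta>max by (intro sin_gt_zero) auto
  then have "sin_ratio M \<theta>max = 1"
    using sin_mult_sin_ratio[of \<theta>max M] unfolding e by simp
  then show "saddle_curve M \<theta>max = 0"
    unfolding saddle_curve_def \<theta>max(3) by simp
  then show "saddle_curve M (- \<theta>max) = 0"
    by (simp add: saddle_curve_minus)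
qed

lemma saddle_curve_0: "saddle_curve M 0 = of_real (1 + 1 / real M)"
  by (simp add: saddle_curve_def sin_ratio_def)

lemma continuous_on_saddle_curve: "continuous_on {-\<theta>max..\<theta>max} (saddle_curve M)"
proof (rule saddle_curve_C1)
  fix D assume "\<And>\<theta>. \<bar>\<theta>\<bar> \<le> \<theta>max \<Longrightarrow> (saddle_curve M has_vector_derivative D \<theta>) (at \<theta>)"
  then have "isCont (saddle_curve M) \<theta>" if "\<theta> \<in> {-\<theta>max..\<theta>max}" for \<theta>
    using that by (meson abs_le_iff atLeastAtMost_iff has_vector_derivative_continuous minus_le_iff)
  then show ?thesis
    by (intro continuous_at_imp_continuous_on) auto
qed

definition contour :: "real \<Rightarrow> complex" where
  "contour x = saddle_curve M ((2 * x - 1) * \<theta>max)"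

lemma contour_angle:
  assumes "x \<in> {0..1}"
  shows "\<bar>(2 * x - 1) * \<theta>max\<bar> \<le> \<theta>max"
proof -
  have "\<bar>2 * x - 1\<bar> \<le> 1" using assms by auto
  then show ?thesis using \<theta>max by (simp add: abs_mult mult_le_cancel_right1)
qed

lemma path_image_contour: "path_image contour = saddle_curve M ` {-\<theta>max..\<theta>max}"
proof -
  have "(\<lambda>x. (2 * x - 1) * \<theta>max) ` {0..1} = {-\<theta>max..\<theta>max}"
  proof (intro equalityI subsetI)
    fix t assume t: "t \<in> {-\<theta>max..\<theta>max}"
    have "t = (2 * ((t / \<theta>max + 1) / 2) - 1) * \<theta>max" using \<theta>max(1) by (simp add: field_simps)
    moreover have "(t / \<theta>max + 1) / 2 \<in> {0..1}"
      using t \<theta>max by (auto simp: divide_simps)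
    ultimately show "t \<in> (\<lambda>x. (2 * x - 1) * \<theta>max) ` {0..1}" by blast
  qed (use contour_angle in \<open>auto simp: abs_le_iff\<close>, force+)
  then show ?thesis
    by (metis (no_types, lifting) contour_def image_cong image_image path_image_def)
qed

lemma contour_C1:
  obtains D B where "\<And>x. x \<in> {0..1} \<Longrightarrow> (contour has_vector_derivative D x) (at x)"
    "continuous_on {0..1} D" "B > 0" "\<And>x. x \<in> {0..1} \<Longrightarrow> norm (D x) \<le> B"
proof -
  obtain D where D: "\<And>\<theta>. \<bar>\<theta>\<bar> \<le> \<theta>max \<Longrightarrow> (saddle_curve M has_vector_derivative D \<theta>) (at \<theta>)"
    "continuous_on {-\<theta>max..\<theta>max} D" by (rule saddle_curve_C1) blast
  define D' where "D' = (\<lambda>x. (2 * \<theta>max) *\<^sub>R D ((2 * x - 1) * \<theta>max))"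
  have 1: "(contour has_vector_derivative D' x) (at x)" if "x \<in> {0..1}" for x
  proof -
    have "((\<lambda>x. (2 * x - 1) * \<theta>max) has_vector_derivative 2 * \<theta>max) (at x)"
      by (auto intro!: derivative_eq_intros simp flip: has_real_derivative_iff_has_vector_derivative)
    from vector_diff_chain_at[OF this D(1)[OF contour_angle[OF that]]]
    show ?thesis by (simp add: D'_def contour_def[abs_def] o_def)
  qed
  have 2: "continuous_on {0..1} D'"
    unfolding D'_def
    by (intro continuous_intros continuous_on_compose2[OF D(2)])
       (use contour_angle in \<open>auto simp: abs_le_iff\<close>, force+)
  have "bounded (D' ` {0..1})"
    by (intro compact_imp_bounded compact_continuous_image 2) auto
  then obtain B where B: "B > 0" "\<forall>y\<in>D' ` {0..1}. norm y \<le> B"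
    unfolding bounded_pos by auto
  show ?thesis
    by (rule that[OF 1 2 B(1)]) (use B(2) in auto)
qed

lemma valid_path_contour: "valid_path contour"
proof (rule contour_C1)
  fix D assume "\<And>x. x \<in> {0..1} \<Longrightarrow> (contour has_vector_derivative D x) (at x)" "continuous_on {0..1} D"
  then show ?thesis
    unfolding valid_path_def
    by (intro C1_differentiable_imp_piecewise) (unfold C1_differentiable_on_def, blast)
qed

lemma contour_closed: "pathfinish contour = pathstart contour"
  by (simp add: pathfinish_def pathstart_def contour_def saddle_curve_endpoints)

lemma saddle_curve_cases:
  assumes "\<bar>\<theta>\<bar> \<le> \<theta>max"
  obtains "saddle_curve M \<theta> = 0" | "\<theta> = 0" | "0 < \<theta>" "\<theta> < \<theta>max" | "0 < - \<theta>" "- \<theta> < \<theta>max"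
  using assms saddle_curve_endpoints by (cases "\<theta> = \<theta>max"; cases "\<theta> = - \<theta>max") fastforce+

text \<open>The curve meets the real axis only at 0 (both ends) and at 1 + 1/M (the middle);
  elsewhere its imaginary part has the sign of \<theta>.\<close>

lemma real_notin_contour:
  assumes "0 < p" "p < 1 + 1 / real M"
  shows "of_real p \<notin> path_image contour"
proof
  assume "of_real p \<in> path_image contour"
  then obtain \<theta> where t: "\<bar>\<theta>\<bar> \<le> \<theta>max" "of_real p = saddle_curve M \<theta>"
    unfolding path_image_contour by (force simp: abs_le_iff)
  from t(1) show False
  proof (cases rule: saddle_curve_cases)
    case 2
    then show ?thesis using t assms by (simp add: saddle_curve_0 flip: of_real_add)
  next
    case 3
    then show ?thesis using saddle_curve_quadrant(2)[OF 3] by (simp flip: t(2))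
  next
    case 4
    have "saddle_curve M (- \<theta>) = of_real p" using t(2) by (simp add: saddle_curve_minus flip: t(2))
    then show ?thesis using saddle_curve_quadrant(2)[OF 4] by simp
  qed (use t assms in auto)
qed

text \<open>The curve minus 1 has an explicit continuous logarithm \<open>q\<close>: its imaginary
  part runs from -pi to pi, and its real part has equal end values because \<open>sin_ratio\<close>
  is even.\<close>

lemma winding_number_contour_1: "winding_number contour 1 = 1"
proof -
  define q where "q = (\<lambda>x. of_real (- ln (sin_ratio M ((2 * x - 1) * \<theta>max))) + \<i> * of_real (real (M + 1) * ((2 * x - 1) * \<theta>max)))"
  have q: "exp (q x) = contour x - 1" if "x \<in> {0..1}" for x
  proof -
    define r where "r = sin_ratio M ((2 * x - 1) * \<theta>max)"
    have "exp (of_real (- ln r)) = (1 / of_real r :: complex)"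
      using sin_ratio_pos[OF contour_angle[OF that]] by (simp add: r_def exp_minus exp_of_real divide_inverse)
    then have "exp (q x) = 1 / of_real r * cis (real (M + 1) * ((2 * x - 1) * \<theta>max))"
      unfolding q_def r_def[symmetric] exp_add cis_conv_exp by (simp only:)
    then show ?thesis by (simp add: contour_def saddle_curve_def r_def)
  qed
  have "path q" unfolding path_def q_def sin_ratio_def
    by (intro continuous_intros) (use sin_ratio_pos contour_angle in \<open>force simp: sin_ratio_def\<close>)
  then have "winding_number (exp \<circ> q) 0 = (pathfinish q - pathstart q) / (2 * of_real pi * \<i>)"
    by (rule winding_number_compose_exp)
  also have "\<dots> = 1"
  proof -
    have "sin_ratio M (- \<theta>max) = sin_ratio M \<theta>max" by simp
    moreover have "of_real (real (M + 1)) * of_real \<theta>max = (of_real pi :: complex)"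
      by (simp only: \<theta>max(3) flip: of_real_mult)
    moreover have "pathfinish q - pathstart q = 2 * (of_real (real (M + 1)) * of_real \<theta>max) * \<i>
        + of_real (ln (sin_ratio M (- \<theta>max)) - ln (sin_ratio M \<theta>max))"
      by (simp add: q_def pathfinish_def pathstart_def algebra_simps del: sin_ratio_minus)
    ultimately have "pathfinish q - pathstart q = 2 * of_real pi * \<i>" by simp
    then show ?thesis by simp
  qed
  also have "winding_number (exp \<circ> q) 0 = winding_number (\<lambda>x. contour x - 1) 0"
    by (rule winding_number_cong) (use q in auto)
  also have "\<dots> = winding_number contour 1"
    by (rule winding_number_offset[symmetric])
  finally show ?thesis .
qed

lemma path_contour: "path contour"
  by (rule valid_path_imp_path[OF valid_path_contour])

text \<open>The interval is connected, avoids the curve and contains 1. It contains the rescaled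
  poles (k + 1/2)/n as well as the real part a of the saddle point.\<close>

lemma winding_number_contour_real:
  assumes "0 < p" "p < 1 + 1 / real M"
  shows "winding_number contour (of_real p) = 1"
proof -
  have "winding_number contour (of_real p) = winding_number contour 1"
  proof (rule winding_number_eq[OF path_contour contour_closed])
    show "connected ((of_real :: real \<Rightarrow> complex) ` {0<..<1 + 1 / real M})"
      by (intro connected_continuous_image continuous_intros) auto
    show "of_real ` {0<..<1 + 1 / real M} \<inter> path_image contour = {}"
      using real_notin_contour by auto
    show "1 \<in> complex_of_real ` {0<..<1 + 1 / real M}"
      using M by (intro image_eqI[of _ _ 1]) auto
  qed (use assms in auto)
  then show ?thesis using winding_number_contour_1 by simp
qed

end

section \<open>Extremal properties of the phase on the curve and on the line\<close>

locale bulk_point = factor_count +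
  fixes \<phi> :: real
  assumes \<phi>: "0 < \<phi>" "\<phi> < \<theta>max"
begin

abbreviation "w \<equiv> saddle_curve M \<phi>"
abbreviation "a \<equiv> Re w"
abbreviation "b \<equiv> Im w"
abbreviation "x\<^sub>0 \<equiv> bulk_param M \<phi>"

text \<open>The upper bound is the limit of the decreasing real part as \<theta> tends to 0. Passing
  to the limit loses strictness, so the comparison goes through the intermediate angle
  \<phi>/2.\<close>

lemma a: "0 < a" "a < 1 + 1 / real M" and b: "0 < b"
proof -
  show "0 < a" "0 < b" using saddle_curve_quadrant[OF \<phi>] by auto
  have "((\<lambda>\<theta>. Re (saddle_curve M \<theta>)) \<longlongrightarrow> Re (saddle_curve M 0)) (at 0 within {0<..\<phi>})"
  proof (intro tendsto_Re)
    have "(saddle_curve M \<longlongrightarrow> saddle_curve M 0) (at 0 within {-\<theta>max..\<theta>max})"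
      using continuous_on_saddle_curve \<phi> by (auto simp: continuous_on_def)
    then show "(saddle_curve M \<longlongrightarrow> saddle_curve M 0) (at 0 within {0<..\<phi>})"
      by (rule tendsto_within_subset) (use \<phi> in auto)
  qed
  moreover have "at 0 within {0<..\<phi>} \<noteq> bot"
    using \<phi> by (simp add: at_within_eq_bot_iff)
  moreover have "\<forall>\<^sub>F \<theta> in at 0 within {0<..\<phi>}. Re (saddle_curve M (\<phi>/2)) \<le> Re (saddle_curve M \<theta>)"
  proof -
    have "\<forall>\<^sub>F \<theta> in at 0 within {0<..\<phi>}. \<theta> < \<phi> / 2"
      using \<phi> by (intro order_tendstoD(2)[OF tendsto_ident_at]) auto
    moreover have "\<forall>\<^sub>F \<theta> in at 0 within {0<..\<phi>}. \<theta> > 0"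
      by (simp add: eventually_at_filter)
    ultimately show ?thesis
    proof eventually_elim
      case (elim \<theta>)
      then show ?case using Re_saddle_curve_decreasing[of \<theta> "\<phi>/2"] \<phi> by simp
    qed
  qed
  ultimately have "Re (saddle_curve M (\<phi>/2)) \<le> Re (saddle_curve M 0)"
    using tendsto_lowerbound by blast
  then show "a < 1 + 1 / real M"
    using Re_saddle_curve_decreasing[of "\<phi>/2" \<phi>] \<phi> by (simp add: saddle_curve_0)
qed

lemma Re_eq_a_on_contour:
  assumes "\<bar>\<theta>\<bar> \<le> \<theta>max" "Re (saddle_curve M \<theta>) = a"
  shows "\<bar>Im (saddle_curve M \<theta>)\<bar> = b"
proof -
  have *: "t = \<phi>" if "0 < t" "t < \<theta>max" "Re (saddle_curve M t) = a" for t
    using Re_saddle_curve_decreasing[of t \<phi>] Re_saddle_curve_decreasing[of \<phi> t] that \<phi>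
    by (cases t \<phi> rule: linorder_cases) auto
  from assms(1) show ?thesis
  proof (cases rule: saddle_curve_cases)
    case 1
    then show ?thesis using assms a by simp
  next
    case 2
    then show ?thesis using assms a by (simp add: saddle_curve_0)
  next
    case 3
    then show ?thesis using *[OF 3 assms(2)] b by simp
  next
    case 4
    have "Re (saddle_curve M (- \<theta>)) = a" using assms by (simp add: saddle_curve_minus)
    from *[OF 4 this] have "\<theta> = - \<phi>" by simp
    then show ?thesis using b by (simp add: saddle_curve_minus)
  qed
qed

lemma line_notin_contour:
  assumes "\<bar>v\<bar> \<noteq> b"
  shows "Complex a v \<notin> path_image contour"
proof
  assume "Complex a v \<in> path_image contour"
  then obtain \<theta> where t: "\<bar>\<theta>\<bar> \<le> \<theta>max" "Complex a v = saddle_curve M \<theta>"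
    unfolding path_image_contour by (force simp: abs_le_iff)
  have "\<bar>Im (saddle_curve M \<theta>)\<bar> = b"
    using Re_eq_a_on_contour[OF t(1)] t(2)[symmetric] by simp
  then show False using assms t(2)[symmetric] by simp
qed

text \<open>The line meets the curve only at the two saddle points. Its middle piece is connected to
  the real point a, the outer pieces run to infinity.\<close>

lemma winding_number_contour_line:
  assumes "\<bar>v\<bar> \<noteq> b"
  shows "winding_number contour (Complex a v) = (if \<bar>v\<bar> < b then 1 else 0)"
proof (cases "\<bar>v\<bar> < b")
  case True
  have "winding_number contour (Complex a v) = winding_number contour (of_real a)"
  proof (rule winding_number_eq[OF path_contour contour_closed])
    show "connected (Complex a ` {-b<..<b})"
      by (intro connected_continuous_image continuous_intros) (auto simp: Complex_eq)
    show "Complex a ` {-b<..<b} \<inter> path_image contour = {}"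
      using line_notin_contour by (auto simp: abs_less_iff)
    show "of_real a \<in> Complex a ` {-b<..<b}"
      using b by (auto simp: complex_eq_iff intro!: image_eqI[of _ _ 0])
    show "Complex a v \<in> Complex a ` {-b<..<b}" using True by (intro imageI) auto
  qed
  then show ?thesis using True winding_number_contour_real a by simp
next
  case False
  obtain B where B: "\<And>z. B \<le> norm z \<Longrightarrow> winding_number contour z = 0"
    using winding_number_zero_at_infinity[OF path_contour contour_closed] by blast
  \<comment> \<open>A height on the same side of the real axis at which the modulus exceeds B, so
    that the winding number is known to vanish.\<close>
  define V where "V = \<bar>B\<bar> + \<bar>v\<bar>"
  have *: "connected (Complex a ` A)" if "connected A" for A
    using that by (intro connected_continuous_image continuous_intros) (auto simp: Complex_eq)
  have "winding_number contour (Complex a v) = winding_number contour (Complex a (sgn v * V))"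
  proof (rule winding_number_eq[OF path_contour contour_closed])
    show "connected (Complex a ` (if v > 0 then {b<..} else {..<-b}))"
      by (rule *) auto
    show "Complex a ` (if v > 0 then {b<..} else {..<-b}) \<inter> path_image contour = {}"
      using line_notin_contour b by (auto split: if_splits)
    show "Complex a v \<in> Complex a ` (if v > 0 then {b<..} else {..<-b})"
      using False assms by auto
    show "Complex a (sgn v * V) \<in> Complex a ` (if v > 0 then {b<..} else {..<-b})"
      using False assms b by (intro image_eqI[OF refl]) (auto simp: sgn_if V_def)
  qed
  also have "\<dots> = 0"
  proof (rule B)
    have "B \<le> \<bar>Im (Complex a (sgn v * V))\<bar>"
      using False b by (auto simp: sgn_if V_def)
    also have "\<dots> \<le> norm (Complex a (sgn v * V))" by (rule abs_Im_le_cmod)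
    finally show "B \<le> norm (Complex a (sgn v * V))" .
  qed
  finally show ?thesis using False by simp
qed

text \<open>The complex derivative of the phase is real on the curve, so taking real parts in the
  chain rule leaves it as a factor in front of the derivative of the real part of the curve.\<close>

lemma phase_on_contour_derivative:
  assumes t: "0 < t" "t < \<theta>max" and D: "((\<lambda>t. Re (saddle_curve M t)) has_real_derivative D) (at t)"
  shows "((\<lambda>t. Re (phase M x\<^sub>0 (saddle_curve M t))) has_real_derivative
      (ln (bulk_param M t) - ln x\<^sub>0) * D) (at t)"
proof -
  obtain E where E: "(saddle_curve M has_vector_derivative E) (at t)"
  proof (rule saddle_curve_C1)
    fix D assume "\<And>\<theta>. \<bar>\<theta>\<bar> \<le> \<theta>max \<Longrightarrow> (saddle_curve M has_vector_derivative D \<theta>) (at \<theta>)"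
    from this[of t] show thesis using that t by auto
  qed
  have "(phase M x\<^sub>0 has_field_derivative of_real (ln (bulk_param M t) - ln x\<^sub>0)) (at (saddle_curve M t))"
    using has_field_derivative_phase[of "saddle_curve M t" M x\<^sub>0] saddle_curve_quadrant[OF t]
      phase_derivative_on_curve[OF t] by simp
  from field_vector_diff_chain_at[OF E this]
  have "((\<lambda>t. phase M x\<^sub>0 (saddle_curve M t)) has_vector_derivative E * of_real (ln (bulk_param M t) - ln x\<^sub>0)) (at t)"
    by (simp add: o_def)
  from bounded_linear.has_vector_derivative[OF bounded_linear_Re, OF this]
  have "((\<lambda>t. Re (phase M x\<^sub>0 (saddle_curve M t))) has_real_derivative Re E * (ln (bulk_param M t) - ln x\<^sub>0)) (at t)"
    by (simp add: has_real_derivative_iff_has_vector_derivative)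
  moreover have "Re E = D"
    using bounded_linear.has_vector_derivative[OF bounded_linear_Re, OF E] D
    by (metis DERIV_unique has_real_derivative_iff_has_vector_derivative)
  ultimately show ?thesis by (simp add: mult.commute)
qed

lemma phase_on_contour_isCont:
  assumes "0 < t" "t < \<theta>max"
  shows "isCont (\<lambda>t. Re (phase M x\<^sub>0 (saddle_curve M t))) t"
  using Re_saddle_curve_derivative[OF assms] phase_on_contour_derivative[OF assms]
  by (metis DERIV_isCont)

lemma phase_on_contour_increasing:
  assumes "\<phi> \<le> s" "s < t" "t < \<theta>max"
  shows "Re (phase M x\<^sub>0 (saddle_curve M s)) < Re (phase M x\<^sub>0 (saddle_curve M t))"
proof (rule DERIV_pos_imp_increasing_open[OF assms(2)])
  fix x assume x: "s < x" "x < t"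
  then have x': "0 < x" "x < \<theta>max" using assms \<phi> by auto
  obtain D where D: "D < 0" "((\<lambda>t. Re (saddle_curve M t)) has_real_derivative D) (at x)"
    using Re_saddle_curve_derivative[OF x'] by blast
  have "(ln (bulk_param M x) - ln x\<^sub>0) * D > 0"
    using ln_bulk_param_decreasing[of \<phi> x] x x' assms \<phi> D by (intro mult_neg_neg) auto
  then show "\<exists>y. ((\<lambda>t. Re (phase M x\<^sub>0 (saddle_curve M t))) has_real_derivative y) (at x) \<and> y > 0"
    using phase_on_contour_derivative[OF x' D(2)] by blast
next
  show "continuous_on {s..t} (\<lambda>t. Re (phase M x\<^sub>0 (saddle_curve M t)))"
    using assms \<phi> by (intro continuous_at_imp_continuous_on ballI phase_on_contour_isCont) auto
qed

text \<open>The derivative along the curve is a product of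
  \<open>ln (bulk_param M t) - ln x\<^sub>0\<close>, which changes from positive to negative at
  \<phi>, and of a negative factor; hence \<phi> is a strict minimum.\<close>

lemma phase_on_contour_gt:
  assumes "0 < \<theta>" "\<theta> < \<theta>max" "\<theta> \<noteq> \<phi>"
  shows "Re (phase M x\<^sub>0 w) < Re (phase M x\<^sub>0 (saddle_curve M \<theta>))"
proof (cases "\<theta> < \<phi>")
  case True
  show ?thesis
  proof (rule DERIV_neg_imp_decreasing_open[OF True])
    fix x assume x: "\<theta> < x" "x < \<phi>"
    then have x': "0 < x" "x < \<theta>max" using assms \<phi> by auto
    obtain D where D: "D < 0" "((\<lambda>t. Re (saddle_curve M t)) has_real_derivative D) (at x)"
      using Re_saddle_curve_derivative[OF x'] by blast
    have "(ln (bulk_param M x) - ln x\<^sub>0) * D < 0"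
      using ln_bulk_param_decreasing[of x \<phi>] x x' \<phi> D by (intro mult_pos_neg) auto
    then show "\<exists>y. ((\<lambda>t. Re (phase M x\<^sub>0 (saddle_curve M t))) has_real_derivative y) (at x) \<and> y < 0"
      using phase_on_contour_derivative[OF x' D(2)] by blast
  next
    show "continuous_on {\<theta>..\<phi>} (\<lambda>t. Re (phase M x\<^sub>0 (saddle_curve M t)))"
      using assms \<phi> by (intro continuous_at_imp_continuous_on ballI phase_on_contour_isCont) auto
  qed
qed (use phase_on_contour_increasing[of \<phi> \<theta>] assms in auto)

lemma line_derivative:
  assumes "v > 0"
  shows "((\<lambda>v. Re (phase M x\<^sub>0 (Complex a v))) has_real_derivative
     Im (Ln (Complex a v - 1)) - real (M + 1) * Im (Ln (Complex a v))) (at v within A)"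
proof -
  have 1: "((\<lambda>v. Complex a v) has_vector_derivative \<i>) (at v within A)"
    by (auto simp: Complex_eq intro!: derivative_eq_intros)
  have "(phase M x\<^sub>0 has_field_derivative (of_nat (M + 1) * Ln (Complex a v) - Ln (Complex a v - 1) - of_real (ln x\<^sub>0))) (at (Complex a v) within Complex a ` A)"
    by (rule has_field_derivative_phase) (use assms in auto)
  from bounded_linear.has_vector_derivative[OF bounded_linear_Re, OF field_vector_diff_chain_within[OF 1 this]]
  show ?thesis
    by (simp add: o_def has_real_derivative_iff_has_vector_derivative algebra_simps)
qed

text \<open>A point z of the line is compared with the curve point of the same argument \<theta>.
  Whether arg(z - 1) exceeds (M+1)\<theta> is decided by the side of the line on which that curve
  point lies, and \<theta> grows with v.\<close>

lemma line_derivative_sign: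
  assumes "v > 0"
  shows "v < b \<Longrightarrow> Im (Ln (Complex a v - 1)) - real (M + 1) * Im (Ln (Complex a v)) > 0"
    and "v > b \<Longrightarrow> Im (Ln (Complex a v - 1)) - real (M + 1) * Im (Ln (Complex a v)) < 0"
proof -
  define z where "z = Complex a v"
  define \<theta> where "\<theta> = Im (Ln z)"
  define A where "A = Im (Ln (z - 1))"
  have nz: "z \<noteq> 0" "z - 1 \<noteq> 0" using assms by (auto simp: z_def complex_eq_iff)
  have th: "\<theta> = pi / 2 - arctan (a / v)" unfolding \<theta>_def by (subst Im_Ln_upper) (use assms in \<open>auto simp: z_def\<close>)
  have "arctan (a / v) > 0" using a assms by simp
  then have th2: "0 < \<theta>" "\<theta> < pi / 2" using th arctan_ubound[of "a/v"] by auto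
  have w: "Im (Ln w) = \<phi>" "Im (Ln w) = pi / 2 - arctan (a / b)"
  proof -
    have "Ln w = of_real (ln (sin (real (M + 1) * \<phi>) / sin (real M * \<phi>))) + \<i> * of_real \<phi>"
      unfolding saddle_curve_polar(1)[OF \<phi>]
      using sin_pos[OF \<phi>] \<phi> angle_bounds[OF \<phi>] by (intro Ln_of_real_mult_cis) auto
    then show "Im (Ln w) = \<phi>" by simp
  qed (use b Im_Ln_upper in auto)
  have A: "0 < A" "A < pi"
    using Im_Ln_pos_lt[of "z - 1"] nz assms unfolding A_def by (auto simp: z_def)
  have polar: "z = of_real (norm z) * cis \<theta>" "z - 1 = of_real (norm (z - 1)) * cis A"
    using exp_Ln[OF nz(1)] exp_Ln[OF nz(2)] nz
    by (auto simp: \<theta>_def A_def exp_eq_polar)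
  \<comment> \<open>Rotating z - 1 by -(M+1)\<theta> puts the angle difference in question into a
    sine; computing the same imaginary part from z expresses it by |z| and \<theta>.\<close>
  have "Im ((z - 1) * cis (- (real (M + 1) * \<theta>))) = norm (z - 1) * sin (A - real (M + 1) * \<theta>)"
    by (subst polar(2)) (simp add: mult.assoc cis_mult)
  moreover have "(z - 1) * cis (- (real (M + 1) * \<theta>)) = of_real (norm z) * cis (- (real M * \<theta>)) - cis (- (real (M + 1) * \<theta>))"
  proof -
    have "z * cis (- (real (M + 1) * \<theta>)) = of_real (norm z) * cis (- (real M * \<theta>))"
      by (subst polar(1)) (simp add: mult.assoc cis_mult algebra_simps)
    then show ?thesis by (simp add: left_diff_distrib)
  qed
  moreover have "Im (of_real (norm z) * cis (- (real M * \<theta>)) - cis (- (real (M + 1) * \<theta>)))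
      = sin (real (M + 1) * \<theta>) - norm z * sin (real M * \<theta>)" by simp
  ultimately have key: "norm (z - 1) * sin (A - real (M + 1) * \<theta>) = sin (real (M + 1) * \<theta>) - norm z * sin (real M * \<theta>)"
    by metis
  have az: "a = norm z * cos \<theta>"
    using arg_cong[OF polar(1), of Re] by (simp add: z_def)
  \<comment> \<open>Since |z| = a / cos \<theta>, the right-hand side is a positive multiple of the
    real part of the curve minus a.\<close>
  have key2: "norm (z - 1) * sin (A - real (M + 1) * \<theta>) = (sin (real M * \<theta>) / cos \<theta>) * (Re (saddle_curve M \<theta>) - a)"
    if "\<theta> < \<theta>max"
  proof -
    have p: "sin (real M * \<theta>) > 0" "cos \<theta> > 0" using sin_pos[of \<theta>] th2 that by auto
    then have "(sin (real M * \<theta>) / cos \<theta>) * (Re (saddle_curve M \<theta>) - a) = sin (real (M + 1) * \<theta>) - norm z * sin (real M * \<theta>)"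
      unfolding Re_saddle_curve[OF th2(1) that] az by (simp add: field_simps)
    then show ?thesis using key by simp
  qed
  show "Im (Ln (Complex a v - 1)) - real (M + 1) * Im (Ln (Complex a v)) > 0" if "v < b"
  proof -
    have "a / b < a / v" using that assms a b by (intro divide_strict_left_mono) auto
    then have lt: "\<theta> < \<phi>" using th w arctan_less_iff[of "a/b" "a/v"] by linarith
    then have "\<theta> < \<theta>max" using \<phi> by simp
    then have "norm (z - 1) * sin (A - real (M + 1) * \<theta>) > 0"
      unfolding key2[OF \<open>\<theta> < \<theta>max\<close>] using sin_pos[of \<theta>] th2 lt \<phi> Re_saddle_curve_decreasing[of \<theta> \<phi>]
      by (intro mult_pos_pos divide_pos_pos) auto
    then have s: "sin (A - real (M + 1) * \<theta>) > 0" using nz by (simp add: zero_less_mult_iff)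
    show ?thesis
    proof (rule ccontr)
      assume "\<not> ?thesis"
      then have "A - real (M + 1) * \<theta> \<le> 0" by (simp add: A_def \<theta>_def z_def)
      moreover have "A - real (M + 1) * \<theta> > - pi"
        using A angle_bounds(1)[OF th2(1) \<open>\<theta> < \<theta>max\<close>] by linarith
      ultimately have "sin (- (A - real (M + 1) * \<theta>)) \<ge> 0" by (intro sin_ge_zero) auto
      then show False using s by (simp only: sin_minus)
    qed
  qed
  show "Im (Ln (Complex a v - 1)) - real (M + 1) * Im (Ln (Complex a v)) < 0" if "v > b"
  proof (cases "\<theta> < \<theta>max")
    case True
    have "a / v < a / b" using that assms a b by (intro divide_strict_left_mono) auto
    then have lt: "\<phi> < \<theta>" using th w arctan_less_iff[of "a/v" "a/b"] by linarith
    have "(sin (real M * \<theta>) / cos \<theta>) * (Re (saddle_curve M \<theta>) - a) < 0"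
      using sin_pos[of \<theta>] th2 True lt \<phi> Re_saddle_curve_decreasing[of \<phi> \<theta>]
      by (intro mult_pos_neg divide_pos_pos) auto
    then have s: "sin (A - real (M + 1) * \<theta>) < 0"
      using nz unfolding key2[OF True, symmetric] by (simp add: mult_less_0_iff)
    show ?thesis
    proof (rule ccontr)
      assume "\<not> ?thesis"
      then have "A - real (M + 1) * \<theta> \<ge> 0" by (simp add: A_def \<theta>_def z_def)
      moreover have "A - real (M + 1) * \<theta> < pi"
        using A th2 by (smt (verit) mult_nonneg_nonneg of_nat_0_le_iff)
      ultimately show False using s sin_ge_zero[of "A - real (M + 1) * \<theta>"] by linarith
    qed
  next
    \<comment> \<open>The curve has no point of this argument, but now (M+1)\<theta> is at least pi
      and hence above arg(z - 1).\<close>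
    case False
    then have "real (M + 1) * \<theta>max \<le> real (M + 1) * \<theta>" by (intro mult_left_mono) auto
    then show ?thesis using A unfolding \<theta>max(3) by (simp add: A_def \<theta>_def z_def)
  qed
qed

lemma phase_on_line_le:
  assumes "v > 0"
  shows "Re (phase M x\<^sub>0 (Complex a v)) \<le> Re (phase M x\<^sub>0 w)"
proof -
  define f where "f = (\<lambda>v. Re (phase M x\<^sub>0 (Complex a v)))"
  have "f v \<le> f b"
  proof (cases "v \<le> b")
    case True
    show ?thesis
    proof (rule DERIV_nonneg_imp_increasing_open[of v b f])
      show "continuous_on {v..b} f" unfolding f_def
        by (rule DERIV_continuous_on[OF line_derivative]) (use assms in auto)
    next
      fix x assume "v < x" "x < b"
      then show "\<exists>y. (f has_real_derivative y) (at x) \<and> 0 \<le> y"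
        unfolding f_def using line_derivative[of x UNIV] line_derivative_sign(1)[of x] assms by fastforce
    qed (use True in auto)
  next
    case False
    show ?thesis
    proof (rule DERIV_nonpos_imp_decreasing_open[of b v f])
      show "continuous_on {b..v} f" unfolding f_def
        by (rule DERIV_continuous_on[OF line_derivative]) (use b in auto)
    next
      fix x assume "b < x" "x < v"
      then show "\<exists>y. (f has_real_derivative y) (at x) \<and> y \<le> 0"
        unfolding f_def using line_derivative[of x UNIV] line_derivative_sign(2)[of x] b by fastforce
    qed (use False in auto)
  qed
  then show ?thesis by (simp add: f_def complex_eq_iff[symmetric])
qed

text \<open>As v grows both arguments tend to pi/2, so the slope tends to -M pi/2, which is below
  -1. Beyond a fixed height the phase therefore falls at least as fast as -v, and V covers the part
  below.\<close>

lemma phase_on_line_decay: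
  obtains V where "V > 0" "\<And>v. v > 0 \<Longrightarrow> Re (phase M x\<^sub>0 (Complex a v)) \<le> Re (phase M x\<^sub>0 w) + V - v"
proof -
  define d where "d = (\<lambda>v. (pi / 2 - arctan ((a - 1) / v)) - real (M + 1) * (pi / 2 - arctan (a / v)))"
  have lim: "((\<lambda>v. arctan (c / v)) \<longlongrightarrow> arctan 0) at_top" for c
    by (intro tendsto_intros real_tendsto_divide_at_top[OF tendsto_const filterlim_ident])
  have "(d \<longlongrightarrow> (pi / 2 - arctan 0) - real (M + 1) * (pi / 2 - arctan 0)) at_top"
    unfolding d_def by (intro tendsto_intros lim)
  moreover have "(pi / 2 - arctan 0) - real (M + 1) * (pi / 2 - arctan 0) < -1"
  proof -
    have "1 * (pi / 2) \<le> real M * (pi / 2)" using M by (intro mult_right_mono) auto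
    moreover have "(pi / 2 - arctan 0) - real (M + 1) * (pi / 2 - arctan 0) = - (real M * (pi / 2))"
      by (simp add: algebra_simps)
    ultimately show ?thesis using pi_gt3 by linarith
  qed
  ultimately have "\<forall>\<^sub>F v in at_top. d v < -1" by (rule order_tendstoD)
  then obtain V where V: "\<And>v. v \<ge> V \<Longrightarrow> d v < -1" by (auto simp: eventually_at_top_linorder)
  define V' where "V' = max V 1"
  define f where "f = (\<lambda>v. Re (phase M x\<^sub>0 (Complex a v)))"
  have "f v \<le> f b + V' - v" if v: "v > 0" for v
  proof (cases "v \<le> V'")
    case True
    then show ?thesis using phase_on_line_le[OF v] by (simp add: f_def)
  next
    case False
    have "f v + v \<le> f V' + V'"
    proof (rule DERIV_nonpos_imp_decreasing_open[of V' v "\<lambda>v. f v + v"])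
      show "continuous_on {V'..v} (\<lambda>v. f v + v)" unfolding f_def
        by (intro continuous_intros DERIV_continuous_on[OF line_derivative]) (auto simp: V'_def)
    next
      fix x assume x: "V' < x" "x < v"
      then have x0: "x > 0" "x \<ge> V" by (auto simp: V'_def)
      have "Im (Ln (Complex a x - 1)) = pi / 2 - arctan ((a - 1) / x)"
        "Im (Ln (Complex a x)) = pi / 2 - arctan (a / x)"
        using Im_Ln_upper[of "Complex a x - 1"] Im_Ln_upper[of "Complex a x"] x0 by auto
      then have "(f has_real_derivative d x) (at x)"
        unfolding f_def d_def using line_derivative[OF x0(1), of UNIV] by simp
      then have "((\<lambda>v. f v + v) has_real_derivative d x + 1) (at x)"
        by (auto intro!: derivative_eq_intros)
      then show "\<exists>y. ((\<lambda>v. f v + v) has_real_derivative y) (at x) \<and> y \<le> 0"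
        using V[OF x0(2)] by (intro exI[of _ "d x + 1"]) auto
    qed (use False in auto)
    moreover have "f V' \<le> f b" using phase_on_line_le[of V'] by (simp add: f_def V'_def)
    ultimately show ?thesis by simp
  qed
  then show ?thesis using that[of V'] by (simp add: f_def V'_def)
qed

text \<open>Transversality of the crossing: it separates the variables in the bound for $1/(s - t)$, so that no
  product measure is needed.\<close>

lemma line_contour_distance:
  obtains K where "K > 0"
    "\<And>v \<theta>. 0 < \<bar>\<theta>\<bar> \<Longrightarrow> \<bar>\<theta>\<bar> < \<theta>max \<Longrightarrow>
       \<bar>\<bar>v\<bar> - b\<bar> * \<bar>\<bar>\<theta>\<bar> - \<phi>\<bar> \<le> K * (norm (Complex a v - saddle_curve M \<theta>))\<^sup>2"
proof -
  obtain D where D: "D < 0" "((\<lambda>\<theta>. Re (saddle_curve M \<theta>)) has_real_derivative D) (at \<phi>)"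
    using Re_saddle_curve_derivative[OF \<phi>] by blast
  obtain c where c: "c > 0" "\<And>\<theta>. 0 < \<theta> \<Longrightarrow> \<theta> < \<theta>max \<Longrightarrow> c * \<bar>\<theta> - \<phi>\<bar> \<le> \<bar>Re (saddle_curve M \<theta>) - a\<bar>"
    by (rule strict_decreasing_linear_bound[OF \<phi> Re_saddle_curve_decreasing D(2)]) (use D in auto)
  obtain E where E: "\<And>\<theta>. \<bar>\<theta>\<bar> \<le> \<theta>max \<Longrightarrow> (saddle_curve M has_vector_derivative E \<theta>) (at \<theta>)"
    "continuous_on {-\<theta>max..\<theta>max} E" by (rule saddle_curve_C1) blast
  have "bounded (E ` {-\<theta>max..\<theta>max})"
    by (intro compact_imp_bounded compact_continuous_image E) auto
  then obtain B where B: "B > 0" "\<And>\<theta>. \<bar>\<theta>\<bar> \<le> \<theta>max \<Longrightarrow> norm (E \<theta>) \<le> B"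
    unfolding bounded_pos by (auto simp: abs_le_iff)
  have lip: "norm (saddle_curve M \<theta> - w) \<le> B * \<bar>\<theta> - \<phi>\<bar>" if "0 < \<theta>" "\<theta> < \<theta>max" for \<theta>
  proof -
    have "norm (saddle_curve M \<theta> - saddle_curve M \<phi>) \<le> B * norm (\<theta> - \<phi>)"
    proof (rule differentiable_bound[of "{0..\<theta>max}" "saddle_curve M" "\<lambda>\<theta> h. h *\<^sub>R E \<theta>"])
      show "(saddle_curve M has_derivative (\<lambda>h. h *\<^sub>R E t)) (at t within {0..\<theta>max})" if "t \<in> {0..\<theta>max}" for t
        using E(1)[of t] that by (auto simp: has_vector_derivative_def intro: has_derivative_at_withinI)
      show "onorm (\<lambda>h. h *\<^sub>R E t) \<le> B" if "t \<in> {0..\<theta>max}" for t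
      proof (rule onorm_le)
        fix h :: real
        have "norm (E t) \<le> B" using B(2)[of t] that by simp
        from mult_right_mono[OF this, of "norm h"] show "norm (h *\<^sub>R E t) \<le> B * norm h"
          by (simp add: mult.commute)
      qed
    qed (use that \<phi> in auto)
    then show ?thesis by simp
  qed
  \<comment> \<open>With N the distance of the two points, |\<theta> - \<phi>| is at most N/c by
    monotonicity of the real part, and the vertical distance to w is at most (1 + B/c) N by the
    Lipschitz bound; K is the product of the two constants.\<close>
  define K where "K = (1 + B / c) / c"
  have K: "K > 0" using B c by (auto simp: K_def intro!: divide_pos_pos add_pos_pos)
  have main: "\<bar>\<bar>v\<bar> - b\<bar> * \<bar>\<theta> - \<phi>\<bar> \<le> K * (norm (Complex a v - saddle_curve M \<theta>))\<^sup>2"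
    if t: "0 < \<theta>" "\<theta> < \<theta>max" for v \<theta>
  proof -
    define N where "N = norm (Complex a v - saddle_curve M \<theta>)"
    have "c * \<bar>\<theta> - \<phi>\<bar> \<le> N"
      using c(2)[OF t] abs_Re_le_cmod[of "Complex a v - saddle_curve M \<theta>"] by (simp add: N_def)
    then have 1: "\<bar>\<theta> - \<phi>\<bar> \<le> N / c" using c(1) by (simp add: field_simps)
    have "\<bar>\<bar>v\<bar> - b\<bar> \<le> \<bar>v - b\<bar>" using b by linarith
    also have "\<dots> \<le> norm (Complex a v - w)" using abs_Im_le_cmod[of "Complex a v - w"] by simp
    also have "\<dots> \<le> N + norm (saddle_curve M \<theta> - w)"
      using norm_triangle_ineq[of "Complex a v - saddle_curve M \<theta>" "saddle_curve M \<theta> - w"] by (simp add: N_def)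
    also have "\<dots> \<le> N + B * (N / c)"
      using lip[OF t] mult_left_mono[OF 1, of B] B by linarith
    also have "\<dots> = (1 + B / c) * N" by (simp add: algebra_simps)
    finally have "\<bar>\<bar>v\<bar> - b\<bar> * \<bar>\<theta> - \<phi>\<bar> \<le> (1 + B / c) * N * (N / c)"
      using 1 by (intro mult_mono) (auto simp: N_def intro!: mult_nonneg_nonneg add_nonneg_nonneg divide_nonneg_nonneg less_imp_le[OF B(1)] less_imp_le[OF c(1)])
    then show ?thesis by (simp add: K_def N_def power2_eq_square)
  qed
  have "\<bar>\<bar>v\<bar> - b\<bar> * \<bar>\<bar>\<theta>\<bar> - \<phi>\<bar> \<le> K * (norm (Complex a v - saddle_curve M \<theta>))\<^sup>2"
    if "0 < \<bar>\<theta>\<bar>" "\<bar>\<theta>\<bar> < \<theta>max" for v \<theta>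
  proof (cases "\<theta> > 0")
    case False
    have "norm (Complex a (- v) - saddle_curve M (- \<theta>)) = norm (cnj (Complex a v - saddle_curve M \<theta>))"
      by (simp add: saddle_curve_minus complex_cnj)
    also have "\<dots> = norm (Complex a v - saddle_curve M \<theta>)" by (rule complex_mod_cnj)
    finally have "norm (Complex a (- v) - saddle_curve M (- \<theta>)) = norm (Complex a v - saddle_curve M \<theta>)" .
    then show ?thesis using main[of "- \<theta>" "- v"] that False by simp
  qed (use main that in auto)
  then show ?thesis using K that by blast
qed

end

lemma stirling_exponent_cnj:
  "Im z \<noteq> 0 \<Longrightarrow> stirling_exponent (cnj z) = cnj (stirling_exponent z)"
  by (simp add: stirling_exponent_def cnj_Ln complex_nonpos_Reals_iff)

lemma phase_cnj: "Im z \<noteq> 0 \<Longrightarrow> phase M x (cnj z) = cnj (phase M x z)"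
  using stirling_exponent_cnj[of z] stirling_exponent_cnj[of "z - 1"] by (simp add: phase_def)

section \<open>Residues and vertical lines\<close>

lemma contour_integral_simple_poles:
  fixes R :: "complex \<Rightarrow> complex"
  assumes R: "R holomorphic_on UNIV" and P: "finite P" "z \<notin> P"
    and g: "valid_path g" "pathfinish g = pathstart g" "path_image g \<inter> insert z P = {}"
    and w: "\<And>p. p \<in> P \<Longrightarrow> winding_number g p = 1"
  shows "contour_integral g (\<lambda>t. R t / ((\<Prod>p\<in>P. t - p) * (z - t))) =
     2 * of_real pi * \<i> * ((\<Sum>p\<in>P. R p / ((\<Prod>q\<in>P - {p}. p - q) * (z - p)))
        - winding_number g z * (R z / (\<Prod>p\<in>P. z - p)))"
proof -
  define f where "f = (\<lambda>t. R t / ((\<Prod>p\<in>P. t - p) * (z - t)))"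
  have nz: "(\<Prod>p\<in>A. t - p) \<noteq> 0" if "t \<notin> A" "A \<subseteq> P" for t A
    using that P finite_subset[OF that(2)] by auto
  have holo: "f holomorphic_on UNIV - insert z P"
    unfolding f_def using nz[OF _ order.refl]
    by (intro holomorphic_intros holomorphic_on_subset[OF R]) auto
  have res_p: "residue f p = R p / ((\<Prod>q\<in>P - {p}. p - q) * (z - p))" if p: "p \<in> P" for p
  proof -
    define h where "h = (\<lambda>t. R t / ((\<Prod>q\<in>P - {p}. t - q) * (z - t)))"
    have "residue (\<lambda>t. h t / (t - p)) p = h p"
    proof (rule residue_simple)
      show "open (- insert z (P - {p}))" by (intro open_Compl finite_imp_closed) (use P in auto)
      show "h holomorphic_on - insert z (P - {p})"
        unfolding h_def using nz[of _ "P - {p}"]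
        by (intro holomorphic_intros holomorphic_on_subset[OF R]) auto
    qed (use p P in auto)
    moreover have "(\<lambda>t. h t / (t - p)) = f"
      unfolding h_def f_def using p P by (simp add: prod.remove[of P p] mult_ac fun_eq_iff)
    ultimately show ?thesis by (simp add: h_def)
  qed
  have res_z: "residue f z = - (R z / (\<Prod>p\<in>P. z - p))"
  proof -
    define h where "h = (\<lambda>t. - (R t / (\<Prod>q\<in>P. t - q)))"
    have "residue (\<lambda>t. h t / (t - z)) z = h z"
    proof (rule residue_simple)
      show "open (- P)" by (intro open_Compl finite_imp_closed) (use P in auto)
      show "h holomorphic_on - P"
        unfolding h_def using nz[of _ P]
        by (intro holomorphic_intros holomorphic_on_subset[OF R]) auto
    qed (use P in auto)
    moreover have "h t / (t - z) = f t" for t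
    proof -
      have "h t / (t - z) = (- R t) / ((\<Prod>q\<in>P. t - q) * (t - z))" by (simp add: h_def)
      also have "\<dots> = R t / ((\<Prod>q\<in>P. t - q) * (z - t))"
        by (metis (no_types, opaque_lifting) minus_diff_eq minus_divide_divide minus_mult_right minus_minus)
      finally show ?thesis by (simp add: f_def)
    qed
    ultimately show ?thesis by (simp add: h_def)
  qed
  have "contour_integral g f = 2 * pi * \<i> * (\<Sum>p\<in>insert z P. winding_number g p * residue f p)"
    by (rule Residue_theorem[OF _ _ _ holo g(1,2)]) (use P g in auto)
  then have "contour_integral g f = 2 * of_real pi * \<i> * (\<Sum>p\<in>insert z P. winding_number g p * residue f p)"
    by simp
  also have "(\<Sum>p\<in>insert z P. winding_number g p * residue f p)
      = (\<Sum>p\<in>P. R p / ((\<Prod>q\<in>P - {p}. p - q) * (z - p))) - winding_number g z * (R z / (\<Prod>p\<in>P. z - p))"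
    using P by (simp add: w res_p res_z)
  finally show ?thesis by (simp add: f_def)
qed

lemma integrable_inverse_1_plus_square: "integrable lborel (\<lambda>u::real. 1 / (1 + u\<^sup>2))"
proof -
  have "set_integrable lborel (einterval (-\<infinity>) \<infinity>) (\<lambda>u::real. 1 / (1 + u\<^sup>2))"
  proof (rule interval_integral_FTC_nonneg)
    show "(arctan has_real_derivative 1 / (1 + x\<^sup>2)) (at x)" for x
      using DERIV_arctan[of x] by (simp add: divide_inverse)
    show "isCont (\<lambda>u::real. 1 / (1 + u\<^sup>2)) x" for x
      by (intro continuous_intros) (smt (verit) zero_le_power2)
    show "((arctan \<circ> real_of_ereal) \<longlongrightarrow> - (pi / 2)) (at_right (-\<infinity>))"
      unfolding ereal_tendsto_simps by (rule tendsto_arctan_at_bot)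
    show "((arctan \<circ> real_of_ereal) \<longlongrightarrow> pi / 2) (at_left \<infinity>)"
      unfolding ereal_tendsto_simps by (rule tendsto_arctan_at_top)
  qed auto
  then show ?thesis by (simp add: set_integrable_def)
qed

text \<open>A primitive g on the half-plane replaces rectangular contours: the truncated integrals
  are differences of g, and they differ only by increments of g along two horizontal segments, which
  vanish by the decay in Im s.\<close>

lemma vertical_line_shift:
  fixes f :: "complex \<Rightarrow> complex"
  assumes f: "f holomorphic_on {s. Re s > l}" and le: "l < c" "c \<le> d"
    and bound: "\<And>s. c \<le> Re s \<Longrightarrow> Re s \<le> d \<Longrightarrow> norm (f s) \<le> C / (1 + (Im s)\<^sup>2)"
  shows "integrable lborel (\<lambda>u. f (Complex c u))" "integrable lborel (\<lambda>u. f (Complex d u))"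
    and "(LINT u|lborel. f (Complex c u)) = (LINT u|lborel. f (Complex d u))"
proof -
  define S where "S = {s. Re s > l}"
  have S: "convex S" "open S" unfolding S_def by (auto intro: convex_halfspace_Re_gt open_halfspace_Re_gt)
  obtain g where g: "\<And>s. s \<in> S \<Longrightarrow> (g has_field_derivative f s) (at s within S)"
    by (rule holomorphic_convex_primitive'[OF S]) (use f in \<open>auto simp: S_def\<close>)
  have g': "(g has_field_derivative f s) (at s within A)" if "s \<in> S" for s A
    using g[OF that] that S by (metis at_within_open has_field_derivative_at_within)
  have C: "C \<ge> 0" using bound[of "of_real c"] le norm_ge_zero[of "f (of_real c)"] by (simp del: norm_ge_zero) 
  have cont: "continuous_on UNIV (\<lambda>u. f (Complex e u))" if "e \<in> {c, d}" for e
    by (rule continuous_on_compose2[OF holomorphic_on_imp_continuous_on[OF f]])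
       (use that le in \<open>auto simp: Complex_eq intro!: continuous_intros\<close>)
  have int: "integrable lborel (\<lambda>u. f (Complex e u))" if "e \<in> {c, d}" for e
  proof (rule Bochner_Integration.integrable_bound)
    show "integrable lborel (\<lambda>u::real. C * (1 / (1 + u\<^sup>2)))"
      by (intro integrable_mult_right integrable_inverse_1_plus_square)
    show "(\<lambda>u. f (Complex e u)) \<in> borel_measurable lborel"
      using borel_measurable_continuous_onI[OF cont[OF that]] by simp
    show "AE u in lborel. norm (f (Complex e u)) \<le> norm (C * (1 / (1 + u\<^sup>2)))"
    proof (rule AE_I2)
      fix u :: real
      have "norm (f (Complex e u)) \<le> C / (1 + u\<^sup>2)" using bound[of "Complex e u"] that le by auto
      also have "\<dots> \<le> norm (C * (1 / (1 + u\<^sup>2)))" using C by simp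
      finally show "norm (f (Complex e u)) \<le> norm (C * (1 / (1 + u\<^sup>2)))" .
    qed
  qed
  show "integrable lborel (\<lambda>u. f (Complex c u))" "integrable lborel (\<lambda>u. f (Complex d u))"
    by (intro int; simp)+
  define G where "G = (\<lambda>e N. (g (Complex e (real N)) - g (Complex e (- real N))) / \<i>)"
  have lim: "G e \<longlonglongrightarrow> (LINT u|lborel. f (Complex e u))" if e: "e \<in> {c, d}" for e
  proof -
    have "(\<lambda>N. LINT u|lborel. indicator {- real N..real N} u *\<^sub>R f (Complex e u)) \<longlonglongrightarrow> (LINT u|lborel. f (Complex e u))"
    proof (rule integral_dominated_convergence[where w = "\<lambda>u. norm (f (Complex e u))"])
      show "AE u in lborel. (\<lambda>N. indicator {- real N..real N} u *\<^sub>R f (Complex e u)) \<longlonglongrightarrow> f (Complex e u)"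
      proof (rule AE_I2)
        fix u :: real
        have "\<forall>\<^sub>F N in sequentially. indicator {- real N..real N} u *\<^sub>R f (Complex e u) = f (Complex e u)"
        proof -
          obtain N0 :: nat where "\<bar>u\<bar> \<le> real N0" using real_arch_simple by blast
          then show ?thesis by (intro eventually_sequentiallyI[of N0]) (auto simp: indicator_def abs_le_iff)
        qed
        then show "(\<lambda>N. indicator {- real N..real N} u *\<^sub>R f (Complex e u)) \<longlonglongrightarrow> f (Complex e u)"
          by (rule tendsto_eventually)
      qed
      show "AE u in lborel. norm (indicator {- real N..real N} u *\<^sub>R f (Complex e u)) \<le> norm (f (Complex e u))" for N
        by (auto simp: indicator_def)
      show "integrable lborel (\<lambda>u. norm (f (Complex e u)))" using int[OF e] by simp
      show "(\<lambda>u. f (Complex e u)) \<in> borel_measurable lborel" using int[OF e] by simp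
      then show "(\<lambda>u. indicator {- real N..real N} u *\<^sub>R f (Complex e u)) \<in> borel_measurable lborel" for N
        by measurable
    qed
    moreover have "(LINT u|lborel. indicator {- real N..real N} u *\<^sub>R f (Complex e u)) = G e N" for N
    proof -
      have hi: "((\<lambda>u. f (Complex e u)) has_integral G e N) {- real N..real N}"
      proof -
        have "((\<lambda>u. f (Complex e u)) has_integral (g (Complex e (real N)) / \<i> - g (Complex e (- real N)) / \<i>)) {- real N..real N}"
        proof (rule fundamental_theorem_of_calculus)
          fix u
          have "((\<lambda>u. Complex e u) has_vector_derivative \<i>) (at u within {- real N..real N})"
            by (auto simp: Complex_eq intro!: derivative_eq_intros)
          moreover have "((\<lambda>s. g s / \<i>) has_field_derivative f (Complex e u) / \<i>) (at (Complex e u) within Complex e ` {- real N..real N})"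
            by (intro DERIV_cdivide g') (use e le in \<open>auto simp: S_def\<close>)
          ultimately show "((\<lambda>u. g (Complex e u) / \<i>) has_vector_derivative f (Complex e u)) (at u within {- real N..real N})"
            using field_vector_diff_chain_within by (fastforce simp: o_def)
        qed auto
        then show ?thesis unfolding G_def diff_divide_distrib .
      qed
      have "set_integrable lborel {- real N..real N} (\<lambda>u. f (Complex e u))"
        unfolding set_integrable_def using int[OF e] by (intro integrable_mult_indicator) auto
      from set_borel_integral_eq_integral(2)[OF this] show ?thesis
        using integral_unique[OF hi] by (simp add: set_lebesgue_integral_def)
    qed
    ultimately show ?thesis by simp
  qed
  have b: "norm (g (Complex d r) - g (Complex c r)) \<le> C / (1 + r\<^sup>2) * (d - c)" for r
  proof -
    have "norm (g (Complex d r) - g (Complex c r)) \<le> C / (1 + r\<^sup>2) * norm (Complex d r - Complex c r)"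
    proof (rule field_differentiable_bound[where f' = f and S = "closed_segment (Complex c r) (Complex d r)"])
      fix s assume "s \<in> closed_segment (Complex c r) (Complex d r)"
      then have s: "Im s = r" "c \<le> Re s" "Re s \<le> d"
      proof -
        obtain t where t: "0 \<le> t" "t \<le> 1" "s = (1 - t) *\<^sub>R Complex c r + t *\<^sub>R Complex d r"
          using \<open>s \<in> _\<close> unfolding closed_segment_def by auto
        have "t * c \<le> t * d" "(1 - t) * c \<le> (1 - t) * d" using t le by (auto intro!: mult_left_mono)
        moreover have "Re s = (1 - t) * c + t * d" "Im s = (1 - t) * r + t * r" by (simp_all add: t(3))
        ultimately show "Im s = r" "c \<le> Re s" "Re s \<le> d" by (simp_all add: left_diff_distrib)
      qed
      show "(g has_field_derivative f s) (at s within closed_segment (Complex c r) (Complex d r))"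
        using s le by (intro g') (auto simp: S_def)
      show "norm (f s) \<le> C / (1 + r\<^sup>2)" using bound[of s] s by simp
    qed auto
    also have "norm (Complex d r - Complex c r) = d - c" using le by (simp add: cmod_def)
    finally show ?thesis .
  qed
  have "(\<lambda>N. G d N - G c N) \<longlonglongrightarrow> 0"
  proof (rule Lim_null_comparison)
    show "\<forall>\<^sub>F N in sequentially. norm (G d N - G c N) \<le> 2 * (C * (d - c)) / real N"
    proof (rule eventually_mono[OF eventually_gt_at_top[of 0]])
      fix N :: nat assume N: "0 < N"
      have "norm (G d N - G c N) = norm ((g (Complex d (real N)) - g (Complex c (real N))) - (g (Complex d (- real N)) - g (Complex c (- real N))))"
      proof -
        have "G d N - G c N = ((g (Complex d (real N)) - g (Complex c (real N))) - (g (Complex d (- real N)) - g (Complex c (- real N)))) / \<i>"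
          unfolding G_def diff_divide_distrib[symmetric] by (simp only: algebra_simps)
        then show ?thesis by (simp only: norm_divide norm_ii div_by_1)
      qed
      also have "\<dots> \<le> C / (1 + (real N)\<^sup>2) * (d - c) + C / (1 + (real N)\<^sup>2) * (d - c)"
        using b[of "real N"] b[of "- real N"] by (intro order.trans[OF norm_triangle_ineq4]) auto
      also have "\<dots> = 2 * (C * (d - c)) / (1 + (real N)\<^sup>2)" by simp
      also have "\<dots> \<le> 2 * (C * (d - c)) / real N"
      proof (rule divide_left_mono)
        have "real N \<le> (real N)\<^sup>2" using N by (simp add: power2_eq_square)
        then show "real N \<le> 1 + (real N)\<^sup>2" by linarith
        show "0 \<le> 2 * (C * (d - c))" using C le by simp
        show "0 < (1 + (real N)\<^sup>2) * real N" using N by (intro mult_pos_pos add_pos_nonneg) auto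
      qed
      finally show "norm (G d N - G c N) \<le> 2 * (C * (d - c)) / real N" .
    qed
    show "(\<lambda>N. 2 * (C * (d - c)) / real N) \<longlonglongrightarrow> 0"
      by (rule real_tendsto_divide_at_top[OF tendsto_const filterlim_real_sequentially])
  qed
  moreover have "(\<lambda>N. G d N - G c N) \<longlonglongrightarrow> (LINT u|lborel. f (Complex d u)) - (LINT u|lborel. f (Complex c u))"
    by (intro tendsto_diff lim) auto
  ultimately show "(LINT u|lborel. f (Complex c u)) = (LINT u|lborel. f (Complex d u))"
    using LIMSEQ_unique by fastforce
qed

text \<open>In Gauss's product the numerator has the modulus it would have at Re z, and every factor
  z + k of the denominator is at least Re z + k in modulus.\<close>

lemma norm_Gamma_le_Gamma_Re:
  fixes z :: complex
  assumes "Re z > 0"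
  shows "norm (Gamma z) \<le> Gamma (Re z)"
proof (rule LIMSEQ_le)
  show "(\<lambda>n. norm (Gamma_series z n)) \<longlonglongrightarrow> norm (Gamma z)"
    by (intro tendsto_norm Gamma_series_LIMSEQ)
  show "Gamma_series (Re z) \<longlonglongrightarrow> Gamma (Re z)"
    by (rule Gamma_series_LIMSEQ)
  have poch: "pochhammer (Re z) n \<le> norm (pochhammer z n) \<and> 0 < pochhammer (Re z) n" for n
  proof (induction n)
    case (Suc n)
    have "pochhammer (Re z) n * (Re z + real n) \<le> norm (pochhammer z n) * norm (z + of_nat n)"
      using Suc complex_Re_le_cmod[of "z + of_nat n"] assms by (intro mult_mono) auto
    moreover have "0 < pochhammer (Re z) n * (Re z + real n)" using Suc assms by (intro mult_pos_pos) auto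
    ultimately show ?case by (simp add: pochhammer_Suc norm_mult)
  qed simp
  have "norm (Gamma_series z n) \<le> Gamma_series (Re z) n" for n
  proof -
    have "norm (Gamma_series z n) = fact n * exp (Re z * ln (real n)) / norm (pochhammer z (n + 1))"
      by (simp add: Gamma_series_def norm_divide norm_mult)
    also have "\<dots> \<le> fact n * exp (Re z * ln (real n)) / pochhammer (Re z) (n + 1)"
      using poch[of "n + 1"] by (intro divide_left_mono mult_pos_pos) auto
    finally show ?thesis by (simp add: Gamma_series_def)
  qed
  then show "\<exists>N. \<forall>n\<ge>N. norm (Gamma_series z n) \<le> Gamma_series (Re z) n" by blast
qed

text \<open>Gamma decays faster than every power on vertical strips: Gamma(s + m) is bounded there
  and equals Gamma(s) times a Pochhammer symbol of size |Im s|^m.\<close>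

lemma Gamma_strip_bound:
  assumes "0 < l"
  obtains C where "C > 0"
    "\<And>s::complex. l \<le> Re s \<Longrightarrow> Re s \<le> u \<Longrightarrow> norm (Gamma s) * (1 + \<bar>Im s\<bar>) ^ m \<le> C"
proof -
  have "compact (Gamma ` {l + real m..u + real m})"
    by (intro compact_continuous_image continuous_intros) (use assms in \<open>auto elim!: nonpos_Ints_cases\<close>)
  then obtain B where B: "B > 0" "\<And>t. l + real m \<le> t \<Longrightarrow> t \<le> u + real m \<Longrightarrow> \<bar>Gamma t\<bar> \<le> B"
    using compact_imp_bounded bounded_pos by (metis (no_types, lifting) atLeastAtMost_iff image_eqI real_norm_def)
  \<comment> \<open>Each factor s + k is at least l and at least |Im s| in modulus, hence at least
    their mean; this e fits below it.\<close>
  define e where "e = min l 1 / 2"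
  have e: "e > 0" using assms by (simp add: e_def)
  have "norm (Gamma s) * (1 + \<bar>Im s\<bar>) ^ m \<le> B / e ^ m" if s: "l \<le> Re s" "Re s \<le> u" for s :: complex
  proof -
    have k: "e * (1 + \<bar>Im s\<bar>) \<le> norm (s + of_nat k)" for k
    proof -
      have "\<bar>Im s\<bar> \<le> norm (s + of_nat k)" using abs_Im_le_cmod[of "s + of_nat k"] by simp
      moreover have "l \<le> norm (s + of_nat k)" using complex_Re_le_cmod[of "s + of_nat k"] s by simp
      moreover have "e * (1 + \<bar>Im s\<bar>) \<le> l / 2 + \<bar>Im s\<bar> / 2"
      proof -
        have "e \<le> l / 2" "e \<le> 1 / 2" by (auto simp: e_def)
        then have "e * 1 + e * \<bar>Im s\<bar> \<le> l / 2 + 1 / 2 * \<bar>Im s\<bar>" by (intro add_mono mult_right_mono) auto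
        then show ?thesis by (simp add: distrib_left)
      qed
      ultimately show ?thesis by linarith
    qed
    have "(e * (1 + \<bar>Im s\<bar>)) ^ j \<le> norm (pochhammer s j)" for j
    proof (induction j)
      case (Suc j)
      then have "(e * (1 + \<bar>Im s\<bar>)) ^ j * (e * (1 + \<bar>Im s\<bar>)) \<le> norm (pochhammer s j) * norm (s + of_nat j)"
        using k e by (intro mult_mono) auto
      then show ?case by (simp add: pochhammer_Suc norm_mult mult.commute)
    qed simp
    from mult_left_mono[OF this[of m], of "norm (Gamma s)"]
    have "norm (Gamma s) * (1 + \<bar>Im s\<bar>) ^ m * e ^ m \<le> norm (Gamma s * pochhammer s m)"
      by (simp add: power_mult_distrib norm_mult mult_ac)
    also have "Gamma s * pochhammer s m = Gamma (s + of_nat m)"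
    proof -
      have "s \<notin> \<int>\<^sub>\<le>\<^sub>0" using s assms by (auto elim!: nonpos_Ints_cases)
      then show ?thesis by (simp add: pochhammer_Gamma Gamma_eq_zero_iff)
    qed
    also have "norm \<dots> \<le> Gamma (Re (s + of_nat m))" using s assms by (intro norm_Gamma_le_Gamma_Re) auto
    also have "\<dots> \<le> B" using B(2)[of "Re s + real m"] s by auto
    finally show ?thesis using e by (simp add: field_simps)
  qed
  moreover have "B / e ^ m > 0" using B e by simp
  ultimately show ?thesis using that by blast
qed

section \<open>The kernel as one integral over a vertical line\<close>

definition gamma_prod :: "nat \<Rightarrow> (nat \<Rightarrow> nat) \<Rightarrow> complex \<Rightarrow> complex" where
  "gamma_prod M \<nu> s = (\<Prod>j=1..M. Gamma (s + of_nat (\<nu> j) + 1))"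

text \<open>Reciprocal Gamma functions are entire, so the numerator of the t-integrand has no poles
  at all.\<close>

definition rgamma_prod :: "nat \<Rightarrow> (nat \<Rightarrow> nat) \<Rightarrow> complex \<Rightarrow> complex" where
  "rgamma_prod M \<nu> t = (\<Prod>j=1..M. rGamma (t + of_nat (\<nu> j) + 1))"

text \<open>This polynomial is Gamma(s+1)/Gamma(s-n+1); it absorbs the factor with index 0, which is
  why the other products begin at index 1.\<close>

definition falling :: "nat \<Rightarrow> complex \<Rightarrow> complex" where
  "falling n s = (\<Prod>k<n. s - of_nat k)"

definition numer :: "nat \<Rightarrow> (nat \<Rightarrow> nat) \<Rightarrow> real \<Rightarrow> complex \<Rightarrow> complex" where
  "numer M \<nu> x t = of_real x powr t * rgamma_prod M \<nu> t"

text \<open>Sum of the residues in t at 0, ..., n-1 of the numerator divided by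
  \<open>falling n t * (s - t)\<close>.\<close>

definition residue_sum :: "nat \<Rightarrow> (nat \<Rightarrow> nat) \<Rightarrow> nat \<Rightarrow> real \<Rightarrow> complex \<Rightarrow> complex" where
  "residue_sum M \<nu> n x s =
     (\<Sum>k<n. numer M \<nu> x (of_nat k) / ((\<Prod>i\<in>{..<n}-{k}. of_nat k - of_nat i) * (s - of_nat k)))"

text \<open>The Gamma factors in $s$ times the sum of the $t$-residues, with the poles of the residue sum at
  $0, \dots, n-1$ cancelled.\<close>

definition line_integrand :: "nat \<Rightarrow> (nat \<Rightarrow> nat) \<Rightarrow> nat \<Rightarrow> real \<Rightarrow> real \<Rightarrow> complex \<Rightarrow> complex" where
  "line_integrand M \<nu> n x y s = gamma_prod M \<nu> s * of_real y powr (- s - 1) *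
     (\<Sum>k<n. numer M \<nu> x (of_nat k) / (\<Prod>i\<in>{..<n}-{k}. of_nat k - of_nat i) * (\<Prod>i\<in>{..<n}-{k}. s - of_nat i))"

lemma line_integrand_eq:
  assumes "s \<notin> of_nat ` {..<n}"
  shows "line_integrand M \<nu> n x y s =
     gamma_prod M \<nu> s * falling n s * of_real y powr (- s - 1) * residue_sum M \<nu> n x s"
proof -
  have "falling n s * (c / (d * (s - of_nat k))) = c / d * (\<Prod>i\<in>{..<n}-{k}. s - of_nat i)" if "k < n" for k c d
  proof -
    have "s - of_nat k \<noteq> 0" using assms that by auto
    moreover have "falling n s = (s - of_nat k) * (\<Prod>i\<in>{..<n}-{k}. s - of_nat i)"
      unfolding falling_def using that by (intro prod.remove) auto
    ultimately show ?thesis by simp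
  qed
  then have "falling n s * residue_sum M \<nu> n x s =
    (\<Sum>k<n. numer M \<nu> x (of_nat k) / (\<Prod>i\<in>{..<n}-{k}. of_nat k - of_nat i) * (\<Prod>i\<in>{..<n}-{k}. s - of_nat i))"
    by (simp add: residue_sum_def sum_distrib_left)
  then show ?thesis by (simp add: line_integrand_def mult_ac)
qed

lemma numer_holomorphic: "x > 0 \<Longrightarrow> numer M \<nu> x holomorphic_on A"
  unfolding numer_def rgamma_prod_def by (intro holomorphic_intros) auto

lemma contour_integral_numer:
  assumes x: "x > 0" and s: "s \<notin> of_nat ` {..<n}"
    and g: "valid_path g" "pathfinish g = pathstart g" "path_image g \<inter> insert s (of_nat ` {..<n}) = {}"
    and w: "\<And>k. k < n \<Longrightarrow> winding_number g (of_nat k) = 1"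
  shows "contour_integral g (\<lambda>t. numer M \<nu> x t / (falling n t * (s - t))) =
     2 * of_real pi * \<i> * (residue_sum M \<nu> n x s - winding_number g s * (numer M \<nu> x s / falling n s))"
proof -
  have inj: "inj_on (of_nat :: nat \<Rightarrow> complex) A" for A by (auto simp: inj_on_def)
  have f: "(\<Prod>p\<in>of_nat ` {..<n}. t - p) = falling n t" for t
    by (simp add: falling_def prod.reindex[OF inj])
  have d: "(\<Prod>q\<in>of_nat ` {..<n} - {of_nat k}. of_nat k - q) = (\<Prod>i\<in>{..<n}-{k}. of_nat k - of_nat i :: complex)" for k
  proof -
    have "(of_nat ` {..<n} - {of_nat k} :: complex set) = of_nat ` ({..<n} - {k})" by auto
    then show ?thesis by (simp add: prod.reindex[OF inj])
  qed
  have "winding_number g p = 1" if "p \<in> of_nat ` {..<n}" for p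
    using that w by auto
  then show ?thesis
    using contour_integral_simple_poles[OF numer_holomorphic[OF x, of M \<nu> UNIV] _ s g]
    by (simp add: f d sum.reindex[OF inj] residue_sum_def)
qed

text \<open>A pole of Gamma(t - n + 1) would make t an integer below n; such t is either one of 0,
  ..., n-1 or negative, and each case contradicts one of the assumptions.\<close>

lemma Gamma_quotient_falling:
  assumes "t + 1 \<notin> \<int>\<^sub>\<le>\<^sub>0" "t \<notin> of_nat ` {..<n}"
  shows "Gamma (t - of_nat n + 1) \<noteq> 0" "Gamma (t + 1) / Gamma (t - of_nat n + 1) = falling n t"
proof -
  have ni: "t - of_nat n + 1 \<notin> \<int>\<^sub>\<le>\<^sub>0"
  proof
    assume "t - of_nat n + 1 \<in> \<int>\<^sub>\<le>\<^sub>0"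
    then obtain m :: nat where m: "t - of_nat n + 1 = - of_nat m" by (auto elim: nonpos_Ints_cases')
    show False
    proof (cases "m + 1 \<le> n")
      case True
      then have "of_nat (n - (m + 1)) = (of_nat n - of_nat (m + 1) :: complex)" by (rule of_nat_diff)
      moreover have "t = of_nat n - of_nat (m + 1)" using m by (simp add: algebra_simps)
      ultimately have "t = of_nat (n - (m + 1))" by simp
      moreover have "n - (m + 1) < n" using True by simp
      ultimately show False using assms(2) by blast
    next
      case False
      then have "t + 1 = - of_nat (m - n)" using m by (simp add: of_nat_diff algebra_simps)
      then show False using assms(1) by simp
    qed
  qed
  then show "Gamma (t - of_nat n + 1) \<noteq> 0" by (simp add: Gamma_eq_zero_iff)
  have "Gamma (t + 1) / Gamma (t - of_nat n + 1) = pochhammer (t - of_nat n + 1) n"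
    using pochhammer_Gamma[OF ni, of n] by simp
  also have "\<dots> = (\<Prod>i<n. t - of_nat n + 1 + of_nat i)"
    by (simp add: pochhammer_prod atLeast0LessThan)
  also have "\<dots> = falling n t"
    unfolding falling_def
    by (rule prod.reindex_bij_witness[of _ "\<lambda>i. n - 1 - i" "\<lambda>i. n - 1 - i"]) (auto simp: of_nat_diff algebra_simps)
  finally show "Gamma (t + 1) / Gamma (t - of_nat n + 1) = falling n t" .
qed

lemma kernel_integrand_eq:
  assumes nu: "\<nu> 0 = 0" and s: "Re s = - 1 / 2" and t: "Re t > - 1 / 2" "t \<notin> of_nat ` {..<n}"
  shows "kernel_integrand M \<nu> n x y s t =
    gamma_prod M \<nu> s * falling n s * of_real y powr (- s - 1) * (numer M \<nu> x t / (falling n t * (s - t)))"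
proof -
  have ni: "s + 1 \<notin> \<int>\<^sub>\<le>\<^sub>0" "t + 1 \<notin> \<int>\<^sub>\<le>\<^sub>0"
    using s t by (auto elim!: nonpos_Ints_cases simp: complex_eq_iff)
  have sn: "s \<notin> of_nat ` {..<n}" using s by auto
  have "(\<Prod>j=0..M. Gamma (s + of_nat (\<nu> j) + 1) / Gamma (t + of_nat (\<nu> j) + 1)) =
     Gamma (s + 1) / Gamma (t + 1) * (\<Prod>j=1..M. Gamma (s + of_nat (\<nu> j) + 1) / Gamma (t + of_nat (\<nu> j) + 1))"
    by (simp add: prod.atLeast_Suc_atMost nu)
  also have "(\<Prod>j=1..M. Gamma (s + of_nat (\<nu> j) + 1) / Gamma (t + of_nat (\<nu> j) + 1)) = gamma_prod M \<nu> s * rgamma_prod M \<nu> t"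
    by (simp add: gamma_prod_def rgamma_prod_def rGamma_inverse_Gamma prod_dividef divide_inverse prod.distrib)
  finally have 1: "(\<Prod>j=0..M. Gamma (s + of_nat (\<nu> j) + 1) / Gamma (t + of_nat (\<nu> j) + 1)) =
     Gamma (s + 1) / Gamma (t + 1) * (gamma_prod M \<nu> s * rgamma_prod M \<nu> t)" .
  have "Gamma (t + 1) \<noteq> 0" using ni by (simp add: Gamma_eq_zero_iff)
  then have 2: "Gamma (s + 1) / Gamma (t + 1) * (Gamma (t - of_nat n + 1) / Gamma (s - of_nat n + 1)) = falling n s / falling n t"
    unfolding Gamma_quotient_falling(2)[OF ni(1) sn, symmetric] Gamma_quotient_falling(2)[OF ni(2) t(2), symmetric]
    by simp
  define A where "A = Gamma (s + 1) / Gamma (t + 1)"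
  define B where "B = Gamma (t - of_nat n + 1) / Gamma (s - of_nat n + 1)"
  define G where "G = gamma_prod M \<nu> s * rgamma_prod M \<nu> t"
  have "kernel_integrand M \<nu> n x y s t = (A * B) * (G * (of_real x powr t * of_real y powr (- s - 1) / (s - t)))"
    unfolding kernel_integrand_def 1 A_def[symmetric] B_def[symmetric] G_def[symmetric] by (simp only: mult_ac)
  also have "A * B = falling n s / falling n t" using 2 by (simp add: A_def B_def)
  finally show ?thesis by (simp add: G_def numer_def mult_ac)
qed

text \<open>The path lies in the convex half-plane Re t > -1/2 and s on its boundary, so s has
  winding number 0 and only the poles at 0, ..., n-1 contribute. From here on the choice of
  \<open>\<Sigma>\<close> is irrelevant.\<close>

lemma contour_integral_kernel_integrand:
  assumes nu: "\<nu> 0 = 0" and enc: "encloses_once n \<Sigma>" and x: "x > 0" and s: "Re s = - 1 / 2"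
  shows "contour_integral \<Sigma> (kernel_integrand M \<nu> n x y s) = 2 * of_real pi * \<i> * line_integrand M \<nu> n x y s"
proof -
  have e: "valid_path \<Sigma>" "pathfinish \<Sigma> = pathstart \<Sigma>" "\<And>t. t \<in> path_image \<Sigma> \<Longrightarrow> Re t > - 1 / 2"
    "\<And>k. k < n \<Longrightarrow> of_nat k \<notin> path_image \<Sigma>" "\<And>k. k < n \<Longrightarrow> winding_number \<Sigma> (of_nat k) = 1"
    using enc by (auto simp: encloses_once_def)
  have sn: "s \<notin> of_nat ` {..<n}" using s by auto
  have ws: "winding_number \<Sigma> s = 0"
    by (rule winding_number_zero_outside[OF valid_path_imp_path[OF e(1)] convex_halfspace_Re_gt[of "-1/2"] e(2)])
       (use e(3) s in auto)
  have "contour_integral \<Sigma> (kernel_integrand M \<nu> n x y s) =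
    contour_integral \<Sigma> (\<lambda>t. gamma_prod M \<nu> s * falling n s * of_real y powr (- s - 1) * (numer M \<nu> x t / (falling n t * (s - t))))"
  proof (rule contour_integral_cong[OF refl])
    fix t assume t: "t \<in> path_image \<Sigma>"
    show "kernel_integrand M \<nu> n x y s t = gamma_prod M \<nu> s * falling n s * of_real y powr (- s - 1) * (numer M \<nu> x t / (falling n t * (s - t)))"
      by (rule kernel_integrand_eq[where \<nu> = \<nu>, OF nu s e(3)[OF t]]) (use e(4) t in auto)
  qed
  also have "\<dots> = gamma_prod M \<nu> s * falling n s * of_real y powr (- s - 1) *
      contour_integral \<Sigma> (\<lambda>t. numer M \<nu> x t / (falling n t * (s - t)))"
  proof (rule contour_integral_lmul)
    show "(\<lambda>t. numer M \<nu> x t / (falling n t * (s - t))) contour_integrable_on \<Sigma>"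
    proof (rule contour_integrable_holomorphic_simple[OF _ _ e(1)])
      show "open (- insert s (of_nat ` {..<n}))" by (intro open_Compl finite_imp_closed) auto
      show "(\<lambda>t. numer M \<nu> x t / (falling n t * (s - t))) holomorphic_on - insert s (of_nat ` {..<n})"
        unfolding falling_def by (intro holomorphic_intros numer_holomorphic[OF x]) auto
      show "path_image \<Sigma> \<subseteq> - insert s (of_nat ` {..<n})" using e(3,4) s by fastforce
    qed
  qed
  also have "contour_integral \<Sigma> (\<lambda>t. numer M \<nu> x t / (falling n t * (s - t))) = 2 * of_real pi * \<i> * residue_sum M \<nu> n x s"
    using contour_integral_numer[OF x sn e(1,2) _ e(5)] e(3,4) s ws by fastforce
  finally show ?thesis by (simp add: line_integrand_eq[OF sn] mult_ac)
qed

lemma line_integrand_bound: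
  assumes M: "M \<ge> 1" and y: "y > 0"
  obtains C where "\<And>s. - 1 / 2 \<le> Re s \<Longrightarrow> Re s \<le> d \<Longrightarrow> norm (line_integrand M \<nu> n x y s) \<le> C / (1 + (Im s)\<^sup>2)"
proof -
  have G: "\<exists>B>0. \<forall>s. - 1 / 2 \<le> Re s \<longrightarrow> Re s \<le> d \<longrightarrow> norm (Gamma (s + of_nat (\<nu> j) + 1)) * (1 + \<bar>Im s\<bar>) ^ m \<le> B" for j m
  proof -
    obtain B where B: "B > 0" "\<And>s::complex. 1 / 2 \<le> Re s \<Longrightarrow> Re s \<le> d + real (\<nu> j) + 1 \<Longrightarrow> norm (Gamma s) * (1 + \<bar>Im s\<bar>) ^ m \<le> B"
      by (rule Gamma_strip_bound[of "1/2"]) auto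
    have "norm (Gamma (s + of_nat (\<nu> j) + 1)) * (1 + \<bar>Im s\<bar>) ^ m \<le> B" if "- 1 / 2 \<le> Re s" "Re s \<le> d" for s
      using B(2)[of "s + of_nat (\<nu> j) + 1"] that by auto
    then show ?thesis using B(1) by blast
  qed
  obtain B0 where B0: "\<And>j. B0 j > 0" "\<And>j s. - 1 / 2 \<le> Re s \<Longrightarrow> Re s \<le> d \<Longrightarrow> norm (Gamma (s + of_nat (\<nu> j) + 1)) \<le> B0 j"
    using G[of _ 0] by (metis mult.right_neutral power_0)
  \<comment> \<open>One Gamma factor suffices for the decay: n powers beat the polynomial in s, and
    two more leave an integrable bound. The remaining factors only need to be bounded.\<close>
  obtain B1 where B1: "B1 > 0" "\<And>s. - 1 / 2 \<le> Re s \<Longrightarrow> Re s \<le> d \<Longrightarrow> norm (Gamma (s + of_nat (\<nu> 1) + 1)) * (1 + \<bar>Im s\<bar>) ^ (n + 2) \<le> B1"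
    using G[of 1 "n + 2"] by auto
  define B where "B = B1 * (\<Prod>j=2..M. B0 j)"
  have B: "B \<ge> 0" using B1 B0 by (auto simp: B_def intro!: less_imp_le[OF mult_pos_pos] prod_pos)
  have gp: "norm (gamma_prod M \<nu> s) * (1 + \<bar>Im s\<bar>) ^ (n + 2) \<le> B" if s: "- 1 / 2 \<le> Re s" "Re s \<le> d" for s
  proof -
    have "norm (gamma_prod M \<nu> s) = norm (Gamma (s + of_nat (\<nu> 1) + 1)) * (\<Prod>j=2..M. norm (Gamma (s + of_nat (\<nu> j) + 1)))"
      using M unfolding gamma_prod_def by (subst prod.atLeast_Suc_atMost) (auto simp: norm_mult prod_norm numeral_2_eq_2)
    then have "norm (gamma_prod M \<nu> s) * (1 + \<bar>Im s\<bar>) ^ (n + 2) =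
       (norm (Gamma (s + of_nat (\<nu> 1) + 1)) * (1 + \<bar>Im s\<bar>) ^ (n + 2)) * (\<Prod>j=2..M. norm (Gamma (s + of_nat (\<nu> j) + 1)))"
      by (simp add: mult_ac)
    also have "\<dots> \<le> B1 * (\<Prod>j=2..M. B0 j)"
      using B0(2)[OF s] B1 B1(2)[OF s] by (intro mult_mono prod_mono) (auto intro!: prod_nonneg)
    finally show ?thesis by (simp add: B_def)
  qed
  define K where "K = \<bar>d\<bar> + real n + 1"
  have K: "K \<ge> 1" by (simp add: K_def)
  have lin: "norm (s - of_nat i) \<le> K * (1 + \<bar>Im s\<bar>)" if s: "- 1 / 2 \<le> Re s" "Re s \<le> d" and "i < n" for s i
  proof -
    have "norm (s - of_nat i) \<le> \<bar>Re (s - of_nat i)\<bar> + \<bar>Im (s - of_nat i)\<bar>" by (rule cmod_le)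
    also have "\<dots> \<le> K + 1 * \<bar>Im s\<bar>" using s \<open>i < n\<close> by (auto simp: K_def)
    also have "\<dots> \<le> K + K * \<bar>Im s\<bar>" using K by (intro add_left_mono mult_right_mono) auto
    finally show ?thesis by (simp add: distrib_left)
  qed
  define T where "T = (\<lambda>s. \<Sum>k<n. numer M \<nu> x (of_nat k) / (\<Prod>i\<in>{..<n}-{k}. of_nat k - of_nat i) * (\<Prod>i\<in>{..<n}-{k}. s - of_nat i))"
  define D where "D = (\<Sum>k<n. norm (numer M \<nu> x (of_nat k) / (\<Prod>i\<in>{..<n}-{k}. of_nat k - of_nat i :: complex)) * K ^ n)"
  have D: "D \<ge> 0" using K by (auto simp: D_def intro!: sum_nonneg)
  have T: "norm (T s) \<le> D * (1 + \<bar>Im s\<bar>) ^ n" if s: "- 1 / 2 \<le> Re s" "Re s \<le> d" for s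
  proof -
    have p: "norm (\<Prod>i\<in>{..<n}-{k}. s - of_nat i) \<le> K ^ n * (1 + \<bar>Im s\<bar>) ^ n" if "k < n" for k
    proof -
      have "norm (\<Prod>i\<in>{..<n}-{k}. s - of_nat i) \<le> (\<Prod>i\<in>{..<n}-{k}. K * (1 + \<bar>Im s\<bar>))"
        unfolding prod_norm[symmetric] using lin[OF s] by (intro prod_mono) auto
      also have "\<dots> = (K * (1 + \<bar>Im s\<bar>)) ^ (n - 1)" using that by (simp add: prod_constant card_Diff_singleton)
      also have "\<dots> \<le> (K * (1 + \<bar>Im s\<bar>)) ^ n"
      proof (rule power_increasing)
        have "1 * 1 \<le> K * (1 + \<bar>Im s\<bar>)" using K by (intro mult_mono) auto
        then show "1 \<le> K * (1 + \<bar>Im s\<bar>)" by simp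
      qed simp
      finally show ?thesis by (simp add: power_mult_distrib)
    qed
    have "norm (T s) \<le> (\<Sum>k<n. norm (numer M \<nu> x (of_nat k) / (\<Prod>i\<in>{..<n}-{k}. of_nat k - of_nat i :: complex)) * (K ^ n * (1 + \<bar>Im s\<bar>) ^ n))"
      unfolding T_def
    proof (intro order.trans[OF norm_sum] sum_mono)
      fix k assume "k \<in> {..<n}"
      then have "norm (\<Prod>i\<in>{..<n}-{k}. s - of_nat i) \<le> K ^ n * (1 + \<bar>Im s\<bar>) ^ n" by (intro p) simp
      then show "norm (numer M \<nu> x (of_nat k) / (\<Prod>i\<in>{..<n}-{k}. of_nat k - of_nat i) * (\<Prod>i\<in>{..<n}-{k}. s - of_nat i))
        \<le> norm (numer M \<nu> x (of_nat k) / (\<Prod>i\<in>{..<n}-{k}. of_nat k - of_nat i :: complex)) * (K ^ n * (1 + \<bar>Im s\<bar>) ^ n)"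
        unfolding norm_mult[of "numer M \<nu> x (of_nat k) / _"] by (rule mult_left_mono) simp
    qed
    also have "\<dots> = D * (1 + \<bar>Im s\<bar>) ^ n"
      unfolding D_def sum_distrib_right mult.assoc ..
    finally show ?thesis .
  qed
  define E where "E = exp (\<bar>ln y\<bar> * (\<bar>d\<bar> + 2))"
  have pw: "norm (of_real y powr (- s - 1)) \<le> E" if s: "- 1 / 2 \<le> Re s" "Re s \<le> d" for s
  proof -
    have "norm (of_real y powr (- s - 1)) = exp ((- Re s - 1) * ln y)"
      using y by (simp add: norm_powr_real_powr powr_def)
    also have "\<bar>(- Re s - 1) * ln y\<bar> \<le> (\<bar>d\<bar> + 2) * \<bar>ln y\<bar>"
      unfolding abs_mult using s by (intro mult_right_mono) auto
    then have "exp ((- Re s - 1) * ln y) \<le> E" by (simp add: E_def mult.commute abs_le_iff)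
    finally show ?thesis .
  qed
  have "norm (line_integrand M \<nu> n x y s) \<le> (B * E * D) / (1 + (Im s)\<^sup>2)" if s: "- 1 / 2 \<le> Re s" "Re s \<le> d" for s
  proof -
    define q where "q = 1 + \<bar>Im s\<bar>"
    have q: "q \<ge> 1" "1 + (Im s)\<^sup>2 \<le> q\<^sup>2" by (auto simp: q_def power2_eq_square algebra_simps)
    have "norm (line_integrand M \<nu> n x y s) * q ^ (n + 2) = (norm (gamma_prod M \<nu> s) * q ^ (n + 2)) * norm (of_real y powr (- s - 1) :: complex) * norm (T s)"
      by (simp add: line_integrand_def T_def norm_mult mult_ac)
    also have "\<dots> \<le> B * E * (D * q ^ n)"
      using gp[OF s] pw[OF s] T[OF s] B q by (intro mult_mono) (auto simp: q_def E_def)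
    finally have "(norm (line_integrand M \<nu> n x y s) * q\<^sup>2) * q ^ n \<le> (B * E * D) * q ^ n"
      by (simp add: power_add power2_eq_square mult_ac)
    then have "norm (line_integrand M \<nu> n x y s) * q\<^sup>2 \<le> B * E * D"
      by (rule mult_right_le_imp_le) (use q in auto)
    moreover have "norm (line_integrand M \<nu> n x y s) * (1 + (Im s)\<^sup>2) \<le> norm (line_integrand M \<nu> n x y s) * q\<^sup>2"
      using q by (intro mult_left_mono) auto
    moreover have "1 + (Im s)\<^sup>2 > 0" by (simp add: add_pos_nonneg)
    ultimately show ?thesis by (simp add: pos_le_divide_eq)
  qed
  then show ?thesis by (rule that)
qed

lemma line_integrand_holomorphic:
  assumes "y > 0"
  shows "line_integrand M \<nu> n x y holomorphic_on {s. Re s > - 1}"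
  unfolding line_integrand_def gamma_prod_def
  by (intro holomorphic_intros) (use assms in \<open>auto elim!: nonpos_Ints_cases' simp: complex_eq_iff\<close>)

text \<open>The line moves right across 0, ..., n-1 without residues, since
  \<open>line_integrand\<close> has no poles there. The constant is i * 2 pi i / (2 pi i)^2 = 1/(2
  pi).\<close>

theorem ginibre_kernel_line:
  assumes M: "M \<ge> 1" and nu: "\<nu> 0 = 0" and enc: "encloses_once n \<Sigma>"
    and xy: "x > 0" "y > 0" and c: "c \<ge> - 1 / 2"
  shows "integrable lborel (\<lambda>u. line_integrand M \<nu> n x y (Complex c u))"
    and "ginibre_kernel M \<nu> n \<Sigma> x y = 1 / (2 * of_real pi) * (LINT u|lborel. line_integrand M \<nu> n x y (Complex c u))"
proof -
  obtain C where C: "\<And>s. - 1 / 2 \<le> Re s \<Longrightarrow> Re s \<le> c \<Longrightarrow> norm (line_integrand M \<nu> n x y s) \<le> C / (1 + (Im s)\<^sup>2)"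
    by (rule line_integrand_bound[OF M xy(2), where d = c and \<nu> = \<nu> and n = n and x = x]) blast
  note shift = vertical_line_shift[OF line_integrand_holomorphic[OF xy(2)] _ c C]
  show "integrable lborel (\<lambda>u. line_integrand M \<nu> n x y (Complex c u))"
    by (rule shift(2)) auto
  have "ginibre_kernel M \<nu> n \<Sigma> x y =
     1 / (2 * of_real pi * \<i>)\<^sup>2 * (LINT u|lborel. \<i> * (2 * of_real pi * \<i>) * line_integrand M \<nu> n x y (Complex (- 1 / 2) u))"
    unfolding ginibre_kernel_def
    by (subst contour_integral_kernel_integrand[where \<nu> = \<nu>, OF nu enc xy(1)]) (auto simp: mult_ac)
  also have "\<dots> = 1 / (2 * of_real pi * \<i>)\<^sup>2 * (\<i> * (2 * of_real pi * \<i>)) * (LINT u|lborel. line_integrand M \<nu> n x y (Complex (- 1 / 2) u))"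
    by (subst integral_mult_right_zero) (simp add: mult_ac)
  also have "1 / (2 * of_real pi * \<i>)\<^sup>2 * (\<i> * (2 * of_real pi * \<i>)) = 1 / (2 * of_real pi :: complex)"
    by (simp add: power2_eq_square field_simps)
  also have "(LINT u|lborel. line_integrand M \<nu> n x y (Complex (- 1 / 2) u)) = (LINT u|lborel. line_integrand M \<nu> n x y (Complex c u))"
    by (rule shift(3)) auto
  finally show "ginibre_kernel M \<nu> n \<Sigma> x y = 1 / (2 * of_real pi) * (LINT u|lborel. line_integrand M \<nu> n x y (Complex c u))" .
qed

section \<open>Splitting off the main term\<close>

context bulk_point
begin

text \<open>The shift by 1/2 turns Gamma(t + 1) into Gamma(n z + 1/2), the form covered by the
  Stirling estimates.\<close>

definition scaled_contour :: "nat \<Rightarrow> real \<Rightarrow> complex" where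
  "scaled_contour n x = of_nat n * contour x - 1 / 2"

lemma scaled_contour_has_derivative:
  assumes "(contour has_vector_derivative D) (at x)"
  shows "(scaled_contour n has_vector_derivative of_nat n * D) (at x)"
  unfolding scaled_contour_def by (auto intro!: derivative_eq_intros assms)

lemma valid_path_scaled_contour: "valid_path (scaled_contour n)"
proof (rule contour_C1)
  fix D assume D: "\<And>x. x \<in> {0..1} \<Longrightarrow> (contour has_vector_derivative D x) (at x)" "continuous_on {0..1} D"
  have "scaled_contour n C1_differentiable_on {0..1}"
    unfolding C1_differentiable_on_def
    by (intro exI[of _ "\<lambda>x. of_nat n * D x"] conjI ballI scaled_contour_has_derivative D continuous_intros)
  then show ?thesis unfolding valid_path_def by (rule C1_differentiable_imp_piecewise)
qed

lemma scaled_contour_closed: "pathfinish (scaled_contour n) = pathstart (scaled_contour n)"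
  using contour_closed by (simp add: scaled_contour_def pathfinish_def pathstart_def)

lemma path_image_scaled_contour: "path_image (scaled_contour n) = (\<lambda>z. of_nat n * z - 1 / 2) ` path_image contour"
  by (auto simp: path_image_def scaled_contour_def)

lemma winding_number_scaled_contour:
  assumes n: "n \<ge> 1" and p: "p \<notin> path_image contour"
  shows "of_nat n * p - 1 / 2 \<notin> path_image (scaled_contour n)"
    and "winding_number (scaled_contour n) (of_nat n * p - 1 / 2) = winding_number contour p"
proof -
  show np: "of_nat n * p - 1 / 2 \<notin> path_image (scaled_contour n)"
    using n p by (auto simp: path_image_scaled_contour)
  obtain D where D: "\<And>x. x \<in> {0..1} \<Longrightarrow> (contour has_vector_derivative D x) (at x)"
    by (rule contour_C1) blast
  have "contour_integral (scaled_contour n) (\<lambda>w. 1 / (w - (of_nat n * p - 1 / 2))) = contour_integral contour (\<lambda>w. 1 / (w - p))"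
    unfolding contour_integral_integral
  proof (rule integral_cong)
    fix x :: real assume x: "x \<in> {0..1}"
    have "vector_derivative contour (at x) = D x"
      by (rule vector_derivative_at[OF D[OF x]])
    moreover have "vector_derivative (scaled_contour n) (at x) = of_nat n * D x"
      by (rule vector_derivative_at[OF scaled_contour_has_derivative[OF D[OF x]]])
    moreover have "scaled_contour n x - (of_nat n * p - 1 / 2) = of_nat n * (contour x - p)"
      by (simp add: scaled_contour_def algebra_simps)
    ultimately show "1 / (scaled_contour n x - (of_nat n * p - 1 / 2)) * vector_derivative (scaled_contour n) (at x)
        = 1 / (contour x - p) * vector_derivative contour (at x)"
      using n by simp
  qed
  then show "winding_number (scaled_contour n) (of_nat n * p - 1 / 2) = winding_number contour p"
    using winding_number_valid_path[OF valid_path_scaled_contour np] winding_number_valid_path[OF valid_path_contour p]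
    by simp
qed

lemma nat_scaled_contour:
  assumes "k < n"
  shows "of_nat k \<notin> path_image (scaled_contour n)" "winding_number (scaled_contour n) (of_nat k) = 1"
proof -
  \<comment> \<open>The pole k sits at the midpoint of the cell from k/n to (k+1)/n in the scaled
    picture, hence inside (0, 1).\<close>
  define p where "p = (real k + 1 / 2) / real n"
  have n: "n \<ge> 1" using assms by simp
  have k: "of_nat k = of_nat n * complex_of_real p - 1 / 2"
    using assms by (simp add: p_def)
  have "0 < p" "p < 1" using assms by (auto simp: p_def field_simps)
  then have p: "0 < p" "p < 1 + 1 / real M" using M by (auto intro: order.strict_trans)
  show "of_nat k \<notin> path_image (scaled_contour n)" "winding_number (scaled_contour n) (of_nat k) = 1"
    unfolding k using winding_number_scaled_contour[OF n real_notin_contour[OF p]] winding_number_contour_real[OF p]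
    by auto
qed

lemma gamma_prod_rgamma_prod:
  assumes "Re s > - 1"
  shows "gamma_prod M \<nu> s * rgamma_prod M \<nu> s = 1"
proof -
  have "Gamma (s + of_nat (\<nu> j) + 1) * rGamma (s + of_nat (\<nu> j) + 1) = 1" for j
  proof -
    have "s + of_nat (\<nu> j) + 1 \<notin> \<int>\<^sub>\<le>\<^sub>0" using assms by (auto elim!: nonpos_Ints_cases' simp: complex_eq_iff)
    then show ?thesis by (simp add: rGamma_inverse_Gamma Gamma_eq_zero_iff)
  qed
  then show ?thesis by (simp add: gamma_prod_def rgamma_prod_def flip: prod.distrib)
qed

text \<open>The residue sum equals the integral over the saddle curve plus the winding number times
  the term from t = s. At t = s all Gamma factors cancel and only the powers of x and y survive. The
  condition on v keeps s off the curve and off the poles.\<close>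

lemma line_integrand_decomposition:
  assumes n: "n \<ge> 1" and xy: "x > 0" "y > 0" and v: "\<bar>v\<bar> \<noteq> b" "v \<noteq> 0"
  defines "s \<equiv> of_nat n * Complex a v - 1 / 2"
  shows "line_integrand M \<nu> n x y s =
     (if \<bar>v\<bar> < b then of_real x powr s * of_real y powr (- s - 1) else 0) +
     gamma_prod M \<nu> s * falling n s * of_real y powr (- s - 1) / (2 * of_real pi * \<i>) *
       contour_integral (scaled_contour n) (\<lambda>t. numer M \<nu> x t / (falling n t * (s - t)))"
proof -
  have Im: "Im s = real n * v" and Re: "Re s = real n * a - 1 / 2" by (simp_all add: s_def)
  have sn: "s \<notin> of_nat ` {..<n}" using Im n v(2) by auto
  have w: "s \<notin> path_image (scaled_contour n)" "winding_number (scaled_contour n) s = (if \<bar>v\<bar> < b then 1 else 0)"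
    unfolding s_def
    using winding_number_scaled_contour[OF n line_notin_contour[OF v(1)]] winding_number_contour_line[OF v(1)] by auto
  have f: "falling n s \<noteq> 0" using sn by (auto simp: falling_def)
  have "real n * a \<ge> 0" using a by simp
  then have g: "gamma_prod M \<nu> s * rgamma_prod M \<nu> s = 1" using Re by (intro gamma_prod_rgamma_prod) auto
  define I where "I = contour_integral (scaled_contour n) (\<lambda>t. numer M \<nu> x t / (falling n t * (s - t)))"
  have "I = 2 * of_real pi * \<i> * (residue_sum M \<nu> n x s - winding_number (scaled_contour n) s * (numer M \<nu> x s / falling n s))"
    unfolding I_def
    by (rule contour_integral_numer[OF xy(1) sn valid_path_scaled_contour scaled_contour_closed])
       (use w nat_scaled_contour in auto)
  then have Q: "residue_sum M \<nu> n x s = winding_number (scaled_contour n) s * (numer M \<nu> x s / falling n s) + I / (2 * of_real pi * \<i>)"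
    by simp
  have "gamma_prod M \<nu> s * falling n s * of_real y powr (- s - 1) * (numer M \<nu> x s / falling n s)
      = (gamma_prod M \<nu> s * rgamma_prod M \<nu> s) * (of_real x powr s * of_real y powr (- s - 1))"
    using f by (simp add: numer_def)
  also have "\<dots> = of_real x powr s * of_real y powr (- s - 1)" by (simp add: g)
  finally have "gamma_prod M \<nu> s * falling n s * of_real y powr (- s - 1) * (numer M \<nu> x s / falling n s)
      = of_real x powr s * of_real y powr (- s - 1)" .
  moreover define A where "A = gamma_prod M \<nu> s * falling n s * of_real y powr (- s - 1)"
  moreover define H where "H = numer M \<nu> x s / falling n s"
  ultimately have "A * H = of_real x powr s * of_real y powr (- s - 1)" by simp
  then show ?thesis
    unfolding line_integrand_eq[OF sn] Q w(2) I_def[symmetric] A_def[symmetric] H_def[symmetric]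
    by (simp add: distrib_left)
qed

end

section \<open>Size of the Gamma weights in terms of the phase\<close>

lemma stirling_exponent_of_nat_mult:
  assumes "n \<ge> 1" "z \<noteq> 0"
  shows "stirling_exponent (of_nat n * z) = of_nat n * stirling_exponent z + of_nat n * z * of_real (ln (real n))"
proof -
  have "Ln (of_real (real n) * z) = of_real (ln (real n)) + Ln z"
    using assms by (subst Ln_times_of_real) auto
  then show ?thesis by (simp add: stirling_exponent_def algebra_simps)
qed

text \<open>Scaling by n creates multiples of ln n with total weight n ((M+1) z - (z-1)) = n (M z +
  1). The part M z is absorbed by x of order n^M; the remaining n ln n is the same for s and t and
  drops out of the product of the two weights.\<close>

lemma scaled_phase:
  assumes "n \<ge> 1" "z \<noteq> 0" "z \<noteq> 1"
  shows "real (M + 1) * Re (stirling_exponent (of_nat n * z)) - Re (stirling_exponent (of_nat n * z - of_nat n))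
     = real n * Re (phase M x z) + real n * Re z * (ln x + real M * ln (real n)) + real n * ln (real n)"
proof -
  have e: "of_nat n * z - of_nat n = of_nat n * (z - 1)" by (simp add: algebra_simps)
  have r1: "Re (stirling_exponent (of_nat n * z)) = real n * Re (stirling_exponent z) + real n * Re z * ln (real n)"
    using assms by (simp add: stirling_exponent_of_nat_mult)
  have r2: "Re (stirling_exponent (of_nat n * (z - 1))) = real n * Re (stirling_exponent (z - 1)) + real n * (Re z - 1) * ln (real n)"
    using assms by (simp add: stirling_exponent_of_nat_mult)
  show ?thesis unfolding e r1 r2 phase_def by (simp add: algebra_simps)
qed

text \<open>Written with the reciprocal Gamma function so that it also holds at the zeros of
  \<open>falling\<close>.\<close>

lemma falling_eq_Gamma:
  assumes "Re u \<ge> 0"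
  shows "falling n (u - 1 / 2) = Gamma (u + 1 / 2) * rGamma (u - of_nat n + 1 / 2)"
proof -
  have "u + 1 / 2 \<notin> \<int>\<^sub>\<le>\<^sub>0" using assms by (auto elim!: nonpos_Ints_cases' simp: complex_eq_iff)
  then have nz: "Gamma (u + 1 / 2) * rGamma (u + 1 / 2) = 1" by (simp add: rGamma_inverse_Gamma Gamma_eq_zero_iff)
  have "rGamma (u - of_nat n + 1 / 2) = pochhammer (u - of_nat n + 1 / 2) n * rGamma (u + 1 / 2)"
    using pochhammer_rGamma[of "u - of_nat n + 1 / 2" n] by simp
  then have "Gamma (u + 1 / 2) * rGamma (u - of_nat n + 1 / 2) = pochhammer (u - of_nat n + 1 / 2) n"
    using nz by (simp add: mult_ac)
  also have "\<dots> = (\<Prod>i<n. u - of_nat n + 1 / 2 + of_nat i)"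
    by (simp add: pochhammer_prod atLeast0LessThan)
  also have "\<dots> = falling n (u - 1 / 2)"
    unfolding falling_def
    by (rule prod.reindex_bij_witness[of _ "\<lambda>i. n - 1 - i" "\<lambda>i. n - 1 - i"]) (auto simp: of_nat_diff algebra_simps)
  finally show ?thesis ..
qed

lemma Gamma_shift_half:
  assumes "Re u \<ge> 0"
  shows "Gamma (u - 1 / 2 + of_nat k + 1) = pochhammer (u + 1 / 2) k * Gamma (u + 1 / 2)"
    and "rGamma (u - 1 / 2 + of_nat k + 1) * pochhammer (u + 1 / 2) k = rGamma (u + 1 / 2)"
proof -
  have e: "u - 1 / 2 + of_nat k + 1 = u + 1 / 2 + of_nat k" by simp
  have ni: "u + 1 / 2 \<notin> \<int>\<^sub>\<le>\<^sub>0" using assms by (auto elim!: nonpos_Ints_cases' simp: complex_eq_iff)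
  show "Gamma (u - 1 / 2 + of_nat k + 1) = pochhammer (u + 1 / 2) k * Gamma (u + 1 / 2)"
    unfolding e using ni by (simp add: pochhammer_Gamma Gamma_eq_zero_iff)
  show "rGamma (u - 1 / 2 + of_nat k + 1) * pochhammer (u + 1 / 2) k = rGamma (u + 1 / 2)"
    unfolding e using pochhammer_rGamma[of "u + 1 / 2" k] by (simp add: mult.commute)
qed

text \<open>Together with the lower bound that follows, this shows that each index
  \<open>\<nu> j\<close> changes the weights by exactly a power of 1 + |u|, up to constants.\<close>

lemma norm_pochhammer_half_le:
  "norm (pochhammer (u + 1 / 2 :: complex) k) \<le> (real k + 1) ^ k * (1 + norm u) ^ k"
proof -
  have "norm (pochhammer (u + 1 / 2) k) = (\<Prod>i<k. norm (u + 1 / 2 + of_nat i))"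
    by (simp add: pochhammer_prod atLeast0LessThan prod_norm)
  also have "\<dots> \<le> (\<Prod>i<k. (real k + 1) * (1 + norm u))"
  proof (intro prod_mono conjI)
    fix i assume "i \<in> {..<k}"
    then have i: "1 / 2 + real i \<le> real k + 1" by simp
    have "norm (u + 1 / 2 + of_nat i) \<le> norm u + norm (1 / 2 + of_nat i :: complex)"
      by (metis add.assoc norm_triangle_ineq)
    also have "norm (1 / 2 + of_nat i :: complex) = 1 / 2 + real i"
    proof -
      have "1 / 2 + of_nat i = complex_of_real (1 / 2 + real i)" by simp
      then show ?thesis by (simp only: norm_of_real)
    qed
    also have "norm u + (1 / 2 + real i) \<le> (real k + 1) * (1 + norm u)"
    proof -
      have "1 * norm u \<le> (real k + 1) * norm u" by (intro mult_right_mono) auto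
      then show ?thesis using i by (simp add: distrib_left)
    qed
    finally show "norm (u + 1 / 2 + of_nat i) \<le> (real k + 1) * (1 + norm u)" .
  qed simp
  also have "\<dots> = (real k + 1) ^ k * (1 + norm u) ^ k" by (simp add: power_mult_distrib)
  finally show ?thesis .
qed

lemma norm_pochhammer_half_ge:
  assumes "Re u \<ge> 0"
  shows "(1 + norm u) ^ k \<le> 3 ^ k * norm (pochhammer (u + 1 / 2 :: complex) k)"
proof -
  have "(1 + norm u) ^ k = (\<Prod>i<k. 1 + norm u)" by simp
  also have "\<dots> \<le> (\<Prod>i<k. 3 * norm (u + 1 / 2 + of_nat i))"
  proof (intro prod_mono conjI)
    fix i
    have e: "u + 1 / 2 + of_nat i = u + of_real (1 / 2 + real i)" by simp
    have "norm u \<le> norm (u + of_real (1 / 2 + real i))"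
      by (rule norm_le_norm_add_of_real[OF assms]) simp
    moreover have "1 / 2 \<le> norm (u + of_real (1 / 2 + real i))"
      using complex_Re_le_cmod[of "u + of_real (1 / 2 + real i)"] assms by simp
    ultimately show "1 + norm u \<le> 3 * norm (u + 1 / 2 + of_nat i)" unfolding e by linarith
  qed (simp add: add_nonneg_nonneg)
  also have "\<dots> = 3 ^ k * norm (pochhammer (u + 1 / 2) k)"
    by (simp add: pochhammer_prod atLeast0LessThan prod_norm prod.distrib)
  finally show ?thesis .
qed

lemma weight_upper_bound:
  obtains C where "C > 0"
    "\<And>n u. Re u \<ge> 0 \<Longrightarrow> Im u \<noteq> 0 \<Longrightarrow>
       norm (gamma_prod M \<nu> (u - 1 / 2) * falling n (u - 1 / 2))
         \<le> C * (1 + norm u) ^ (\<Sum>j=1..M. \<nu> j) *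
           exp (real (M + 1) * Re (stirling_exponent u) - Re (stirling_exponent (u - of_nat n)))"
proof -
  obtain C1 where C1: "C1 > 0"
    "\<And>z. Re z \<ge> 0 \<Longrightarrow> norm (Gamma (z + 1/2)) \<le> C1 * exp (Re (stirling_exponent z))"
    by (rule Gamma_half_bounds) blast
  obtain C2 where C2: "C2 > 0"
    "\<And>u. Im u \<noteq> 0 \<Longrightarrow> norm (rGamma (u + 1/2)) \<le> C2 * exp (- Re (stirling_exponent u))"
    by (rule rGamma_half_upper) blast
  define P where "P = (\<Prod>j=1..M. (real (\<nu> j) + 1) ^ \<nu> j)"
  have P: "P > 0" by (auto simp: P_def intro!: prod_pos)
  have "norm (gamma_prod M \<nu> (u - 1 / 2) * falling n (u - 1 / 2))
         \<le> (P * C1 ^ (M + 1) * C2) * (1 + norm u) ^ (\<Sum>j=1..M. \<nu> j) *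
           exp (real (M + 1) * Re (stirling_exponent u) - Re (stirling_exponent (u - of_nat n)))"
    if u: "Re u \<ge> 0" "Im u \<noteq> 0" for n u
  proof -
    define E where "E = exp (Re (stirling_exponent u))"
    have "norm (gamma_prod M \<nu> (u - 1 / 2)) = (\<Prod>j=1..M. norm (pochhammer (u + 1 / 2) (\<nu> j)) * norm (Gamma (u + 1 / 2)))"
      unfolding gamma_prod_def Gamma_shift_half(1)[OF u(1)] by (simp add: norm_mult flip: prod_norm)
    also have "\<dots> \<le> (\<Prod>j=1..M. ((real (\<nu> j) + 1) ^ \<nu> j * (1 + norm u) ^ \<nu> j) * (C1 * E))"
      using norm_pochhammer_half_le C1(2)[OF u(1)] by (intro prod_mono conjI mult_mono) (auto simp: E_def)
    also have "\<dots> = P * (1 + norm u) ^ (\<Sum>j=1..M. \<nu> j) * (C1 * E) ^ M"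
      by (simp add: prod.distrib P_def power_sum)
    finally have 1: "norm (gamma_prod M \<nu> (u - 1 / 2)) \<le> P * (1 + norm u) ^ (\<Sum>j=1..M. \<nu> j) * (C1 * E) ^ M" .
    have "norm (falling n (u - 1 / 2)) \<le> (C1 * E) * (C2 * exp (- Re (stirling_exponent (u - of_nat n))))"
      unfolding falling_eq_Gamma[OF u(1)] norm_mult
      using C1 C2(2)[of "u - of_nat n"] u by (intro mult_mono) (auto simp: E_def)
    then have "norm (gamma_prod M \<nu> (u - 1 / 2) * falling n (u - 1 / 2)) \<le>
      (P * (1 + norm u) ^ (\<Sum>j=1..M. \<nu> j) * (C1 * E) ^ M) * ((C1 * E) * (C2 * exp (- Re (stirling_exponent (u - of_nat n)))))"
      unfolding norm_mult using 1 P C1 by (intro mult_mono) (auto simp: E_def intro!: mult_nonneg_nonneg)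
    also have "\<dots> = (P * C1 ^ (M + 1) * C2) * (1 + norm u) ^ (\<Sum>j=1..M. \<nu> j) * (E ^ (M + 1) * exp (- Re (stirling_exponent (u - of_nat n))))"
      by (simp add: power_mult_distrib mult_ac)
    also have "E ^ (M + 1) * exp (- Re (stirling_exponent (u - of_nat n))) = exp (real (M + 1) * Re (stirling_exponent u) - Re (stirling_exponent (u - of_nat n)))"
      unfolding E_def exp_of_nat_mult[symmetric] by (simp add: exp_diff exp_minus divide_inverse)
    finally show ?thesis .
  qed
  moreover have "P * C1 ^ (M + 1) * C2 > 0" using P C1 C2 by simp
  ultimately show ?thesis using that by blast
qed

text \<open>Dividing by \<open>falling\<close> needs a lower bound for 1/Gamma(u - n + 1/2): either
  u - n lies in the right half-plane, or u lies in the sector where the cosine is large. The power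
  of 1 + |u| is kept on the left to be played off against the one in
  \<open>weight_upper_bound\<close>.\<close>

lemma weight_lower_bound:
  assumes "\<kappa> > 0"
  obtains C where "C > 0"
    "\<And>n u. Re u \<ge> 0 \<Longrightarrow> real n \<le> Re u \<or> (Im u \<noteq> 0 \<and> \<kappa> * Re u \<le> \<bar>Im u\<bar>) \<Longrightarrow>
       norm (rgamma_prod M \<nu> (u - 1 / 2) / falling n (u - 1 / 2)) * (1 + norm u) ^ (\<Sum>j=1..M. \<nu> j)
         \<le> C * exp (- (real (M + 1) * Re (stirling_exponent u) - Re (stirling_exponent (u - of_nat n))))"
proof -
  obtain K where K: "K > 0"
    "\<And>w n. Re w \<ge> 0 \<Longrightarrow> \<bar>Im w\<bar> \<ge> \<kappa> * Re w \<Longrightarrow>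
       exp (pi * \<bar>Im w\<bar>) \<le> K * norm (cos (of_real pi * (w - of_nat n)))"
    by (rule norm_cos_pi_sector_ge[OF assms]) blast
  obtain C2 where C2: "C2 > 0"
    "\<And>u. Re u \<ge> 0 \<or> Im u \<noteq> 0 \<and> exp (pi * \<bar>Im u\<bar>) \<le> K * norm (cos (of_real pi * u)) \<Longrightarrow>
        exp (- Re (stirling_exponent u)) \<le> C2 * norm (rGamma (u + 1/2))"
    by (rule rGamma_half_lower[OF K(1)]) blast
  obtain C1 where C1: "C1 > 0"
    "\<And>z. Re z \<ge> 0 \<Longrightarrow> exp (Re (stirling_exponent z)) \<le> C1 * norm (Gamma (z + 1/2))"
    by (rule Gamma_half_bounds) blast
  define N where "N = (\<Sum>j=1..M. \<nu> j)"
  have "norm (rgamma_prod M \<nu> (u - 1 / 2) / falling n (u - 1 / 2)) * (1 + norm u) ^ N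
         \<le> (3 ^ N * C1 ^ (M + 1) * C2) * exp (- (real (M + 1) * Re (stirling_exponent u) - Re (stirling_exponent (u - of_nat n))))"
    if u: "Re u \<ge> 0" and c: "real n \<le> Re u \<or> (Im u \<noteq> 0 \<and> \<kappa> * Re u \<le> \<bar>Im u\<bar>)" for n u
  proof -
    define E where "E = exp (- Re (stirling_exponent u))"
    have ni: "u + 1 / 2 \<notin> \<int>\<^sub>\<le>\<^sub>0" using u by (auto elim!: nonpos_Ints_cases' simp: complex_eq_iff)
    then have nz: "norm (Gamma (u + 1 / 2)) > 0" by (simp add: Gamma_eq_zero_iff)
    have r: "norm (rGamma (u + 1 / 2)) \<le> C1 * E"
      using C1(2)[OF u] nz unfolding rGamma_inverse_Gamma norm_inverse E_def exp_minus
      by (simp add: divide_simps mult.commute)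
    have r2: "norm (rGamma (u - 1 / 2 + of_nat k + 1)) * (1 + norm u) ^ k \<le> 3 ^ k * (C1 * E)" for k
    proof -
      have "norm (rGamma (u - 1 / 2 + of_nat k + 1)) * (1 + norm u) ^ k \<le> norm (rGamma (u - 1 / 2 + of_nat k + 1)) * (3 ^ k * norm (pochhammer (u + 1 / 2) k))"
        by (intro mult_left_mono norm_pochhammer_half_ge u) auto
      also have "\<dots> = 3 ^ k * norm (rGamma (u + 1 / 2))"
        unfolding Gamma_shift_half(2)[OF u, of k, symmetric] by (simp add: norm_mult mult_ac)
      also have "\<dots> \<le> 3 ^ k * (C1 * E)" using r by (intro mult_left_mono) auto
      finally show ?thesis .
    qed
    have "norm (rgamma_prod M \<nu> (u - 1 / 2)) * (1 + norm u) ^ N =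
        (\<Prod>j=1..M. norm (rGamma (u - 1 / 2 + of_nat (\<nu> j) + 1)) * (1 + norm u) ^ \<nu> j)"
      by (simp add: rgamma_prod_def N_def power_sum prod.distrib prod_norm)
    also have "\<dots> \<le> (\<Prod>j=1..M. 3 ^ \<nu> j * (C1 * E))"
      using r2 by (intro prod_mono) (auto intro!: mult_nonneg_nonneg)
    also have "\<dots> = 3 ^ N * (C1 * E) ^ M" by (simp add: prod.distrib N_def power_sum)
    finally have 1: "norm (rgamma_prod M \<nu> (u - 1 / 2)) * (1 + norm u) ^ N \<le> 3 ^ N * (C1 * E) ^ M" .
    have c': "exp (- Re (stirling_exponent (u - of_nat n))) \<le> C2 * norm (rGamma (u - of_nat n + 1 / 2))"
    proof (rule C2(2))
      show "Re (u - of_nat n) \<ge> 0 \<or> Im (u - of_nat n) \<noteq> 0 \<and>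
         exp (pi * \<bar>Im (u - of_nat n)\<bar>) \<le> K * norm (cos (of_real pi * (u - of_nat n)))"
        using c K(2)[OF u, of n] by auto
    qed
    then have nz2: "norm (rGamma (u - of_nat n + 1 / 2)) > 0"
      using C2(1) by (smt (verit) exp_gt_zero mult_nonneg_nonpos norm_ge_zero zero_less_norm_iff mult_zero_right)
    have "1 / norm (rGamma (u - of_nat n + 1 / 2)) \<le> C2 * exp (Re (stirling_exponent (u - of_nat n)))"
      using c' nz2 C2(1) by (simp add: exp_minus divide_simps mult_ac)
    moreover have "1 / norm (Gamma (u + 1 / 2)) \<le> C1 * E"
      using r unfolding rGamma_inverse_Gamma norm_inverse by (simp only: inverse_eq_divide)
    ultimately have "1 / norm (Gamma (u + 1 / 2)) * (1 / norm (rGamma (u - of_nat n + 1 / 2)))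
        \<le> (C1 * E) * (C2 * exp (Re (stirling_exponent (u - of_nat n))))"
      using C1 by (intro mult_mono) (auto simp: E_def)
    then have 2: "1 / norm (falling n (u - 1 / 2)) \<le> (C1 * E) * (C2 * exp (Re (stirling_exponent (u - of_nat n))))"
      by (simp add: falling_eq_Gamma[OF u] norm_mult)
    have "norm (rgamma_prod M \<nu> (u - 1 / 2) / falling n (u - 1 / 2)) * (1 + norm u) ^ N
       = (norm (rgamma_prod M \<nu> (u - 1 / 2)) * (1 + norm u) ^ N) * (1 / norm (falling n (u - 1 / 2)))"
      by (simp add: norm_divide)
    also have "\<dots> \<le> (3 ^ N * (C1 * E) ^ M) * ((C1 * E) * (C2 * exp (Re (stirling_exponent (u - of_nat n)))))"
      by (rule mult_mono[OF 1 2]) (use C1 in \<open>auto simp: E_def\<close>)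
    also have "\<dots> = (3 ^ N * C1 ^ (M + 1) * C2) * (E ^ (M + 1) * exp (Re (stirling_exponent (u - of_nat n))))"
      by (simp add: power_mult_distrib mult_ac)
    also have "E ^ (M + 1) * exp (Re (stirling_exponent (u - of_nat n))) = exp (- (real (M + 1) * Re (stirling_exponent u) - Re (stirling_exponent (u - of_nat n))))"
      unfolding E_def exp_of_nat_mult[symmetric] by (simp add: exp_diff exp_minus divide_inverse)
    finally show ?thesis .
  qed
  moreover have "3 ^ N * C1 ^ (M + 1) * C2 > 0" using C1 C2 by simp
  ultimately show ?thesis using that unfolding N_def by blast
qed

section \<open>Bounds for the remaining double integral\<close>

lemma power_le_exp_times:
  fixes x :: real
  assumes "x \<ge> 0"
  shows "x ^ k \<le> real k ^ k * exp x"
proof (cases "k = 0")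
  case False
  have "x / real k \<le> exp (x / real k)" using exp_ge_add_one_self[of "x / real k"] by linarith
  then have "(x / real k) ^ k \<le> exp (x / real k) ^ k" using assms by (intro power_mono) auto
  also have "\<dots> = exp x" using False by (simp flip: exp_of_nat_mult)
  finally show ?thesis using False by (simp add: power_divide field_simps)
qed (use assms in auto)

lemma integrable_sqrt_singularity_unit:
  "integrable lborel (\<lambda>x::real. indicator {0..1} x * x powr (-1/2))"
proof -
  have "(\<lambda>x::real. x powr (-1/2)) integrable_on {0..1}"
    using has_integral_powr_from_0[of "-1/2" 1] by (auto simp: integrable_on_def)
  then have "(\<lambda>x::real. x powr (-1/2)) absolutely_integrable_on {0..1}"
    by (rule nonnegative_absolutely_integrable_1) auto
  then have "integrable lebesgue (\<lambda>x::real. indicator {0..1} x * x powr (-1/2))"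
    by (simp add: set_integrable_def)
  then show ?thesis
    by (subst (asm) integrable_completion) auto
qed

text \<open>Within distance 1 of c the bound W times the integrable singularity dominates; farther
  away the singular factor is at most 1 and g itself dominates.\<close>

lemma integrable_sqrt_singularity:
  fixes g :: "real \<Rightarrow> real"
  assumes g: "integrable lborel g" and W: "\<And>x. 0 \<le> g x" "\<And>x. g x \<le> W"
  shows "integrable lborel (\<lambda>x. g x * \<bar>x - c\<bar> powr (-1/2))"
proof (rule Bochner_Integration.integrable_bound)
  define s where "s = (\<lambda>x::real. indicator {0..1} x * x powr (-1/2))"
  have s: "integrable lborel s" unfolding s_def by (rule integrable_sqrt_singularity_unit)
  have 1: "integrable lborel (\<lambda>x. s (- c + 1 * x))" "integrable lborel (\<lambda>x. s (c + (-1) * x))"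
    by (rule lborel_integrable_real_affine[OF s]; simp)+
  show "integrable lborel (\<lambda>x. g x + W * (s (- c + 1 * x) + s (c + (-1) * x)))"
    by (intro Bochner_Integration.integrable_add integrable_mult_right g 1)
  show "(\<lambda>x. g x * \<bar>x - c\<bar> powr (-1/2)) \<in> borel_measurable lborel"
    using g by measurable
  have W0: "W \<ge> 0" using W(1)[of 0] W(2)[of 0] by linarith
  have s0: "s x \<ge> 0" for x by (auto simp: s_def indicator_def)
  have "g x * \<bar>x - c\<bar> powr (-1/2) \<le> g x + W * (s (x - c) + s (c - x))" for x
  proof (cases "\<bar>x - c\<bar> \<le> 1")
    case True
    have "\<bar>x - c\<bar> powr (-1/2) \<le> s (x - c) + s (c - x)"
      using True s0 by (cases "x \<ge> c") (auto simp: s_def indicator_def abs_if)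
    then have "g x * \<bar>x - c\<bar> powr (-1/2) \<le> W * (s (x - c) + s (c - x))"
      using W W0 by (intro mult_mono) auto
    then show ?thesis using W(1)[of x] by linarith
  next
    case False
    have "\<bar>x - c\<bar> powr (-1/2) \<le> \<bar>x - c\<bar> powr 0" using False by (intro powr_mono) auto
    also have "\<bar>x - c\<bar> powr 0 = 1" using False by auto
    finally have "g x * \<bar>x - c\<bar> powr (-1/2) \<le> g x * 1" using W False by (intro mult_left_mono) auto
    moreover have "0 \<le> W * (s (x - c) + s (c - x))" using W0 s0 by (intro mult_nonneg_nonneg add_nonneg_nonneg) auto
    ultimately show ?thesis by linarith
  qed
  then show "AE x in lborel. norm (g x * \<bar>x - c\<bar> powr (-1/2)) \<le> norm (g x + W * (s (- c + 1 * x) + s (c + (-1) * x)))"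
    using W W0 s0 by (intro AE_I2) (auto simp: abs_of_nonneg add_nonneg_nonneg)
qed

lemma abs_powr_half_le:
  fixes t p :: real
  assumes "p > 0"
  shows "\<bar>\<bar>t\<bar> - p\<bar> powr (-1/2) \<le> \<bar>t - p\<bar> powr (-1/2) + \<bar>t - (- p)\<bar> powr (-1/2)"
proof (cases "t \<ge> 0")
  case False
  then have "\<bar>\<bar>t\<bar> - p\<bar> = \<bar>t - (- p)\<bar>" by auto
  then show ?thesis by simp
qed simp

lemma integrable_symmetric_sqrt_singularity:
  fixes g :: "real \<Rightarrow> real"
  assumes g: "integrable lborel g" and W: "\<And>x. 0 \<le> g x" "\<And>x. g x \<le> W" and p: "p > 0"
  shows "integrable lborel (\<lambda>x. g x * \<bar>\<bar>x\<bar> - p\<bar> powr (-1/2))"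
proof (rule Bochner_Integration.integrable_bound)
  show "integrable lborel (\<lambda>x. g x * \<bar>x - p\<bar> powr (-1/2) + g x * \<bar>x - (- p)\<bar> powr (-1/2))"
    by (intro Bochner_Integration.integrable_add integrable_sqrt_singularity[OF g W])
  show "(\<lambda>x. g x * \<bar>\<bar>x\<bar> - p\<bar> powr (-1/2)) \<in> borel_measurable lborel"
    using g by measurable
  show "AE x in lborel. norm (g x * \<bar>\<bar>x\<bar> - p\<bar> powr (-1/2)) \<le> norm (g x * \<bar>x - p\<bar> powr (-1/2) + g x * \<bar>x - (- p)\<bar> powr (-1/2))"
  proof (rule AE_I2)
    fix x
    have "g x * \<bar>\<bar>x\<bar> - p\<bar> powr (-1/2) \<le> g x * (\<bar>x - p\<bar> powr (-1/2) + \<bar>x - (- p)\<bar> powr (-1/2))"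
      using W abs_powr_half_le[OF p] by (intro mult_left_mono) auto
    then show "norm (g x * \<bar>\<bar>x\<bar> - p\<bar> powr (-1/2)) \<le> norm (g x * \<bar>x - p\<bar> powr (-1/2) + g x * \<bar>x - (- p)\<bar> powr (-1/2))"
      using W by (simp add: distrib_left abs_mult)
  qed
qed

section \<open>Weights on the line and on the curve, and the damping along the curve\<close>

context bulk_point
begin

text \<open>Here e is the deviation of ln y from the logarithm of \<open>n^M x\<^sub>0\<close>. Its
  effect is kept explicit, because n e stays bounded in the scaling window.\<close>

lemma left_factor_bound:
  obtains C where "C > 0"
    "\<And>n v y e. n \<ge> 1 \<Longrightarrow> v \<noteq> 0 \<Longrightarrow> y > 0 \<Longrightarrow> ln y = real M * ln (real n) + ln x\<^sub>0 + e \<Longrightarrow>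
       norm (gamma_prod M \<nu> (of_nat n * Complex a v - 1 / 2) * falling n (of_nat n * Complex a v - 1 / 2)
          * of_real y powr (- (of_nat n * Complex a v - 1 / 2) - 1))
       \<le> C * (1 + real n * norm (Complex a v)) ^ (\<Sum>j=1..M. \<nu> j) *
         exp (real n * Re (phase M x\<^sub>0 (Complex a v)) + real n * ln (real n) - real n * a * e - ln y / 2)"
proof -
  define N where "N = (\<Sum>j=1..M. \<nu> j)"
  obtain C where C: "C > 0"
    "\<And>n u. Re u \<ge> 0 \<Longrightarrow> Im u \<noteq> 0 \<Longrightarrow>
       norm (gamma_prod M \<nu> (u - 1 / 2) * falling n (u - 1 / 2))
         \<le> C * (1 + norm u) ^ N *
           exp (real (M + 1) * Re (stirling_exponent u) - Re (stirling_exponent (u - of_nat n)))"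
    unfolding N_def by (rule weight_upper_bound[where M = M and \<nu> = \<nu>]) blast
  show ?thesis
  proof (rule that[OF C(1)], fold N_def)
    fix n :: nat and v y e :: real
    assume n: "n \<ge> 1" and v: "v \<noteq> 0" and y: "y > 0" and e: "ln y = real M * ln (real n) + ln x\<^sub>0 + e"
    define z where "z = Complex a v"
    define u where "u = of_nat n * z"
    have z: "z \<noteq> 0" "z \<noteq> 1" using v by (auto simp: z_def complex_eq_iff)
    have u: "Re u \<ge> 0" "Im u \<noteq> 0" using v n a by (auto simp: u_def z_def)
    have pw: "norm (of_real y powr (- (u - 1 / 2) - 1)) = exp (- ((real n * a + 1 / 2) * ln y))"
      using y by (simp add: norm_powr_real_powr powr_def u_def z_def algebra_simps)
    have "norm (gamma_prod M \<nu> (u - 1 / 2) * falling n (u - 1 / 2) * of_real y powr (- (u - 1 / 2) - 1))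
       \<le> (C * (1 + norm u) ^ N * exp (real (M + 1) * Re (stirling_exponent u) - Re (stirling_exponent (u - of_nat n)))) * exp (- ((real n * a + 1 / 2) * ln y))"
      unfolding norm_mult[of "_ * _" "of_real y powr _"] pw by (intro mult_right_mono C(2) u) auto
    also have "\<dots> = C * (1 + real n * norm z) ^ N * exp (real (M + 1) * Re (stirling_exponent u) - Re (stirling_exponent (u - of_nat n)) - (real n * a + 1 / 2) * ln y)"
      by (simp add: u_def norm_mult mult_ac flip: exp_add)
    also have "real (M + 1) * Re (stirling_exponent u) - Re (stirling_exponent (u - of_nat n)) - (real n * a + 1 / 2) * ln y
       = real n * Re (phase M x\<^sub>0 z) + real n * ln (real n) - real n * a * e - ln y / 2"
    proof -
      have "Re z = a" by (simp add: z_def)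
      moreover have "(real n * a + 1 / 2) * ln y = real n * a * (ln x\<^sub>0 + real M * ln (real n)) + real n * a * e + ln y / 2"
      proof -
        have "real n * a * ln y = real n * a * (ln x\<^sub>0 + real M * ln (real n)) + real n * a * e"
          unfolding e by (simp add: algebra_simps)
        then show ?thesis by (simp add: distrib_right)
      qed
      ultimately show ?thesis
        unfolding u_def scaled_phase[OF n z, of M "x\<^sub>0"] by simp
    qed
    finally show "norm (gamma_prod M \<nu> (of_nat n * Complex a v - 1 / 2) * falling n (of_nat n * Complex a v - 1 / 2)
          * of_real y powr (- (of_nat n * Complex a v - 1 / 2) - 1))
       \<le> C * (1 + real n * norm (Complex a v)) ^ N *
         exp (real n * Re (phase M x\<^sub>0 (Complex a v)) + real n * ln (real n) - real n * a * e - ln y / 2)"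
      by (simp add: u_def z_def)
  qed
qed

text \<open>Up to half the maximal angle the argument (M+1)\<theta> of z - 1 is at most pi/2, so Re
  z >= 1. Beyond it the argument of z itself is at least \<open>\<theta>max / 2\<close>. These are
  the two alternatives in \<open>weight_lower_bound\<close>.\<close>

lemma contour_sector:
  assumes "0 < \<bar>\<theta>\<bar>" "\<bar>\<theta>\<bar> < \<theta>max"
  shows "1 \<le> Re (saddle_curve M \<theta>) \<or>
    (Im (saddle_curve M \<theta>) \<noteq> 0 \<and> tan (\<theta>max / 2) * Re (saddle_curve M \<theta>) \<le> \<bar>Im (saddle_curve M \<theta>)\<bar>)"
proof -
  have main: "1 \<le> Re (saddle_curve M t) \<or> tan (\<theta>max / 2) * Re (saddle_curve M t) \<le> Im (saddle_curve M t)"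
    if t: "0 < t" "t < \<theta>max" for t
  proof (cases "t \<le> \<theta>max / 2")
    case True
    have "real (M + 1) * t \<le> real (M + 1) * (\<theta>max / 2)" using True by (intro mult_left_mono) auto
    also have "real (M + 1) * (\<theta>max / 2) = pi / 2" by (subst \<theta>max(3)[symmetric]) simp
    finally have "real (M + 1) * t \<le> pi / 2" .
    then have "cos (real (M + 1) * t) \<ge> 0" using t by (intro cos_ge_zero) (auto intro: order.trans[of _ 0])
    then have "Re (saddle_curve M t - 1) \<ge> 0"
      unfolding saddle_curve_polar(2)[OF t] using sin_pos[OF t] by simp
    then show ?thesis by simp
  next
    case False
    have "tan (\<theta>max / 2) \<le> tan t" using False t \<theta>max angle_bounds[OF t] by (intro tan_mono_le) auto
    then have "tan (\<theta>max / 2) * Re (saddle_curve M t) \<le> tan t * Re (saddle_curve M t)"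
      using saddle_curve_quadrant[OF t] by (intro mult_right_mono) auto
    also have "\<dots> = Im (saddle_curve M t)"
      using sin_pos[OF t] by (simp add: Re_saddle_curve[OF t] Im_saddle_curve[OF t] tan_def)
    finally show ?thesis by simp
  qed
  show ?thesis
  proof (cases "\<theta> > 0")
    case True
    then show ?thesis using main[of \<theta>] saddle_curve_quadrant[of \<theta>] assms by auto
  next
    case False
    then show ?thesis using main[of "- \<theta>"] saddle_curve_quadrant[of "- \<theta>"] assms
      by (auto simp: saddle_curve_minus)
  qed
qed

lemma right_factor_bound:
  obtains C where "C > 0"
    "\<And>n \<theta> x e. n \<ge> 1 \<Longrightarrow> 0 < \<bar>\<theta>\<bar> \<Longrightarrow> \<bar>\<theta>\<bar> < \<theta>max \<Longrightarrow> x > 0 \<Longrightarrow> ln x = real M * ln (real n) + ln x\<^sub>0 + e \<Longrightarrow>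
       norm (numer M \<nu> x (of_nat n * saddle_curve M \<theta> - 1 / 2) / falling n (of_nat n * saddle_curve M \<theta> - 1 / 2))
          * (1 + real n * norm (saddle_curve M \<theta>)) ^ (\<Sum>j=1..M. \<nu> j)
       \<le> C * exp (- (real n * Re (phase M x\<^sub>0 (saddle_curve M \<theta>)) + real n * ln (real n))
                 + real n * Re (saddle_curve M \<theta>) * e - ln x / 2)"
proof -
  define N where "N = (\<Sum>j=1..M. \<nu> j)"
  define \<kappa> where "\<kappa> = tan (\<theta>max / 2)"
  have "\<kappa> > 0" unfolding \<kappa>_def using \<theta>max by (intro tan_gt_zero) auto
  then obtain C where C: "C > 0"
    "\<And>n u. Re u \<ge> 0 \<Longrightarrow> real n \<le> Re u \<or> (Im u \<noteq> 0 \<and> \<kappa> * Re u \<le> \<bar>Im u\<bar>) \<Longrightarrow>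
       norm (rgamma_prod M \<nu> (u - 1 / 2) / falling n (u - 1 / 2)) * (1 + norm u) ^ N
         \<le> C * exp (- (real (M + 1) * Re (stirling_exponent u) - Re (stirling_exponent (u - of_nat n))))"
    unfolding N_def by (rule weight_lower_bound[where M = M and \<nu> = \<nu>]) blast
  show ?thesis
  proof (rule that[OF C(1)], fold N_def)
    fix n :: nat and \<theta> x e :: real
    assume n: "n \<ge> 1" and \<theta>: "0 < \<bar>\<theta>\<bar>" "\<bar>\<theta>\<bar> < \<theta>max" and x: "x > 0" and e: "ln x = real M * ln (real n) + ln x\<^sub>0 + e"
    define z where "z = saddle_curve M \<theta>"
    define u where "u = of_nat n * z"
    have zq: "Re z > 0" "Im z \<noteq> 0"
      using saddle_curve_quadrant[of \<theta>] saddle_curve_quadrant[of "- \<theta>"] \<theta>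
      by (cases "\<theta> > 0"; force simp: z_def saddle_curve_minus)+
    then have z: "z \<noteq> 0" "z \<noteq> 1" by auto
    have u: "Re u \<ge> 0" "real n \<le> Re u \<or> (Im u \<noteq> 0 \<and> \<kappa> * Re u \<le> \<bar>Im u\<bar>)"
    proof -
      show "Re u \<ge> 0" using zq by (simp add: u_def)
      have "1 \<le> Re z \<or> (Im z \<noteq> 0 \<and> \<kappa> * Re z \<le> \<bar>Im z\<bar>)"
        using contour_sector[OF \<theta>] by (simp add: z_def \<kappa>_def)
      then show "real n \<le> Re u \<or> (Im u \<noteq> 0 \<and> \<kappa> * Re u \<le> \<bar>Im u\<bar>)"
      proof
        assume "1 \<le> Re z"
        then have "real n * 1 \<le> real n * Re z" by (intro mult_left_mono) auto
        then show ?thesis by (simp add: u_def)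
      next
        assume *: "Im z \<noteq> 0 \<and> \<kappa> * Re z \<le> \<bar>Im z\<bar>"
        then have "real n * (\<kappa> * Re z) \<le> real n * \<bar>Im z\<bar>" by (intro mult_left_mono) auto
        then show ?thesis using * n by (simp add: u_def abs_mult mult_ac)
      qed
    qed
    have pw: "norm (of_real x powr (u - 1 / 2)) = exp ((real n * Re z - 1 / 2) * ln x)"
      using x by (simp add: norm_powr_real_powr powr_def u_def)
    have "norm (numer M \<nu> x (u - 1 / 2) / falling n (u - 1 / 2)) * (1 + norm u) ^ N
       = (norm (rgamma_prod M \<nu> (u - 1 / 2) / falling n (u - 1 / 2)) * (1 + norm u) ^ N) * exp ((real n * Re z - 1 / 2) * ln x)"
      unfolding numer_def pw[symmetric] by (simp add: norm_mult norm_divide)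
    also have "\<dots> \<le> (C * exp (- (real (M + 1) * Re (stirling_exponent u) - Re (stirling_exponent (u - of_nat n))))) * exp ((real n * Re z - 1 / 2) * ln x)"
      by (intro mult_right_mono C(2) u) auto
    also have "\<dots> = C * exp (- (real (M + 1) * Re (stirling_exponent u) - Re (stirling_exponent (u - of_nat n))) + (real n * Re z - 1 / 2) * ln x)"
      by (simp only: mult.assoc exp_add)
    also have "- (real (M + 1) * Re (stirling_exponent u) - Re (stirling_exponent (u - of_nat n))) + (real n * Re z - 1 / 2) * ln x
        = - (real n * Re (phase M x\<^sub>0 z) + real n * ln (real n)) + real n * Re z * e - ln x / 2"
    proof -
      have "(real n * Re z - 1 / 2) * ln x = real n * Re z * (ln x\<^sub>0 + real M * ln (real n)) + real n * Re z * e - ln x / 2"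
      proof -
        have "real n * Re z * ln x = real n * Re z * (ln x\<^sub>0 + real M * ln (real n)) + real n * Re z * e"
          unfolding e by (simp add: algebra_simps)
        then show ?thesis by (simp add: left_diff_distrib)
      qed
      then show ?thesis
        unfolding u_def scaled_phase[OF n z, of M "x\<^sub>0"] by simp
    qed
    finally show "norm (numer M \<nu> x (of_nat n * saddle_curve M \<theta> - 1 / 2) / falling n (of_nat n * saddle_curve M \<theta> - 1 / 2))
          * (1 + real n * norm (saddle_curve M \<theta>)) ^ N
       \<le> C * exp (- (real n * Re (phase M x\<^sub>0 (saddle_curve M \<theta>)) + real n * ln (real n))
                 + real n * Re (saddle_curve M \<theta>) * e - ln x / 2)"
      by (simp add: u_def z_def norm_mult)
  qed
qed

definition contour_gap :: "real \<Rightarrow> real" where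
  "contour_gap \<theta> = Re (phase M x\<^sub>0 (saddle_curve M \<theta>)) - Re (phase M x\<^sub>0 w)"

lemma contour_gap_minus:
  assumes "0 < \<bar>\<theta>\<bar>" "\<bar>\<theta>\<bar> < \<theta>max"
  shows "contour_gap (- \<theta>) = contour_gap \<theta>"
proof -
  have "Im (saddle_curve M \<theta>) \<noteq> 0"
    using saddle_curve_quadrant[of \<theta>] saddle_curve_quadrant[of "- \<theta>"] assms
    by (cases "\<theta> > 0"; force simp: saddle_curve_minus)
  then show ?thesis by (simp add: contour_gap_def saddle_curve_minus phase_cnj)
qed

text \<open>The power accounts for $\nu$, via $\Gamma(t+\nu_j+1)$ near the point $0$ of the contour, where
  the exponential factor is needed to bound it.\<close>

definition damping :: "nat \<Rightarrow> nat \<Rightarrow> real \<Rightarrow> real" where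
  "damping N n \<theta> = (real n / (1 + real n * norm (saddle_curve M \<theta>))) ^ N * exp (- real n * contour_gap \<theta>)"

lemma damping_nonneg: "damping N n \<theta> \<ge> 0"
  by (simp add: damping_def add_nonneg_nonneg)

lemma damping_abs:
  assumes "0 < \<bar>\<theta>\<bar>" "\<bar>\<theta>\<bar> < \<theta>max"
  shows "damping N n \<bar>\<theta>\<bar> = damping N n \<theta>"
  using contour_gap_minus[OF assms] by (cases "\<theta> > 0") (auto simp: damping_def saddle_curve_minus)

text \<open>Split at an angle between \<phi> and the end. Before it the curve stays away from 0 and
  the quotient is at most 1/d. Near the end the power may be as large as n^N, but the gap is at
  least g > 0, and n^N exp(-n g) is bounded.\<close>

lemma damping_bounded:
  obtains C where "C > 0" "\<And>n \<theta>. 0 < \<bar>\<theta>\<bar> \<Longrightarrow> \<bar>\<theta>\<bar> < \<theta>max \<Longrightarrow> damping N n \<theta> \<le> C"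
proof -
  define t1 where "t1 = (\<phi> + \<theta>max) / 2"
  have t1: "\<phi> < t1" "0 < t1" "t1 < \<theta>max" using \<phi> by (auto simp: t1_def)
  define d where "d = Re (saddle_curve M t1)"
  have d: "d > 0" using saddle_curve_quadrant[OF t1(2,3)] by (simp add: d_def)
  define g where "g = contour_gap t1"
  have g: "g > 0" using phase_on_contour_gt[of t1] t1 by (simp add: g_def contour_gap_def)
  define C where "C = (1 / d) ^ N + real N ^ N / g ^ N + 1"
  have C: "C > 0" using d g by (auto simp: C_def intro!: add_nonneg_pos add_nonneg_nonneg)
  have main: "damping N n t \<le> C" if t: "0 < t" "t < \<theta>max" for n t
  proof (cases "t \<le> t1")
    case True
    have "d \<le> Re (saddle_curve M t)"
      using Re_saddle_curve_decreasing[of t t1] True t t1 by (cases "t = t1") (auto simp: d_def)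
    then have r: "d \<le> norm (saddle_curve M t)" using complex_Re_le_cmod order.trans by blast
    have "real n / (1 + real n * norm (saddle_curve M t)) \<le> 1 / d"
    proof -
      have "real n * d \<le> real n * norm (saddle_curve M t)" using r by (intro mult_left_mono) auto
      then have "real n * d \<le> 1 + real n * norm (saddle_curve M t)" by linarith
      moreover have "1 + real n * norm (saddle_curve M t) > 0" by (simp add: add_pos_nonneg)
      ultimately show ?thesis using d by (simp add: divide_simps)
    qed
    then have "(real n / (1 + real n * norm (saddle_curve M t))) ^ N \<le> (1 / d) ^ N"
      by (intro power_mono) (auto intro!: divide_nonneg_nonneg add_nonneg_nonneg)
    moreover have "contour_gap t \<ge> 0"
      using phase_on_contour_gt[OF t] by (cases "t = \<phi>") (auto simp: contour_gap_def)
    then have "exp (- real n * contour_gap t) \<le> 1" by simp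
    ultimately have "damping N n t \<le> (1 / d) ^ N * 1"
      unfolding damping_def using d by (intro mult_mono) auto
    also have "\<dots> \<le> C" using g by (auto simp: C_def intro!: add_nonneg_nonneg)
    finally show ?thesis .
  next
    case False
    have "g \<le> contour_gap t"
      using phase_on_contour_increasing[of t1 t] False t t1 by (simp add: g_def contour_gap_def)
    then have "real n * g \<le> real n * contour_gap t" by (intro mult_left_mono) auto
    then have 1: "exp (- real n * contour_gap t) \<le> exp (- (real n * g))" by simp
    have "real n / (1 + real n * norm (saddle_curve M t)) \<le> real n / 1"
      by (intro divide_left_mono) (auto intro!: mult_pos_pos add_pos_nonneg)
    then have "(real n / (1 + real n * norm (saddle_curve M t))) ^ N \<le> real n ^ N"
      by (intro power_mono) (auto intro!: divide_nonneg_nonneg add_nonneg_nonneg)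
    then have "damping N n t \<le> real n ^ N * exp (- (real n * g))"
      unfolding damping_def using 1 by (intro mult_mono) auto
    also have "\<dots> \<le> real N ^ N / g ^ N"
    proof -
      have "(real n * g) ^ N \<le> real N ^ N * exp (real n * g)" using g by (intro power_le_exp_times) auto
      then show ?thesis using g by (simp add: power_mult_distrib exp_minus field_simps)
    qed
    also have "\<dots> \<le> C" using d by (auto simp: C_def intro!: add_nonneg_nonneg)
    finally show ?thesis .
  qed
  have "damping N n \<theta> \<le> C" if "0 < \<bar>\<theta>\<bar>" "\<bar>\<theta>\<bar> < \<theta>max" for n \<theta>
    using main[of "\<bar>\<theta>\<bar>" n] that unfolding damping_abs[OF that] by simp
  then show ?thesis using C that by blast
qed

lemma damping_tendsto_0:
  assumes "0 < \<theta>" "\<theta> < \<theta>max" "\<theta> \<noteq> \<phi>"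
  shows "(\<lambda>n. damping N n \<theta>) \<longlonglongrightarrow> 0"
proof (rule Lim_null_comparison)
  define r where "r = norm (saddle_curve M \<theta>)"
  have r: "r > 0" using saddle_curve_quadrant[OF assms(1,2)] by (auto simp: r_def)
  have g: "contour_gap \<theta> > 0" using phase_on_contour_gt[OF assms] by (simp add: contour_gap_def)
  show "\<forall>\<^sub>F n in sequentially. norm (damping N n \<theta>) \<le> (1 / r) ^ N * exp (- contour_gap \<theta>) ^ n"
  proof (intro always_eventually allI)
    fix n
    have "real n / (1 + real n * r) \<le> 1 / r"
      using r by (simp add: divide_simps add_pos_nonneg)
    then have "(real n / (1 + real n * r)) ^ N \<le> (1 / r) ^ N"
      using r by (intro power_mono) auto
    then have "damping N n \<theta> \<le> (1 / r) ^ N * exp (- real n * contour_gap \<theta>)"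
      unfolding damping_def r_def by (intro mult_right_mono) auto
    also have "exp (- real n * contour_gap \<theta>) = exp (- contour_gap \<theta>) ^ n"
      by (simp flip: exp_of_nat_mult)
    finally show "norm (damping N n \<theta>) \<le> (1 / r) ^ N * exp (- contour_gap \<theta>) ^ n"
      using damping_nonneg by simp
  qed
  show "(\<lambda>n. (1 / r) ^ N * exp (- contour_gap \<theta>) ^ n) \<longlonglongrightarrow> 0"
    by (intro tendsto_mult_right_zero LIMSEQ_power_zero) (use g in auto)
qed

text \<open>Leaves out finitely many parameters: the real points of the curve, where the phase meets
  the branch cuts, and the two saddle points, where the square root singularity sits.\<close>

definition regular_params :: "real set" where
  "regular_params = {x. 0 < \<bar>(2 * x - 1) * \<theta>max\<bar> \<and> \<bar>(2 * x - 1) * \<theta>max\<bar> < \<theta>max \<and> \<bar>(2 * x - 1) * \<theta>max\<bar> \<noteq> \<phi>}"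

definition damped :: "nat \<Rightarrow> nat \<Rightarrow> real \<Rightarrow> real" where
  "damped N n x = indicator regular_params x *
     (damping N n ((2 * x - 1) * \<theta>max) * \<bar>\<bar>(2 * x - 1) * \<theta>max\<bar> - \<phi>\<bar> powr (-1/2))"

lemma open_regular_params: "open regular_params"
  unfolding regular_params_def
  by (intro open_Collect_conj open_Collect_less open_Collect_neq continuous_intros)

lemma regular_params_subset: "regular_params \<subseteq> {0<..<1}"
proof
  fix x assume "x \<in> regular_params"
  then have "\<bar>2 * x - 1\<bar> * \<theta>max < 1 * \<theta>max" using \<theta>max by (simp add: regular_params_def abs_mult)
  then have "\<bar>2 * x - 1\<bar> < 1" using \<theta>max(1) by (simp only: mult_less_cancel_right_pos)
  then show "x \<in> {0<..<1}" by auto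
qed

lemma finite_irregular_params: "finite ({0..1} - regular_params)"
proof (rule finite_subset)
  \<comment> \<open>The listed parameters belong to the angles 0, \<open>- \<theta>max\<close>,
    \<open>\<theta>max\<close>, \<phi> and -\<phi>, in this order.\<close>
  show "{0..1} - regular_params \<subseteq> {1/2, 0, 1, (\<phi> / \<theta>max + 1) / 2, (1 - \<phi> / \<theta>max) / 2}"
  proof
    fix x assume x: "x \<in> {0..1} - regular_params"
    then have "\<bar>(2 * x - 1) * \<theta>max\<bar> \<le> \<theta>max" by (intro contour_angle) auto
    with x have "(2 * x - 1) * \<theta>max = 0 \<or> \<bar>(2 * x - 1) * \<theta>max\<bar> = 1 * \<theta>max \<or> \<bar>(2 * x - 1) * \<theta>max\<bar> = \<phi>"
      by (auto simp: regular_params_def)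
    then have "2 * x - 1 = 0 \<or> \<bar>2 * x - 1\<bar> = 1 \<or> \<bar>2 * x - 1\<bar> = \<phi> / \<theta>max"
      using \<theta>max(1) by (auto simp: abs_mult eq_divide_eq)
    then show "x \<in> {1/2, 0, 1, (\<phi> / \<theta>max + 1) / 2, (1 - \<phi> / \<theta>max) / 2}" by auto
  qed
qed simp

text \<open>Continuity on an open set suffices. The absolute value of the angle is used because
  continuity of the phase along the curve is available for positive angles only;
  \<open>damping\<close> is even.\<close>

lemma damped_measurable: "damped N n \<in> borel_measurable borel"
proof -
  have iso: "isCont (\<lambda>t. Re (phase M x\<^sub>0 (saddle_curve M t))) \<bar>(2 * x - 1) * \<theta>max\<bar>" if "x \<in> regular_params" for x
    using that by (intro phase_on_contour_isCont) (auto simp: regular_params_def)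
  have c1: "continuous_on regular_params (\<lambda>x. Re (phase M x\<^sub>0 (saddle_curve M \<bar>(2 * x - 1) * \<theta>max\<bar>)))"
    by (intro continuous_at_imp_continuous_on ballI isCont_o2[where g = "\<lambda>t. Re (phase M x\<^sub>0 (saddle_curve M t))" and f = "\<lambda>x. \<bar>(2 * x - 1) * \<theta>max\<bar>", OF _ iso] continuous_intros)
  have c2: "continuous_on regular_params (\<lambda>x. saddle_curve M \<bar>(2 * x - 1) * \<theta>max\<bar>)"
    by (rule continuous_on_compose2[OF continuous_on_saddle_curve])
       (auto intro!: continuous_intros simp: regular_params_def)
  have "continuous_on regular_params (\<lambda>x. damping N n \<bar>(2 * x - 1) * \<theta>max\<bar> * \<bar>\<bar>(2 * x - 1) * \<theta>max\<bar> - \<phi>\<bar> powr (-1/2))"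
    unfolding damping_def contour_gap_def
    by (intro continuous_intros c1 c2)
       (auto simp: regular_params_def add_nonneg_eq_0_iff)
  then have "(\<lambda>x. indicator regular_params x *\<^sub>R (damping N n \<bar>(2 * x - 1) * \<theta>max\<bar> * \<bar>\<bar>(2 * x - 1) * \<theta>max\<bar> - \<phi>\<bar> powr (-1/2))) \<in> borel_measurable borel"
    by (intro borel_measurable_continuous_on_indicator) (use open_regular_params in auto)
  moreover have "(\<lambda>x. indicator regular_params x *\<^sub>R (damping N n \<bar>(2 * x - 1) * \<theta>max\<bar> * \<bar>\<bar>(2 * x - 1) * \<theta>max\<bar> - \<phi>\<bar> powr (-1/2))) = damped N n"
  proof
    fix x
    show "indicator regular_params x *\<^sub>R (damping N n \<bar>(2 * x - 1) * \<theta>max\<bar> * \<bar>\<bar>(2 * x - 1) * \<theta>max\<bar> - \<phi>\<bar> powr (-1/2)) = damped N n x"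
    proof (cases "x \<in> regular_params")
      case True
      then have "damping N n \<bar>(2 * x - 1) * \<theta>max\<bar> = damping N n ((2 * x - 1) * \<theta>max)"
        by (intro damping_abs) (auto simp: regular_params_def)
      then show ?thesis by (simp only: damped_def real_scaleR_def)
    qed (simp add: damped_def)
  qed
  ultimately show ?thesis by simp
qed

text \<open>Dominated convergence with a multiple of the square root singularity as majorant. No
  rate is obtained, and none is needed for the limit.\<close>

lemma damped_integral_tendsto_0:
  shows "integrable lborel (damped N n)" and "(\<lambda>n. LINT x|lborel. damped N n x) \<longlonglongrightarrow> 0"
proof -
  obtain C where C: "C > 0" "\<And>n \<theta>. 0 < \<bar>\<theta>\<bar> \<Longrightarrow> \<bar>\<theta>\<bar> < \<theta>max \<Longrightarrow> damping N n \<theta> \<le> C"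
    by (rule damping_bounded) blast
  define g where "g = (\<lambda>t::real. indicator {-\<theta>max..\<theta>max} t * C)"
  have "integrable lborel g"
    unfolding g_def by (intro integrable_mult_left integrable_real_indicator) (auto simp: emeasure_lborel_Icc_eq)
  then have "integrable lborel (\<lambda>t. g t * \<bar>\<bar>t\<bar> - \<phi>\<bar> powr (-1/2))"
    by (rule integrable_symmetric_sqrt_singularity[where W = C])
       (use C \<phi> in \<open>auto simp: g_def indicator_def\<close>)
  then have "integrable lborel (\<lambda>x. g (- \<theta>max + (2 * \<theta>max) * x) * \<bar>\<bar>- \<theta>max + (2 * \<theta>max) * x\<bar> - \<phi>\<bar> powr (-1/2))"
    by (rule lborel_integrable_real_affine) (use \<theta>max in auto)
  moreover have "- \<theta>max + (2 * \<theta>max) * x = (2 * x - 1) * \<theta>max" for x by (simp add: algebra_simps)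
  ultimately have D: "integrable lborel (\<lambda>x. g ((2 * x - 1) * \<theta>max) * \<bar>\<bar>(2 * x - 1) * \<theta>max\<bar> - \<phi>\<bar> powr (-1/2))"
    by simp
  have le: "norm (damped N n x) \<le> g ((2 * x - 1) * \<theta>max) * \<bar>\<bar>(2 * x - 1) * \<theta>max\<bar> - \<phi>\<bar> powr (-1/2)" for n x
  proof (cases "x \<in> regular_params")
    case True
    then have t: "0 < \<bar>(2 * x - 1) * \<theta>max\<bar>" "\<bar>(2 * x - 1) * \<theta>max\<bar> < \<theta>max" by (auto simp: regular_params_def)
    then have "(2 * x - 1) * \<theta>max \<in> {-\<theta>max..\<theta>max}"
      unfolding abs_less_iff atLeastAtMost_iff by linarith
    then have "g ((2 * x - 1) * \<theta>max) = C" unfolding g_def by (simp only: indicator_simps mult_1)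
    then show ?thesis
      using True damping_nonneg C(2)[OF t] by (auto simp: damped_def abs_mult intro!: mult_right_mono)
  qed (use C in \<open>auto simp: damped_def g_def indicator_def\<close>)
  have m: "damped N n \<in> borel_measurable lborel" for n using damped_measurable by simp
  show "integrable lborel (damped N n)"
  proof (rule Bochner_Integration.integrable_bound[OF D m], rule AE_I2)
    fix x
    show "norm (damped N n x) \<le> norm (g ((2 * x - 1) * \<theta>max) * \<bar>\<bar>(2 * x - 1) * \<theta>max\<bar> - \<phi>\<bar> powr (-1/2))"
      by (rule order.trans[OF le]) (simp only: real_norm_def abs_ge_self)
  qed
  have "(\<lambda>n. LINT x|lborel. damped N n x) \<longlonglongrightarrow> integral\<^sup>L lborel (\<lambda>x::real. 0)"
  proof (rule integral_dominated_convergence[where w = "\<lambda>x. g ((2 * x - 1) * \<theta>max) * \<bar>\<bar>(2 * x - 1) * \<theta>max\<bar> - \<phi>\<bar> powr (-1/2)"])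
    show "AE x in lborel. (\<lambda>n. damped N n x) \<longlonglongrightarrow> 0"
    proof (rule AE_I2)
      fix x
      show "(\<lambda>n. damped N n x) \<longlonglongrightarrow> 0"
      proof (cases "x \<in> regular_params")
        case True
        then have t: "0 < \<bar>(2 * x - 1) * \<theta>max\<bar>" "\<bar>(2 * x - 1) * \<theta>max\<bar> < \<theta>max" "\<bar>(2 * x - 1) * \<theta>max\<bar> \<noteq> \<phi>"
          by (auto simp: regular_params_def)
        have "(\<lambda>n. damping N n ((2 * x - 1) * \<theta>max)) \<longlonglongrightarrow> 0"
          using damping_tendsto_0[OF t] unfolding damping_abs[OF t(1,2)] .
        then have "(\<lambda>n. damping N n ((2 * x - 1) * \<theta>max) * \<bar>\<bar>(2 * x - 1) * \<theta>max\<bar> - \<phi>\<bar> powr (-1/2)) \<longlonglongrightarrow> 0"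
          by (rule tendsto_mult_left_zero)
        then show ?thesis using True by (simp add: damped_def)
      qed (simp add: damped_def)
    qed
  qed (use le D m in auto)
  then show "(\<lambda>n. LINT x|lborel. damped N n x) \<longlonglongrightarrow> 0" by simp
qed

end

section \<open>The error left by the double integral\<close>

context bulk_point
begin

text \<open>These identities explain the constants of the limit: the powers of x and y are
  integrated over a segment of half-length b, whose relation to the density gives the frequency pi,
  and a = b cot \<phi> gives the exponential prefactor.\<close>

lemma bulk_constants:
  shows "rho M \<phi> > 0" "b = pi * (rho M \<phi> * x\<^sub>0)" "a = b * cot \<phi>"
proof -
  obtain m where m: "M = Suc m" using M by (cases M) auto
  note p = sin_pos[OF \<phi>]
  show "rho M \<phi> > 0" using p by (simp add: rho_def)
  have "sin (real M * \<phi>) ^ (M - 1) / sin (real M * \<phi>) ^ M = 1 / sin (real M * \<phi>)"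
    using p unfolding m by simp
  moreover have "sin (real (M + 1) * \<phi>) ^ (M + 1) / sin (real (M + 1) * \<phi>) ^ M = sin (real (M + 1) * \<phi>)"
    using p by simp
  moreover have "rho M \<phi> * x\<^sub>0 = 1 / pi * ((sin \<phi>)\<^sup>2 / sin \<phi>) * (sin (real M * \<phi>) ^ (M - 1) / sin (real M * \<phi>) ^ M)
      * (sin (real (M + 1) * \<phi>) ^ (M + 1) / sin (real (M + 1) * \<phi>) ^ M)"
    by (simp add: rho_def bulk_param_def)
  ultimately have "rho M \<phi> * x\<^sub>0 = 1 / pi * sin \<phi> * (1 / sin (real M * \<phi>)) * sin (real (M + 1) * \<phi>)"
    using p by (simp only: power2_eq_square) simp
  then show "b = pi * (rho M \<phi> * x\<^sub>0)" by (simp add: Im_saddle_curve[OF \<phi>])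
  show "a = b * cot \<phi>"
    using p by (simp add: Re_saddle_curve[OF \<phi>] Im_saddle_curve[OF \<phi>] cot_def)
qed

text \<open>The phase difference E is nonpositive, so exp(n E) is largest for n = 1, uniformly in n.
  Two powers more than N are traded for exponential decay to leave 1/(1 + v^2).\<close>

lemma line_decay:
  obtains C where "C > 0"
    "\<And>n v. n \<ge> 1 \<Longrightarrow> v \<noteq> 0 \<Longrightarrow> (1 + norm (Complex a v)) ^ N *
       exp (real n * (Re (phase M x\<^sub>0 (Complex a v)) - Re (phase M x\<^sub>0 w))) \<le> C * (1 / (1 + v\<^sup>2))"
proof -
  obtain V where V: "V > 0" "\<And>v. v > 0 \<Longrightarrow> Re (phase M x\<^sub>0 (Complex a v)) \<le> Re (phase M x\<^sub>0 w) + V - v"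
    by (rule phase_on_line_decay) blast
  define C where "C = real (N + 2) ^ (N + 2) * exp (1 + a + V)"
  have "(1 + norm (Complex a v)) ^ N * exp (real n * (Re (phase M x\<^sub>0 (Complex a v)) - Re (phase M x\<^sub>0 w))) \<le> C * (1 / (1 + v\<^sup>2))"
    if n: "n \<ge> 1" and v: "v \<noteq> 0" for n v
  proof -
    have sym: "Re (phase M x\<^sub>0 (Complex a v)) = Re (phase M x\<^sub>0 (Complex a \<bar>v\<bar>))"
      using phase_cnj[of "Complex a \<bar>v\<bar>" M "x\<^sub>0"] v by (cases "v > 0") (auto simp: complex_cnj)
    define E where "E = Re (phase M x\<^sub>0 (Complex a v)) - Re (phase M x\<^sub>0 w)"
    have E: "E \<le> 0" "E \<le> V - \<bar>v\<bar>"
      using phase_on_line_le[of "\<bar>v\<bar>"] V(2)[of "\<bar>v\<bar>"] v by (auto simp: E_def sym)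
    have "real n * E \<le> 1 * E" using E n by (intro mult_right_mono_neg) auto
    then have e: "exp (real n * E) \<le> exp (V - \<bar>v\<bar>)" using E by simp
    define q where "q = 1 + a + \<bar>v\<bar>"
    have q: "1 + norm (Complex a v) \<le> q" "q \<ge> 1"
      using cmod_le[of "Complex a v"] a by (auto simp: q_def)
    have "1 + v\<^sup>2 \<le> (1 + \<bar>v\<bar>)\<^sup>2" by (simp add: power2_eq_square algebra_simps)
    also have "\<dots> \<le> q\<^sup>2" using a by (intro power_mono) (auto simp: q_def)
    finally have q2: "1 + v\<^sup>2 \<le> q\<^sup>2" .
    have "((1 + norm (Complex a v)) ^ N * exp (real n * E)) * (1 + v\<^sup>2) \<le> (q ^ N * exp (V - \<bar>v\<bar>)) * q\<^sup>2"
      using q q2 e by (intro mult_mono power_mono) auto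
    also have "\<dots> = q ^ (N + 2) * exp (V - \<bar>v\<bar>)" by (simp add: power_add power2_eq_square mult_ac)
    also have "\<dots> \<le> (real (N + 2) ^ (N + 2) * exp q) * exp (V - \<bar>v\<bar>)"
      using q by (intro mult_right_mono power_le_exp_times) auto
    also have "\<dots> = C" by (simp add: C_def q_def mult.assoc flip: exp_add)
    finally have "((1 + norm (Complex a v)) ^ N * exp (real n * E)) * (1 + v\<^sup>2) \<le> C" .
    moreover have "1 + v\<^sup>2 > 0" by (simp add: add_pos_nonneg)
    ultimately show ?thesis unfolding E_def[symmetric] by (simp add: pos_le_divide_eq)
  qed
  moreover have "C > 0" by (simp add: C_def)
  ultimately show ?thesis using that by blast
qed

text \<open>For fixed v the integrand in the curve parameter is bounded by a function of v times
  \<open>damped\<close>. The factor in v is integrable and free of n, so everything that must tend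
  to 0 sits in the integral of \<open>damped\<close>; n^(-M) is the natural size of the kernel up to
  a factor n.\<close>

lemma error_integrand_bound:
  assumes T: "T \<ge> 0"
  obtains C where "C > 0"
    "\<And>n x y e e' v. n \<ge> 1 \<Longrightarrow> x > 0 \<Longrightarrow> y > 0 \<Longrightarrow>
       ln x = real M * ln (real n) + ln x\<^sub>0 + e' \<Longrightarrow> ln y = real M * ln (real n) + ln x\<^sub>0 + e \<Longrightarrow>
       real n * \<bar>e\<bar> \<le> T \<Longrightarrow> real n * \<bar>e'\<bar> \<le> T \<Longrightarrow> v \<noteq> 0 \<Longrightarrow> \<bar>v\<bar> \<noteq> b \<Longrightarrow>
       norm (line_integrand M \<nu> n x y (of_nat n * Complex a v - 1 / 2)
          - (if \<bar>v\<bar> < b then of_real x powr (of_nat n * Complex a v - 1 / 2) * of_real y powr (- (of_nat n * Complex a v - 1 / 2) - 1) else 0))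
       \<le> (C / real n ^ M * (LINT \<xi>|lborel. damped (\<Sum>j=1..M. \<nu> j) n \<xi>)) * (1 / (1 + v\<^sup>2) * \<bar>\<bar>v\<bar> - b\<bar> powr (-1/2))"
proof -
  define N where "N = (\<Sum>j=1..M. \<nu> j)"
  obtain CL where CL: "CL > 0"
    "\<And>n v y e. n \<ge> 1 \<Longrightarrow> v \<noteq> 0 \<Longrightarrow> y > 0 \<Longrightarrow> ln y = real M * ln (real n) + ln x\<^sub>0 + e \<Longrightarrow>
       norm (gamma_prod M \<nu> (of_nat n * Complex a v - 1 / 2) * falling n (of_nat n * Complex a v - 1 / 2)
          * of_real y powr (- (of_nat n * Complex a v - 1 / 2) - 1))
       \<le> CL * (1 + real n * norm (Complex a v)) ^ N *
         exp (real n * Re (phase M x\<^sub>0 (Complex a v)) + real n * ln (real n) - real n * a * e - ln y / 2)"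
    unfolding N_def by (rule left_factor_bound[where \<nu> = \<nu>]) blast
  obtain CR where CR: "CR > 0"
    "\<And>n \<theta> x e. n \<ge> 1 \<Longrightarrow> 0 < \<bar>\<theta>\<bar> \<Longrightarrow> \<bar>\<theta>\<bar> < \<theta>max \<Longrightarrow> x > 0 \<Longrightarrow> ln x = real M * ln (real n) + ln x\<^sub>0 + e \<Longrightarrow>
       norm (numer M \<nu> x (of_nat n * saddle_curve M \<theta> - 1 / 2) / falling n (of_nat n * saddle_curve M \<theta> - 1 / 2))
          * (1 + real n * norm (saddle_curve M \<theta>)) ^ N
       \<le> CR * exp (- (real n * Re (phase M x\<^sub>0 (saddle_curve M \<theta>)) + real n * ln (real n))
                 + real n * Re (saddle_curve M \<theta>) * e - ln x / 2)"
    unfolding N_def by (rule right_factor_bound[where \<nu> = \<nu>]) blast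
  obtain K where K: "K > 0"
    "\<And>v \<theta>. 0 < \<bar>\<theta>\<bar> \<Longrightarrow> \<bar>\<theta>\<bar> < \<theta>max \<Longrightarrow>
       \<bar>\<bar>v\<bar> - b\<bar> * \<bar>\<bar>\<theta>\<bar> - \<phi>\<bar> \<le> K * (norm (Complex a v - saddle_curve M \<theta>))\<^sup>2"
    by (rule line_contour_distance) blast
  obtain CD where CD: "CD > 0"
    "\<And>n v. n \<ge> 1 \<Longrightarrow> v \<noteq> 0 \<Longrightarrow> (1 + norm (Complex a v)) ^ N *
       exp (real n * (Re (phase M x\<^sub>0 (Complex a v)) - Re (phase M x\<^sub>0 w))) \<le> CD * (1 / (1 + v\<^sup>2))"
    by (rule line_decay) blast
  obtain D B where D: "\<And>x. x \<in> {0..1} \<Longrightarrow> (contour has_vector_derivative D x) (at x)"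
    "continuous_on {0..1} D" "B > 0" "\<And>x. x \<in> {0..1} \<Longrightarrow> norm (D x) \<le> B"
    by (rule contour_C1) blast
  have "bounded (saddle_curve M ` {-\<theta>max..\<theta>max})"
    by (intro compact_imp_bounded compact_continuous_image continuous_on_saddle_curve) auto
  then obtain R where R: "R > 0" "\<forall>y\<in>saddle_curve M ` {-\<theta>max..\<theta>max}. norm y \<le> R"
    unfolding bounded_pos by auto
  \<comment> \<open>The exponent collects the effect of e and e': R T from the t-power, a T from the
    s-power and T from the two half powers of x and y, which also produce the division by
    \<open>x\<^sub>0\<close>.\<close>
  define P where "P = exp ((R + a + 1) * T) / x\<^sub>0"
  have P: "P > 0" using bulk_param_pos[OF \<phi>] by (simp add: P_def)
  define C where "C = CL * CR * sqrt K * B * P * CD"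
  have C: "C > 0" using CL CR K CD D P by (simp add: C_def)
  show ?thesis
  proof (rule that[OF C], fold N_def)
    fix n x y e e' v
    assume n: "n \<ge> (1::nat)" and x: "x > 0" and y: "y > 0"
      and e': "ln x = real M * ln (real n) + ln x\<^sub>0 + e'" and e: "ln y = real M * ln (real n) + ln x\<^sub>0 + e"
      and eT: "real n * \<bar>e\<bar> \<le> T" "real n * \<bar>e'\<bar> \<le> T" and v: "v \<noteq> 0" "\<bar>v\<bar> \<noteq> b"
    define z where "z = Complex a v"
    define s where "s = of_nat n * z - 1 / 2"
    define G where "G = gamma_prod M \<nu> s * falling n s * of_real y powr (- s - 1)"
    define F where "F = (\<lambda>\<xi>. numer M \<nu> x (scaled_contour n \<xi>) / (falling n (scaled_contour n \<xi>) * (s - scaled_contour n \<xi>)) * (of_nat n * D \<xi>))"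
    define \<Delta> where "\<Delta> = \<bar>\<bar>v\<bar> - b\<bar> powr (-1/2)"
    define Q where "Q = C / real n ^ M * (1 / (1 + v\<^sup>2)) * \<Delta>"
    have sn: "s \<notin> of_nat ` {..<n}" using v n by (auto simp: s_def z_def complex_eq_iff)
    have spath: "s \<notin> path_image (scaled_contour n)"
      unfolding s_def z_def using winding_number_scaled_contour(1)[OF n line_notin_contour[OF v(2)]] .
    have vd: "vector_derivative (scaled_contour n) (at \<xi>) = of_nat n * D \<xi>" if "\<xi> \<in> {0..1}" for \<xi>
      by (rule vector_derivative_at[OF scaled_contour_has_derivative[OF D(1)[OF that]]])
    define I where "I = contour_integral (scaled_contour n) (\<lambda>t. numer M \<nu> x t / (falling n t * (s - t)))"
    have ci: "(\<lambda>t. numer M \<nu> x t / (falling n t * (s - t))) contour_integrable_on scaled_contour n"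
    proof (rule contour_integrable_holomorphic_simple[OF _ _ valid_path_scaled_contour])
      show "open (- insert s (of_nat ` {..<n}))" by (intro open_Compl finite_imp_closed) auto
      show "(\<lambda>t. numer M \<nu> x t / (falling n t * (s - t))) holomorphic_on - insert s (of_nat ` {..<n})"
        unfolding falling_def by (intro holomorphic_intros numer_holomorphic[OF x]) auto
      show "path_image (scaled_contour n) \<subseteq> - insert s (of_nat ` {..<n})"
        using spath nat_scaled_contour(1) by auto
    qed
    then have Fint: "(F has_integral I) {0..1}"
    proof -
      have "((\<lambda>\<xi>. numer M \<nu> x (scaled_contour n \<xi>) / (falling n (scaled_contour n \<xi>) * (s - scaled_contour n \<xi>))
          * vector_derivative (scaled_contour n) (at \<xi>)) has_integral I) {0..1}"
        using has_contour_integral_integral[OF ci] unfolding I_def has_contour_integral .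
      then show ?thesis unfolding F_def by (rule has_integral_eq[rotated]) (simp add: vd)
    qed
    have pointwise: "norm (G * F \<xi>) \<le> Q * damped N n \<xi>" if \<xi>: "\<xi> \<in> regular_params" for \<xi>
    proof -
      define \<theta> where "\<theta> = (2 * \<xi> - 1) * \<theta>max"
      define \<zeta> where "\<zeta> = saddle_curve M \<theta>"
      have \<theta>: "0 < \<bar>\<theta>\<bar>" "\<bar>\<theta>\<bar> < \<theta>max" "\<bar>\<theta>\<bar> \<noteq> \<phi>" using \<xi> by (auto simp: regular_params_def \<theta>_def)
      have \<xi>01: "\<xi> \<in> {0..1}" using regular_params_subset \<xi> by force
      have sc: "scaled_contour n \<xi> = of_nat n * \<zeta> - 1 / 2" by (simp add: scaled_contour_def contour_def \<zeta>_def \<theta>_def)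
      define H where "H = norm (numer M \<nu> x (of_nat n * \<zeta> - 1 / 2) / falling n (of_nat n * \<zeta> - 1 / 2))"
      define r where "r = 1 + real n * norm \<zeta>"
      have r: "r > 0" by (simp add: r_def add_pos_nonneg)
      have Hb: "H \<le> CR * exp (- (real n * Re (phase M x\<^sub>0 \<zeta>) + real n * ln (real n)) + real n * Re \<zeta> * e' - ln x / 2) / r ^ N"
        using CR(2)[OF n \<theta>(1,2) x e'] r unfolding H_def \<zeta>_def[symmetric] r_def[symmetric]
        by (simp add: pos_le_divide_eq)
      have Gb: "norm G \<le> CL * (1 + real n * norm z) ^ N *
         exp (real n * Re (phase M x\<^sub>0 z) + real n * ln (real n) - real n * a * e - ln y / 2)"
        unfolding G_def s_def z_def by (rule CL(2)[OF n v(1) y e])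
      have zd: "norm (z - \<zeta>) > 0"
      proof -
        have "\<bar>\<bar>v\<bar> - b\<bar> * \<bar>\<bar>\<theta>\<bar> - \<phi>\<bar> > 0" using v \<theta> by (intro mult_pos_pos) auto
        then show ?thesis using K(2)[OF \<theta>(1,2), of v] by (auto simp: z_def \<zeta>_def)
      qed
      \<comment> \<open>Transversality bounds the squared distance below by a product, so the square
        root splits the Cauchy factor into one singularity in v and one in \<theta>.\<close>
      have dist: "1 / norm (z - \<zeta>) \<le> sqrt K * (\<Delta> * \<bar>\<bar>\<theta>\<bar> - \<phi>\<bar> powr (-1/2))"
      proof -
        define A where "A = \<bar>\<bar>v\<bar> - b\<bar> * \<bar>\<bar>\<theta>\<bar> - \<phi>\<bar>"
        have A: "A > 0" using v \<theta> unfolding A_def by (intro mult_pos_pos) auto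
        have "sqrt A \<le> sqrt (K * (norm (z - \<zeta>))\<^sup>2)"
          using K(2)[OF \<theta>(1,2), of v] by (intro real_sqrt_le_mono) (simp add: A_def z_def \<zeta>_def)
        also have "\<dots> = sqrt K * norm (z - \<zeta>)" by (simp add: real_sqrt_mult)
        finally have "1 / norm (z - \<zeta>) \<le> sqrt K * (1 / sqrt A)"
          using A zd by (simp add: divide_simps)
        also have "1 / sqrt A = A powr (-1/2)"
          using A powr_minus[of A "1/2"] by (simp add: powr_half_sqrt inverse_eq_divide)
        also have "\<dots> = \<Delta> * \<bar>\<bar>\<theta>\<bar> - \<phi>\<bar> powr (-1/2)" by (simp add: A_def \<Delta>_def powr_mult)
        finally show ?thesis .
      qed
      \<comment> \<open>The n from s - t = n (z - \<zeta>) cancels the n from the derivative of the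
        scaled contour.\<close>
      have "norm (F \<xi>) = H / (real n * norm (z - \<zeta>)) * (real n * norm (D \<xi>))"
      proof -
        have "s - (of_nat n * \<zeta> - 1 / 2) = of_nat n * (z - \<zeta>)" by (simp add: s_def algebra_simps)
        then show ?thesis unfolding F_def sc H_def by (simp only: norm_mult norm_divide norm_of_nat divide_divide_eq_left)
      qed
      also have "\<dots> = H * (1 / norm (z - \<zeta>)) * norm (D \<xi>)" using n by simp
      finally have "norm (G * F \<xi>) = norm G * (H * (1 / norm (z - \<zeta>)) * norm (D \<xi>))" by (simp add: norm_mult)
      also have "\<dots> \<le> (CL * (1 + real n * norm z) ^ N *
         exp (real n * Re (phase M x\<^sub>0 z) + real n * ln (real n) - real n * a * e - ln y / 2)) *
        ((CR * exp (- (real n * Re (phase M x\<^sub>0 \<zeta>) + real n * ln (real n)) + real n * Re \<zeta> * e' - ln x / 2) / r ^ N)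
          * (sqrt K * (\<Delta> * \<bar>\<bar>\<theta>\<bar> - \<phi>\<bar> powr (-1/2))) * B)"
        using Gb Hb dist D(4)[OF \<xi>01] CL CR K D(3) r zd
        by (intro mult_mono) (auto simp: H_def \<Delta>_def intro!: mult_nonneg_nonneg divide_nonneg_nonneg)
      also have "\<dots> = (CL * CR * sqrt K * B * \<Delta> * \<bar>\<bar>\<theta>\<bar> - \<phi>\<bar> powr (-1/2)) * ((1 + real n * norm z) ^ N / r ^ N) *
          exp ((real n * Re (phase M x\<^sub>0 z) + real n * ln (real n) - real n * a * e - ln y / 2) +
             (- (real n * Re (phase M x\<^sub>0 \<zeta>) + real n * ln (real n)) + real n * Re \<zeta> * e' - ln x / 2))"
        unfolding exp_add[of "real n * Re (phase M x\<^sub>0 z) + real n * ln (real n) - real n * a * e - ln y / 2"] by (simp add: mult_ac)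
      \<comment> \<open>The two n ln n terms cancel, and adding and subtracting the phase at w
        separates the decay along the line from the gap along the curve.\<close>
      also have "(real n * Re (phase M x\<^sub>0 z) + real n * ln (real n) - real n * a * e - ln y / 2) +
             (- (real n * Re (phase M x\<^sub>0 \<zeta>) + real n * ln (real n)) + real n * Re \<zeta> * e' - ln x / 2)
          = real n * (Re (phase M x\<^sub>0 z) - Re (phase M x\<^sub>0 w)) + (- real n * contour_gap \<theta>) +
            ((real n * Re \<zeta> * e' - real n * a * e) - (ln x + ln y) / 2)"
        by (simp add: contour_gap_def \<zeta>_def algebra_simps)
      also have "exp \<dots> = exp (real n * (Re (phase M x\<^sub>0 z) - Re (phase M x\<^sub>0 w))) * exp (- real n * contour_gap \<theta>) *
          exp ((real n * Re \<zeta> * e' - real n * a * e) - (ln x + ln y) / 2)"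
        by (simp only: exp_add)
      finally have 1: "norm (G * F \<xi>) \<le> (CL * CR * sqrt K * B * \<Delta> * \<bar>\<bar>\<theta>\<bar> - \<phi>\<bar> powr (-1/2)) * ((1 + real n * norm z) ^ N / r ^ N) *
          (exp (real n * (Re (phase M x\<^sub>0 z) - Re (phase M x\<^sub>0 w))) * exp (- real n * contour_gap \<theta>) *
          exp ((real n * Re \<zeta> * e' - real n * a * e) - (ln x + ln y) / 2))" .
      \<comment> \<open>The powers coming from \<open>\<nu>\<close> in s and in t nearly balance:
        the numerator gives n^N times a power free of n, and n^N goes into
        \<open>damping\<close>.\<close>
      have 2: "(1 + real n * norm z) ^ N / r ^ N \<le> (1 + norm z) ^ N * (real n / r) ^ N"
      proof -
        have "1 + real n * norm z \<le> real n * (1 + norm z)" using n by (simp add: distrib_left)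
        then have "(1 + real n * norm z) ^ N \<le> (real n * (1 + norm z)) ^ N"
          by (intro power_mono) (auto simp: add_nonneg_nonneg)
        then have "(1 + real n * norm z) ^ N / r ^ N \<le> (real n * (1 + norm z)) ^ N / r ^ N"
          using r by (intro divide_right_mono) auto
        then show ?thesis by (simp add: power_mult_distrib power_divide mult_ac)
      qed
      have 3: "exp ((real n * Re \<zeta> * e' - real n * a * e) - (ln x + ln y) / 2) \<le> P / real n ^ M"
      proof -
        have "\<theta> \<in> {-\<theta>max..\<theta>max}" using \<theta>(2) by auto
        then have "norm \<zeta> \<le> R" unfolding \<zeta>_def by (intro bspec[OF R(2)] imageI)
        then have "\<bar>Re \<zeta>\<bar> \<le> R" using abs_Re_le_cmod[of \<zeta>] by linarith
        then have "\<bar>Re \<zeta>\<bar> * (real n * \<bar>e'\<bar>) \<le> R * T" using eT R by (intro mult_mono) auto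
        then have i: "real n * Re \<zeta> * e' \<le> R * T"
          using abs_ge_self[of "real n * Re \<zeta> * e'"] by (simp add: abs_mult mult_ac)
        have "- (real n * a * e) = a * (real n * (- e))" by simp
        also have "\<dots> \<le> a * (real n * \<bar>e\<bar>)" using a by (intro mult_left_mono) auto
        also have "\<dots> \<le> a * T" using eT a by (intro mult_left_mono) auto
        finally have ii: "- (real n * a * e) \<le> a * T" .
        have "1 * \<bar>e\<bar> \<le> real n * \<bar>e\<bar>" "1 * \<bar>e'\<bar> \<le> real n * \<bar>e'\<bar>" using n by (intro mult_right_mono; simp)+
        then have "\<bar>e\<bar> \<le> T" "\<bar>e'\<bar> \<le> T" using eT by (simp_all only: mult_1)
        then have iii: "- e / 2 - e' / 2 \<le> T" by linarith
        have "(real n * Re \<zeta> * e' - real n * a * e) - (ln x + ln y) / 2 \<le> (R + a + 1) * T - ln x\<^sub>0 - real M * ln (real n)"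
          using i ii iii unfolding e e' by (simp add: algebra_simps add_divide_distrib)
        then have "exp ((real n * Re \<zeta> * e' - real n * a * e) - (ln x + ln y) / 2) \<le> exp ((R + a + 1) * T - ln x\<^sub>0 - real M * ln (real n))"
          by simp
        also have "\<dots> = P / real n ^ M"
          using n bulk_param_pos[OF \<phi>] by (simp add: P_def exp_diff exp_of_nat_mult)
        finally show ?thesis .
      qed
      have dm: "damped N n \<xi> = (real n / r) ^ N * exp (- real n * contour_gap \<theta>) * \<bar>\<bar>\<theta>\<bar> - \<phi>\<bar> powr (-1/2)"
        using \<xi> by (simp add: damped_def damping_def r_def \<zeta>_def \<theta>_def)
      note 1
      also have "(CL * CR * sqrt K * B * \<Delta> * \<bar>\<bar>\<theta>\<bar> - \<phi>\<bar> powr (-1/2)) * ((1 + real n * norm z) ^ N / r ^ N) *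
          (exp (real n * (Re (phase M x\<^sub>0 z) - Re (phase M x\<^sub>0 w))) * exp (- real n * contour_gap \<theta>) *
          exp ((real n * Re \<zeta> * e' - real n * a * e) - (ln x + ln y) / 2))
         \<le> (CL * CR * sqrt K * B * \<Delta> * \<bar>\<bar>\<theta>\<bar> - \<phi>\<bar> powr (-1/2)) * ((1 + norm z) ^ N * (real n / r) ^ N) *
          (exp (real n * (Re (phase M x\<^sub>0 z) - Re (phase M x\<^sub>0 w))) * exp (- real n * contour_gap \<theta>) * (P / real n ^ M))"
        using 2 3 CL CR K D(3) r
        by (intro mult_mono mult_left_mono) (auto simp: \<Delta>_def intro!: mult_nonneg_nonneg divide_nonneg_nonneg add_nonneg_nonneg)
      also have "\<dots> = (CL * CR * sqrt K * B * P / real n ^ M * \<Delta> * damped N n \<xi>) *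
          ((1 + norm z) ^ N * exp (real n * (Re (phase M x\<^sub>0 z) - Re (phase M x\<^sub>0 w))))"
        unfolding dm by (simp add: mult_ac)
      also have "\<dots> \<le> (CL * CR * sqrt K * B * P / real n ^ M * \<Delta> * damped N n \<xi>) * (CD * (1 / (1 + v\<^sup>2)))"
        using CD(2)[OF n v(1)] CL CR K D(3) P r unfolding z_def[symmetric] dm
        by (intro mult_left_mono) (auto simp: \<Delta>_def intro!: mult_nonneg_nonneg divide_nonneg_nonneg)
      also have "\<dots> = Q * damped N n \<xi>" by (simp add: Q_def C_def mult_ac)
      finally show ?thesis .
    qed
    \<comment> \<open>Values at finitely many parameters do not affect the integral; setting them to
      0 makes the bound by \<open>damped\<close> hold everywhere.\<close>
    define F' where "F' = (\<lambda>\<xi>. if \<xi> \<in> regular_params then G * F \<xi> else 0)"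
    have spike: "(F' has_integral G * I) {0..1}"
    proof (rule has_integral_spike_finite[OF finite_irregular_params])
      show "((\<lambda>\<xi>. G * F \<xi>) has_integral G * I) {0..1}"
        by (rule has_integral_mult_right[OF Fint])
    qed (auto simp: F'_def)
    have dint: "damped N n integrable_on {0..1}" "integral {0..1} (damped N n) = (LINT \<xi>|lborel. damped N n \<xi>)"
    proof -
      have eq: "indicator {0..1} \<xi> *\<^sub>R damped N n \<xi> = damped N n \<xi>" for \<xi>
        using regular_params_subset by (auto simp: damped_def indicator_def)
      have si: "set_integrable lborel {0..1} (damped N n)"
        unfolding set_integrable_def eq by (rule damped_integral_tendsto_0)
      show "damped N n integrable_on {0..1}" "integral {0..1} (damped N n) = (LINT \<xi>|lborel. damped N n \<xi>)"
        using set_borel_integral_eq_integral[OF si] unfolding set_lebesgue_integral_def eq by auto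
    qed
    have "norm (integral {0..1} F') \<le> integral {0..1} (\<lambda>\<xi>. Q * damped N n \<xi>)"
    proof (rule integral_norm_bound_integral)
      show "F' integrable_on {0..1}" using spike by blast
      show "(\<lambda>\<xi>. Q * damped N n \<xi>) integrable_on {0..1}" by (rule integrable_on_mult_right[OF dint(1)])
      show "norm (F' \<xi>) \<le> Q * damped N n \<xi>" if "\<xi> \<in> {0..1}" for \<xi>
        using pointwise[of \<xi>] by (auto simp: F'_def damped_def)
    qed
    also have "\<dots> = Q * (LINT \<xi>|lborel. damped N n \<xi>)" by (simp add: dint)
    finally have GI: "norm (G * I) \<le> Q * (LINT \<xi>|lborel. damped N n \<xi>)"
      using integral_unique[OF spike] by simp
    have J: "0 \<le> Q * (LINT \<xi>|lborel. damped N n \<xi>)" using GI norm_ge_zero order.trans by blast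
    have "line_integrand M \<nu> n x y s - (if \<bar>v\<bar> < b then of_real x powr s * of_real y powr (- s - 1) else 0)
        = G / (2 * of_real pi * \<i>) * I"
      using line_integrand_decomposition[OF n x y v(2) v(1), of \<nu>] unfolding s_def[symmetric] z_def[symmetric] G_def I_def by simp
    then have "norm (line_integrand M \<nu> n x y s - (if \<bar>v\<bar> < b then of_real x powr s * of_real y powr (- s - 1) else 0))
       = norm (G * I) / (2 * pi)"
      by (simp add: norm_mult norm_divide)
    also have "\<dots> \<le> Q * (LINT \<xi>|lborel. damped N n \<xi>) / (2 * pi)" using GI by (intro divide_right_mono) auto
    also have "\<dots> \<le> Q * (LINT \<xi>|lborel. damped N n \<xi>) / 1"
      using J pi_gt3 by (intro divide_left_mono) auto
    also have "\<dots> = (C / real n ^ M * (LINT \<xi>|lborel. damped N n \<xi>)) * (1 / (1 + v\<^sup>2) * \<bar>\<bar>v\<bar> - b\<bar> powr (-1/2))"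
      by (simp add: Q_def \<Delta>_def mult_ac)
    finally show "norm (line_integrand M \<nu> n x y (of_nat n * Complex a v - 1 / 2)
          - (if \<bar>v\<bar> < b then of_real x powr (of_nat n * Complex a v - 1 / 2) * of_real y powr (- (of_nat n * Complex a v - 1 / 2) - 1) else 0))
       \<le> (C / real n ^ M * (LINT \<xi>|lborel. damped N n \<xi>)) * (1 / (1 + v\<^sup>2) * \<bar>\<bar>v\<bar> - b\<bar> powr (-1/2))"
      unfolding s_def z_def .
  qed
qed

end

section \<open>The sine kernel\<close>

lemma integral_cexp_symmetric:
  assumes "b > 0"
  shows "((\<lambda>v. exp (\<i> * of_real (\<alpha> * v))) has_integral
     (if \<alpha> = 0 then 2 * of_real b else of_real (2 * sin (\<alpha> * b) / \<alpha>) :: complex)) {-b..b}"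
proof (cases "\<alpha> = 0")
  case True
  then show ?thesis
    using has_integral_const_real[of "1 :: complex" "-b" b] assms by (simp add: scaleR_conv_of_real)
next
  case False
  have "((\<lambda>v. exp (\<i> * of_real (\<alpha> * v))) has_integral
     exp (\<i> * of_real (\<alpha> * b)) / (\<i> * of_real \<alpha>) - exp (\<i> * of_real (\<alpha> * (- b))) / (\<i> * of_real \<alpha>)) {-b..b}"
  proof (rule fundamental_theorem_of_calculus)
    fix v
    have "((\<lambda>z. exp (\<i> * (of_real \<alpha> * z)) / (\<i> * of_real \<alpha>)) has_field_derivative exp (\<i> * of_real (\<alpha> * v))) (at (of_real v))"
      using False by (auto intro!: derivative_eq_intros simp: mult_ac)
    from has_vector_derivative_real_field[OF this, of "{-b..b}"]
    show "((\<lambda>v. exp (\<i> * of_real (\<alpha> * v)) / (\<i> * of_real \<alpha>)) has_vector_derivative exp (\<i> * of_real (\<alpha> * v))) (at v within {-b..b})"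
      by simp
  qed (use assms in auto)
  also have "exp (\<i> * of_real (\<alpha> * b)) / (\<i> * of_real \<alpha>) - exp (\<i> * of_real (\<alpha> * (- b))) / (\<i> * of_real \<alpha>)
      = of_real (2 * sin (\<alpha> * b) / \<alpha>)"
  proof -
    have "exp (\<i> * of_real (\<alpha> * b)) - exp (\<i> * of_real (\<alpha> * (- b))) = cis (\<alpha> * b) - cis (- (\<alpha> * b))"
      by (simp add: cis_conv_exp)
    also have "\<dots> = \<i> * of_real (2 * sin (\<alpha> * b))" by (simp add: complex_eq_iff)
    finally show ?thesis using False by (simp add: field_simps flip: diff_divide_distrib)
  qed
  finally show ?thesis using False by simp
qed

text \<open>On the imaginary axis exp has derivative of modulus 1, so the integrand is Lipschitz in
  the frequency with constant |v|, at most b.\<close>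

lemma norm_integral_cexp_diff_le:
  assumes b: "b > 0"
  shows "norm (integral {-b..b} (\<lambda>v. exp (\<i> * of_real (\<alpha> * v)) :: complex) - integral {-b..b} (\<lambda>v. exp (\<i> * of_real (\<beta> * v))))
    \<le> 2 * b * (\<bar>\<alpha> - \<beta>\<bar> * b)"
    and "norm (integral {-b..b} (\<lambda>v. exp (\<i> * of_real (\<alpha> * v)) :: complex)) \<le> 2 * b"
proof -
  have c: "(\<lambda>v. exp (\<i> * of_real (\<gamma> * v)) :: complex) integrable_on {-b..b}" for \<gamma>
    using integral_cexp_symmetric[OF b, of \<gamma>] by blast
  have p: "norm (exp (\<i> * of_real (\<alpha> * v)) - exp (\<i> * of_real (\<beta> * v)) :: complex) \<le> \<bar>\<alpha> - \<beta>\<bar> * b" if v: "v \<in> {-b..b}" for v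
  proof -
    have "norm (exp (\<i> * of_real (\<alpha> * v)) - exp (\<i> * of_real (\<beta> * v)) :: complex)
        \<le> 1 * norm (\<i> * of_real (\<alpha> * v) - \<i> * of_real (\<beta> * v))"
    proof (rule field_differentiable_bound[where S = "{z. Re z = 0}" and f = exp and f' = exp])
      show "convex {z. Re z = 0}" by (rule convexI) simp
    qed (auto intro!: derivative_eq_intros simp: norm_exp_eq_Re)
    also have "\<i> * of_real (\<alpha> * v) - \<i> * of_real (\<beta> * v) = \<i> * of_real ((\<alpha> - \<beta>) * v)"
      by (simp add: algebra_simps)
    also have "norm \<dots> = \<bar>\<alpha> - \<beta>\<bar> * \<bar>v\<bar>" by (simp only: norm_mult norm_ii norm_of_real abs_mult mult_1)
    also have "1 * \<dots> \<le> \<bar>\<alpha> - \<beta>\<bar> * b" using v by (auto intro!: mult_left_mono)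
    finally show ?thesis .
  qed
  have "norm (integral {-b..b} (\<lambda>v. exp (\<i> * of_real (\<alpha> * v)) - exp (\<i> * of_real (\<beta> * v)) :: complex)) \<le> integral {-b..b} (\<lambda>v. \<bar>\<alpha> - \<beta>\<bar> * b)"
    by (rule integral_norm_bound_integral) (use c p in \<open>auto intro: integrable_diff\<close>)
  also have "\<dots> = 2 * b * (\<bar>\<alpha> - \<beta>\<bar> * b)" using b by simp
  finally show "norm (integral {-b..b} (\<lambda>v. exp (\<i> * of_real (\<alpha> * v)) :: complex) - integral {-b..b} (\<lambda>v. exp (\<i> * of_real (\<beta> * v))))
    \<le> 2 * b * (\<bar>\<alpha> - \<beta>\<bar> * b)"
    unfolding integral_diff[OF c c] .
  have "norm (integral {-b..b} (\<lambda>v. exp (\<i> * of_real (\<alpha> * v)) :: complex)) \<le> integral {-b..b} (\<lambda>v. 1 :: real)"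
    by (rule integral_norm_bound_integral) (use c in \<open>auto simp: norm_exp_eq_Re\<close>)
  then show "norm (integral {-b..b} (\<lambda>v. exp (\<i> * of_real (\<alpha> * v)) :: complex)) \<le> 2 * b" using b by simp
qed

lemma abs_exp_minus_one_le:
  fixes d :: real
  assumes "\<bar>d\<bar> \<le> 1"
  shows "\<bar>exp d - 1\<bar> \<le> 2 * \<bar>d\<bar>"
proof (cases "d \<ge> 0")
  case True
  have "exp d \<le> 1 + d + d\<^sup>2" using True assms by (intro exp_bound) auto
  moreover have "d * d \<le> 1 * d" using True assms by (intro mult_right_mono) auto
  moreover have "exp d \<ge> 1" using True by simp
  ultimately show ?thesis using True unfolding power2_eq_square by linarith
next
  case False
  then have "\<bar>exp d - 1\<bar> = 1 - exp d" "\<bar>d\<bar> = - d" by simp_all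
  then show ?thesis using exp_ge_add_one_self[of d] False by linarith
qed

section \<open>Uniform asymptotics in the scaling window\<close>

context bulk_point
begin

definition window :: "nat \<Rightarrow> real \<Rightarrow> real" where
  "window n t = real n ^ M * (x\<^sub>0 + t / (real n * rho M \<phi>))"

text \<open>The deviation of the logarithm of \<open>window n t\<close> from that of
  \<open>n^M x\<^sub>0\<close>; it supplies the e and e' of the preceding estimates.\<close>

definition log_shift :: "nat \<Rightarrow> real \<Rightarrow> real" where
  "log_shift n t = ln (1 + t / (real n * (rho M \<phi> * x\<^sub>0)))"

text \<open>With h = t/(n k), the lower bound on n gives |h| <= 1/2, and |ln(1 + h) - h| <= 2 h^2
  applies. The third part shows n times the shift is bounded, the fourth identifies its limit with
  an error of order 1/n.\<close>

lemma window_asymptotics: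
  assumes n: "n \<ge> 1" and t: "\<bar>t\<bar> \<le> T" "2 * T \<le> real n * (rho M \<phi> * x\<^sub>0)"
  shows "window n t > 0" "ln (window n t) = real M * ln (real n) + ln x\<^sub>0 + log_shift n t"
    "real n * \<bar>log_shift n t\<bar> \<le> 2 * T / (rho M \<phi> * x\<^sub>0)"
    "\<bar>real n * log_shift n t - t / (rho M \<phi> * x\<^sub>0)\<bar> \<le> 2 * (T / (rho M \<phi> * x\<^sub>0))\<^sup>2 / real n"
proof -
  define k where "k = rho M \<phi> * x\<^sub>0"
  have x0: "x\<^sub>0 > 0" by (rule bulk_param_pos[OF \<phi>])
  have k: "k > 0" using bulk_constants(1) x0 by (simp add: k_def)
  define h where "h = t / (real n * k)"
  have nk: "real n * k > 0" using n k by simp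
  have habs: "\<bar>h\<bar> \<le> T / k / real n"
    using t n k by (simp add: h_def abs_divide abs_mult divide_simps mult_ac)
  have "T / k / real n \<le> 1 / 2" using t(2) n k unfolding k_def[symmetric] by (simp add: divide_simps mult_ac)
  then have h2: "\<bar>h\<bar> \<le> 1 / 2" using habs by linarith
  have w: "window n t = real n ^ M * (x\<^sub>0 * (1 + h))"
    using n x0 bulk_constants(1) by (simp add: window_def h_def k_def field_simps)
  have h1: "1 + h > 0" using h2 by linarith
  show "window n t > 0" unfolding w using n x0 h1 by simp
  have ls: "log_shift n t = ln (1 + h)" by (simp add: log_shift_def h_def k_def)
  show "ln (window n t) = real M * ln (real n) + ln x\<^sub>0 + log_shift n t"
    unfolding w ls using n x0 h1 by (simp add: ln_mult ln_realpow)
  have d: "\<bar>ln (1 + h) - h\<bar> \<le> 2 * h\<^sup>2" by (rule abs_ln_one_plus_x_minus_x_bound[OF h2])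
  have hh: "h\<^sup>2 \<le> (T / k / real n)\<^sup>2" using habs power_mono[of "\<bar>h\<bar>" _ 2] by simp
  have "real n * \<bar>ln (1 + h) - h\<bar> \<le> real n * (2 * (T / k / real n)\<^sup>2)"
    using d hh by (intro mult_left_mono) auto
  also have "\<dots> = 2 * (T / k)\<^sup>2 / real n" using n by (simp add: power2_eq_square)
  finally have "\<bar>real n * (ln (1 + h) - h)\<bar> \<le> 2 * (T / k)\<^sup>2 / real n" by (simp add: abs_mult)
  moreover have "real n * (ln (1 + h) - h) = real n * log_shift n t - t / k"
    using n k by (simp add: ls h_def right_diff_distrib)
  ultimately show "\<bar>real n * log_shift n t - t / (rho M \<phi> * x\<^sub>0)\<bar> \<le> 2 * (T / (rho M \<phi> * x\<^sub>0))\<^sup>2 / real n"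
    by (simp add: k_def)
  have "h\<^sup>2 \<le> 1 / 2 * \<bar>h\<bar>" using h2 mult_right_mono[of "\<bar>h\<bar>" "1/2" "\<bar>h\<bar>"] by (simp add: power2_eq_square)
  then have "\<bar>ln (1 + h)\<bar> \<le> 2 * \<bar>h\<bar>" using d by linarith
  then have "real n * \<bar>log_shift n t\<bar> \<le> real n * (2 * (T / k / real n))"
    unfolding ls using habs by (intro mult_left_mono) auto
  then show "real n * \<bar>log_shift n t\<bar> \<le> 2 * T / (rho M \<phi> * x\<^sub>0)" using n by (simp add: k_def)
qed

definition main_integrand :: "nat \<Rightarrow> real \<Rightarrow> real \<Rightarrow> real \<Rightarrow> complex" where
  "main_integrand n x y v = of_real x powr (of_nat n * Complex a v - 1 / 2) * of_real y powr (- (of_nat n * Complex a v - 1 / 2) - 1)"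

text \<open>On a vertical line the modulus is constant and the phase is linear in v, so the integral
  over the segment between the saddle points is elementary.\<close>

lemma main_integrand_eq:
  assumes "x > 0" "y > 0"
  shows "main_integrand n x y v = of_real (exp ((real n * a - 1 / 2) * (ln x - ln y)) / y) * exp (\<i> * of_real (real n * (ln x - ln y) * v))"
proof -
  define s where "s = of_nat n * Complex a v - 1 / 2"
  have s: "s = of_real (real n * a - 1 / 2) + \<i> * of_real (real n * v)"
    by (simp add: s_def complex_eq_iff)
  have "main_integrand n x y v = exp (s * of_real (ln x)) * exp ((- s - 1) * of_real (ln y))"
    using assms by (simp add: main_integrand_def s_def powr_def Ln_of_real)
  also have "\<dots> = exp (s * of_real (ln x - ln y) + of_real (- ln y))"
    by (simp add: algebra_simps flip: exp_add)
  also have "\<dots> = exp (s * of_real (ln x - ln y)) * of_real (1 / y)"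
    unfolding exp_add[of "s * of_real (ln x - ln y)"] exp_of_real using assms by (simp add: exp_minus divide_inverse)
  also have "s * of_real (ln x - ln y) = of_real ((real n * a - 1 / 2) * (ln x - ln y)) + \<i> * of_real (real n * (ln x - ln y) * v)"
    unfolding s by (simp add: algebra_simps diff_divide_distrib)
  also have "exp \<dots> = of_real (exp ((real n * a - 1 / 2) * (ln x - ln y))) * exp (\<i> * of_real (real n * (ln x - ln y) * v))"
    by (simp only: exp_add exp_of_real)
  finally show ?thesis by simp
qed

lemma main_integral:
  assumes xy: "x > 0" "y > 0"
  shows "integrable lborel (\<lambda>v. indicator {-b..b} v *\<^sub>R main_integrand n x y v)"
    and "(LINT v|lborel. indicator {-b..b} v *\<^sub>R main_integrand n x y v) =
      of_real (exp ((real n * a - 1 / 2) * (ln x - ln y)) / y) *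
      integral {-b..b} (\<lambda>v. exp (\<i> * of_real (real n * (ln x - ln y) * v)))"
proof -
  have "set_integrable lborel {-b..b} (main_integrand n x y)"
    unfolding main_integrand_eq[OF xy, abs_def]
    by (intro borel_integrable_atLeastAtMost' continuous_intros)
  note si = this
  then show "integrable lborel (\<lambda>v. indicator {-b..b} v *\<^sub>R main_integrand n x y v)"
    by (simp add: set_integrable_def)
  show "(LINT v|lborel. indicator {-b..b} v *\<^sub>R main_integrand n x y v) =
      of_real (exp ((real n * a - 1 / 2) * (ln x - ln y)) / y) *
      integral {-b..b} (\<lambda>v. exp (\<i> * of_real (real n * (ln x - ln y) * v)))"
    using set_borel_integral_eq_integral(2)[OF si] unfolding set_lebesgue_integral_def main_integrand_eq[OF xy]
    by (simp only: integral_mult_right)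
qed

text \<open>Integrates the pointwise bound over the line. The factor n comes from the substitution
  Im s = n v.\<close>

lemma kernel_main_term:
  assumes nu: "\<nu> 0 = 0" and T: "T \<ge> 0"
  obtains C where "C > 0"
    "\<And>n \<Sigma> x y e e'. encloses_once n \<Sigma> \<Longrightarrow> n \<ge> 1 \<Longrightarrow> x > 0 \<Longrightarrow> y > 0 \<Longrightarrow>
       ln x = real M * ln (real n) + ln x\<^sub>0 + e' \<Longrightarrow> ln y = real M * ln (real n) + ln x\<^sub>0 + e \<Longrightarrow>
       real n * \<bar>e\<bar> \<le> T \<Longrightarrow> real n * \<bar>e'\<bar> \<le> T \<Longrightarrow>
       norm (ginibre_kernel M \<nu> n \<Sigma> x y - of_real (real n / (2 * pi)) * (LINT v|lborel. indicator {-b..b} v *\<^sub>R main_integrand n x y v))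
       \<le> real n / (2 * pi) * (C / real n ^ M * (LINT \<xi>|lborel. damped (\<Sum>j=1..M. \<nu> j) n \<xi>))"
proof -
  obtain C where C: "C > 0"
    "\<And>n x y e e' v. n \<ge> 1 \<Longrightarrow> x > 0 \<Longrightarrow> y > 0 \<Longrightarrow>
       ln x = real M * ln (real n) + ln x\<^sub>0 + e' \<Longrightarrow> ln y = real M * ln (real n) + ln x\<^sub>0 + e \<Longrightarrow>
       real n * \<bar>e\<bar> \<le> T \<Longrightarrow> real n * \<bar>e'\<bar> \<le> T \<Longrightarrow> v \<noteq> 0 \<Longrightarrow> \<bar>v\<bar> \<noteq> b \<Longrightarrow>
       norm (line_integrand M \<nu> n x y (of_nat n * Complex a v - 1 / 2)
          - (if \<bar>v\<bar> < b then main_integrand n x y v else 0))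
       \<le> (C / real n ^ M * (LINT \<xi>|lborel. damped (\<Sum>j=1..M. \<nu> j) n \<xi>)) * (1 / (1 + v\<^sup>2) * \<bar>\<bar>v\<bar> - b\<bar> powr (-1/2))"
    unfolding main_integrand_def by (rule error_integrand_bound[OF T, where \<nu> = \<nu>]) blast
  define g where "g = (\<lambda>v::real. 1 / (1 + v\<^sup>2) * \<bar>\<bar>v\<bar> - b\<bar> powr (-1/2))"
  have g: "integrable lborel g"
    unfolding g_def
  proof (rule integrable_symmetric_sqrt_singularity[where W = 1])
    show "integrable lborel (\<lambda>v::real. 1 / (1 + v\<^sup>2))" by (rule integrable_inverse_1_plus_square)
    show "0 \<le> 1 / (1 + v\<^sup>2)" "1 / (1 + v\<^sup>2) \<le> 1" for v :: real
      by (auto simp: divide_le_eq_1 add_pos_nonneg intro!: divide_nonneg_nonneg add_nonneg_nonneg)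
  qed (use b in auto)
  \<comment> \<open>The added 1 only ensures positivity of the final constant.\<close>
  define A where "A = (LINT v|lborel. g v) + 1"
  have "(LINT v|lborel. g v) \<ge> 0"
    by (intro Bochner_Integration.integral_nonneg) (auto simp: g_def intro!: mult_nonneg_nonneg divide_nonneg_nonneg add_nonneg_nonneg)
  then have A: "A > 0" "(LINT v|lborel. g v) \<le> A" by (simp_all add: A_def)
  show ?thesis
  proof (rule that[of "C * A"])
    show "C * A > 0" using C A by simp
    fix n \<Sigma> x y e e'
    assume enc: "encloses_once n \<Sigma>" and n: "n \<ge> (1::nat)" and xy: "x > 0" "y > 0"
      and lx: "ln x = real M * ln (real n) + ln x\<^sub>0 + e'" and ly: "ln y = real M * ln (real n) + ln x\<^sub>0 + e"
      and eT: "real n * \<bar>e\<bar> \<le> T" "real n * \<bar>e'\<bar> \<le> T"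
    define c where "c = real n * a - 1 / 2"
    have c: "c \<ge> - 1 / 2" using a by (simp add: c_def)
    define P where "P = (\<lambda>v. line_integrand M \<nu> n x y (of_nat n * Complex a v - 1 / 2))"
    define m where "m = (\<lambda>v. indicator {-b..b} v *\<^sub>R main_integrand n x y v)"
    define J where "J = (LINT \<xi>|lborel. damped (\<Sum>j=1..M. \<nu> j) n \<xi>)"
    have J: "J \<ge> 0" unfolding J_def
      by (intro Bochner_Integration.integral_nonneg) (auto simp: damped_def damping_nonneg)
    note line = ginibre_kernel_line[where \<nu> = \<nu>, OF M nu enc xy c]
    have aff: "Complex c (0 + real n * v) = of_nat n * Complex a v - 1 / 2" for v
      by (simp add: c_def complex_eq_iff)
    have "integrable lborel (\<lambda>v. line_integrand M \<nu> n x y (Complex c (0 + real n * v)))"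
      by (rule lborel_integrable_real_affine[OF line(1)]) (use n in auto)
    then have Pint: "integrable lborel P" unfolding aff P_def .
    have "(LINT u|lborel. line_integrand M \<nu> n x y (Complex c u)) = \<bar>real n\<bar> *\<^sub>R (LINT v|lborel. line_integrand M \<nu> n x y (Complex c (0 + real n * v)))"
      by (rule lborel_integral_real_affine) (use n in auto)
    then have K: "ginibre_kernel M \<nu> n \<Sigma> x y = of_real (real n / (2 * pi)) * (LINT v|lborel. P v)"
      unfolding line(2) aff P_def by (simp add: scaleR_conv_of_real)
    have mint: "integrable lborel m" unfolding m_def by (rule main_integral[OF xy])
    have "norm (LINT v|lborel. P v - m v) \<le> (LINT v|lborel. (C / real n ^ M * J) * g v)"
    proof (rule Bochner_Integration.integral_norm_bound[THEN order.trans], rule integral_mono_AE)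
      show "integrable lborel (\<lambda>v. norm (P v - m v))" using Pint mint by simp
      show "integrable lborel (\<lambda>v. (C / real n ^ M * J) * g v)" using g by simp
      \<comment> \<open>The decomposition fails where the line meets the real axis or the curve;
        these three heights form a null set.\<close>
      have "AE v in lborel. v \<notin> {0, b, -b}"
        by (intro AE_not_in finite_imp_null_set_lborel) auto
      then show "AE v in lborel. norm (P v - m v) \<le> (C / real n ^ M * J) * g v"
      proof eventually_elim
        case (elim v)
        then have v: "v \<noteq> 0" "\<bar>v\<bar> \<noteq> b" by (auto simp: abs_if split: if_splits)
        then have "m v = (if \<bar>v\<bar> < b then main_integrand n x y v else 0)"
          by (auto simp: m_def indicator_def abs_if split: if_splits)
        then show ?case
          using C(2)[OF n xy lx ly eT v] by (simp add: P_def g_def J_def)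
      qed
    qed
    also have "\<dots> = (C / real n ^ M * J) * (LINT v|lborel. g v)" by simp
    also have "\<dots> \<le> (C / real n ^ M * J) * A" using C J A by (intro mult_left_mono) auto
    finally have bound: "norm ((LINT v|lborel. P v) - (LINT v|lborel. m v)) \<le> C * A / real n ^ M * J"
      using Pint mint by (simp add: mult_ac)
    have "norm (ginibre_kernel M \<nu> n \<Sigma> x y - of_real (real n / (2 * pi)) * (LINT v|lborel. m v))
       = real n / (2 * pi) * norm ((LINT v|lborel. P v) - (LINT v|lborel. m v))"
      unfolding K right_diff_distrib[symmetric] norm_mult norm_of_real by simp
    also have "\<dots> \<le> real n / (2 * pi) * (C * A / real n ^ M * J)"
      using bound by (intro mult_left_mono) auto
    finally show "norm (ginibre_kernel M \<nu> n \<Sigma> x y - of_real (real n / (2 * pi)) * (LINT v|lborel. indicator {-b..b} v *\<^sub>R main_integrand n x y v))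
       \<le> real n / (2 * pi) * (C * A / real n ^ M * (LINT \<xi>|lborel. damped (\<Sum>j=1..M. \<nu> j) n \<xi>))"
      by (simp add: m_def J_def)
  qed
qed

text \<open>For the frequency (\<xi> - \<eta>)/k with b = pi k, the product of frequency and b is pi
  (\<xi> - \<eta>).\<close>

lemma sine_kernel_integral:
  "of_real (sine_kernel \<xi> \<eta>) = integral {-b..b} (\<lambda>v. exp (\<i> * of_real ((\<xi> - \<eta>) / (rho M \<phi> * x\<^sub>0) * v))) / (2 * of_real b)"
proof -
  define k where "k = rho M \<phi> * x\<^sub>0"
  have k: "k > 0" "b = pi * k" using bulk_constants bulk_param_pos[OF \<phi>] by (simp_all add: k_def)
  have eq: "(\<xi> - \<eta>) / k * b = pi * (\<xi> - \<eta>)" using k by simp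
  show ?thesis
  proof (cases "\<xi> = \<eta>")
    case True
    then show ?thesis
      unfolding k_def[symmetric] integral_unique[OF integral_cexp_symmetric[OF b]] using b
      by (simp add: sine_kernel_def)
  next
    case False
    define \<alpha> where "\<alpha> = (\<xi> - \<eta>) / k"
    have nz: "\<alpha> \<noteq> 0" using False k by (simp add: \<alpha>_def)
    have "sine_kernel \<xi> \<eta> = sin (\<alpha> * b) / (\<alpha> * b)"
      using False unfolding \<alpha>_def eq by (simp add: sine_kernel_def)
    also have "\<dots> = 2 * sin (\<alpha> * b) / \<alpha> / (2 * b)" by simp
    finally show ?thesis
      unfolding k_def[symmetric] \<alpha>_def[symmetric] integral_unique[OF integral_cexp_symmetric[OF b]]
      using nz by simp
  qed
qed

lemma main_term_bound:
  assumes T: "T \<ge> 0"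
  obtains C n0 where "C > 0"
    "\<And>n \<xi> \<eta>. n \<ge> n0 \<Longrightarrow> \<bar>\<xi>\<bar> \<le> T \<Longrightarrow> \<bar>\<eta>\<bar> \<le> T \<Longrightarrow>
      norm (of_real (exp (- pi * \<xi> * cot \<phi>) / exp (- pi * \<eta> * cot \<phi>)) * of_real (real n ^ (M - 1) / rho M \<phi>) *
        (of_real (real n / (2 * pi)) * (LINT v|lborel. indicator {-b..b} v *\<^sub>R main_integrand n (window n \<xi>) (window n \<eta>) v))
        - of_real (sine_kernel \<xi> \<eta>)) \<le> C / real n"
proof -
  define k where "k = rho M \<phi> * x\<^sub>0"
  have x0: "x\<^sub>0 > 0" by (rule bulk_param_pos[OF \<phi>])
  have k: "k > 0" "b = pi * k" using bulk_constants x0 by (simp_all add: k_def)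
  define T1 where "T1 = 2 * T / k"
  define T2 where "T2 = 2 * (T / k)\<^sup>2"
  have T12: "T1 \<ge> 0" "T2 \<ge> 0" using T k by (auto simp: T1_def T2_def)
  \<comment> \<open>Bounds n |d|: the first summand is the error of n L against its limit,
    multiplied by a; the second covers L/2 and the shift of y, where L is a difference of two
    shifts.\<close>
  define Cd where "Cd = 2 * a * T2 + 2 * T1"
  have Cd: "Cd \<ge> 0" using T12 a by (simp add: Cd_def)
  define C where "C = 2 * Cd + 2 * T2 * b + 1"
  have C: "C > 0" using Cd T12 b by (auto simp: C_def intro!: add_nonneg_pos add_nonneg_nonneg)
  \<comment> \<open>Beyond this index the window lies in the range of
    \<open>window_asymptotics\<close>, and |d| <= 1, as needed to linearise exp d.\<close>
  define n0 where "n0 = nat \<lceil>max (2 * T / k) Cd\<rceil> + 1"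
  show ?thesis
  proof (rule that[OF C, of n0])
    fix n \<xi> \<eta> assume n0: "n \<ge> n0" and xi: "\<bar>\<xi>\<bar> \<le> T" and eta: "\<bar>\<eta>\<bar> \<le> T"
    have n: "n \<ge> 1" using n0 by (simp add: n0_def)
    have "max (2 * T / k) Cd \<le> real n" using n0 unfolding n0_def by linarith
    then have nb: "2 * T \<le> real n * k" "Cd \<le> real n" using k by (auto simp: field_simps)
    note wx = window_asymptotics[OF n xi nb(1)[unfolded k_def], folded k_def, folded T1_def T2_def]
    note wy = window_asymptotics[OF n eta nb(1)[unfolded k_def], folded k_def, folded T1_def T2_def]
    define x where "x = window n \<xi>"
    define y where "y = window n \<eta>"
    define ex where "ex = log_shift n \<xi>"
    define ey where "ey = log_shift n \<eta>"
    define L where "L = ln x - ln y"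
    have L: "L = ex - ey" unfolding L_def x_def y_def ex_def ey_def wx(2) wy(2) by simp
    define I where "I = (\<lambda>\<alpha>. integral {-b..b} (\<lambda>v. exp (\<i> * of_real (\<alpha> * v)) :: complex))"
    \<comment> \<open>All real exponents together: the prefactor, the constant modulus of the main
      integrand and the correction of y relative to \<open>n^M x\<^sub>0\<close>. The leading terms
      cancel because a times the limit frequency equals pi (\<xi> - \<eta>) cot \<phi>.\<close>
    define d where "d = - (pi * (\<xi> - \<eta>) * cot \<phi>) + (real n * a - 1 / 2) * L - ey"
    have main: "of_real (exp (- pi * \<xi> * cot \<phi>) / exp (- pi * \<eta> * cot \<phi>)) * of_real (real n ^ (M - 1) / rho M \<phi>) *
        (of_real (real n / (2 * pi)) * (LINT v|lborel. indicator {-b..b} v *\<^sub>R main_integrand n x y v))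
       = of_real (exp d) * I (real n * L) / (2 * of_real b)"
    proof -
      have y: "y = real n ^ M * x\<^sub>0 * exp ey"
      proof -
        have "y = exp (ln y)" using wy(1) by (simp add: y_def)
        also have "\<dots> = real n ^ M * x\<^sub>0 * exp ey"
          unfolding y_def wy(2) ey_def using n x0 by (simp add: exp_add exp_of_nat_mult)
        finally show ?thesis .
      qed
      have nM: "real n ^ (M - 1) * real n = real n ^ M" using M by (metis power_eq_if mult.commute not_one_le_zero)
      have "exp (- pi * \<xi> * cot \<phi>) / exp (- pi * \<eta> * cot \<phi>) * (real n ^ (M - 1) / rho M \<phi>) * (real n / (2 * pi)) *
            (exp ((real n * a - 1 / 2) * L) / y) = exp d / (2 * b)"
      proof -
        have "exp d = exp (- pi * \<xi> * cot \<phi>) / exp (- pi * \<eta> * cot \<phi>) * exp ((real n * a - 1 / 2) * L) / exp ey"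
          by (simp add: d_def algebra_simps flip: exp_diff exp_add)
        moreover have "(real n ^ (M - 1) / rho M \<phi>) * (real n / (2 * pi)) / y = 1 / (2 * b) / exp ey"
        proof -
          have "(real n ^ (M - 1) / rho M \<phi>) * (real n / (2 * pi)) / y = (real n ^ (M - 1) * real n) / (rho M \<phi> * (2 * pi) * y)"
            by simp
          also have "\<dots> = real n ^ M / (real n ^ M * (2 * b * exp ey))"
            unfolding nM y k(2) k_def by (simp add: mult_ac)
          also have "\<dots> = 1 / (2 * b) / exp ey" using n by simp
          finally show ?thesis .
        qed
        moreover have "exp (- pi * \<xi> * cot \<phi>) / exp (- pi * \<eta> * cot \<phi>) * (real n ^ (M - 1) / rho M \<phi>) * (real n / (2 * pi)) *
            (exp ((real n * a - 1 / 2) * L) / y) = exp (- pi * \<xi> * cot \<phi>) / exp (- pi * \<eta> * cot \<phi>) *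
            exp ((real n * a - 1 / 2) * L) * ((real n ^ (M - 1) / rho M \<phi>) * (real n / (2 * pi)) / y)" by (simp add: mult_ac)
        ultimately show ?thesis by simp
      qed
      then have "of_real (exp (- pi * \<xi> * cot \<phi>) / exp (- pi * \<eta> * cot \<phi>)) * of_real (real n ^ (M - 1) / rho M \<phi>) * of_real (real n / (2 * pi)) *
            of_real (exp ((real n * a - 1 / 2) * L) / y) = (of_real (exp d / (2 * b)) :: complex)"
        by (simp only: flip: of_real_mult)
      moreover have "(LINT v|lborel. indicator {-b..b} v *\<^sub>R main_integrand n x y v) = of_real (exp ((real n * a - 1 / 2) * L) / y) * I (real n * L)"
        using main_integral(2)[of x y n] wx(1) wy(1) by (simp add: x_def y_def L_def I_def)
      ultimately have "of_real (exp (- pi * \<xi> * cot \<phi>) / exp (- pi * \<eta> * cot \<phi>)) * of_real (real n ^ (M - 1) / rho M \<phi>) *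
        (of_real (real n / (2 * pi)) * (LINT v|lborel. indicator {-b..b} v *\<^sub>R main_integrand n x y v)) = of_real (exp d / (2 * b)) * I (real n * L)"
        by (simp only: mult.assoc [symmetric])
      then show ?thesis by simp
    qed
    define \<tau> where "\<tau> = (\<xi> - \<eta>) / k"
    have tau: "\<bar>real n * L - \<tau>\<bar> \<le> 2 * T2 / real n"
    proof -
      have "real n * L - \<tau> = (real n * ex - \<xi> / k) - (real n * ey - \<eta> / k)"
        by (simp add: L \<tau>_def right_diff_distrib diff_divide_distrib)
      also have "\<bar>\<dots>\<bar> \<le> T2 / real n + T2 / real n"
        using wx(4) wy(4) unfolding ex_def ey_def by linarith
      finally show ?thesis by simp
    qed
    have dbound: "\<bar>d\<bar> \<le> Cd / real n"
    proof -
      have "a * \<tau> = pi * (\<xi> - \<eta>) * cot \<phi>" using k bulk_constants(3) by (simp add: \<tau>_def)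
      then have "d = a * (real n * L - \<tau>) - L / 2 - ey" by (simp add: d_def algebra_simps)
      also have "\<bar>\<dots>\<bar> \<le> a * (2 * T2 / real n) + 2 * T1 / real n"
      proof -
        have tri: "\<bar>g - l / 2 - s\<bar> \<le> u + 2 * h" if "\<bar>g\<bar> \<le> u" "\<bar>r\<bar> \<le> h" "\<bar>s\<bar> \<le> h" "l = r - s" for g l r s u h :: real
          using that by (simp add: abs_le_iff diff_divide_distrib)
        have "\<bar>a * (real n * L - \<tau>)\<bar> \<le> a * (2 * T2 / real n)"
          unfolding abs_mult using a tau by (intro mult_mono) auto
        moreover have "\<bar>ex\<bar> \<le> T1 / real n" "\<bar>ey\<bar> \<le> T1 / real n"
          using wx(3) wy(3) n by (auto simp: ex_def ey_def field_simps)
        ultimately have "\<bar>a * (real n * L - \<tau>) - L / 2 - ey\<bar> \<le> a * (2 * T2 / real n) + 2 * (T1 / real n)"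
          by (intro tri[where r = ex] L)
        then show ?thesis by simp
      qed
      also have "\<dots> = Cd / real n" by (simp add: Cd_def add_divide_distrib)
      finally show ?thesis .
    qed
    also have "\<dots> \<le> 1" using nb(2) n by (simp add: divide_le_eq_1)
    finally have ed: "\<bar>exp d - 1\<bar> \<le> 2 * \<bar>d\<bar>" by (rule abs_exp_minus_one_le)
    have sk: "of_real (sine_kernel \<xi> \<eta>) = I \<tau> / (2 * of_real b)"
      unfolding I_def \<tau>_def k_def by (rule sine_kernel_integral)
    have "of_real (exp d) * I (real n * L) / (2 * of_real b) - of_real (sine_kernel \<xi> \<eta>)
       = (of_real (exp d - 1) * I (real n * L) + (I (real n * L) - I \<tau>)) / (2 * of_real b)"
      unfolding sk by (simp add: algebra_simps diff_divide_distrib add_divide_distrib)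
    also have "norm \<dots> = norm (of_real (exp d - 1) * I (real n * L) + (I (real n * L) - I \<tau>)) / (2 * b)"
      using b by (simp add: norm_divide)
    also have "\<dots> \<le> (\<bar>exp d - 1\<bar> * (2 * b) + 2 * b * (\<bar>real n * L - \<tau>\<bar> * b)) / (2 * b)"
    proof (intro divide_right_mono order.trans[OF norm_triangle_ineq] add_mono)
      show "norm (of_real (exp d - 1) * I (real n * L)) \<le> \<bar>exp d - 1\<bar> * (2 * b)"
        unfolding norm_mult norm_of_real I_def by (intro mult_left_mono norm_integral_cexp_diff_le(2) b) auto
      show "norm (I (real n * L) - I \<tau>) \<le> 2 * b * (\<bar>real n * L - \<tau>\<bar> * b)"
        unfolding I_def by (rule norm_integral_cexp_diff_le(1)[OF b])
    qed (use b in auto)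
    also have "\<dots> = \<bar>exp d - 1\<bar> + \<bar>real n * L - \<tau>\<bar> * b" using b by (simp add: field_simps)
    also have "\<dots> \<le> 2 * (Cd / real n) + (2 * T2 / real n) * b"
      using ed dbound tau b by (intro add_mono mult_right_mono) auto
    also have "\<dots> \<le> C / real n" using n by (simp add: C_def add_divide_distrib)
    finally show "norm (of_real (exp (- pi * \<xi> * cot \<phi>) / exp (- pi * \<eta> * cot \<phi>)) * of_real (real n ^ (M - 1) / rho M \<phi>) *
        (of_real (real n / (2 * pi)) * (LINT v|lborel. indicator {-b..b} v *\<^sub>R main_integrand n (window n \<xi>) (window n \<eta>) v))
        - of_real (sine_kernel \<xi> \<eta>)) \<le> C / real n"
      unfolding x_def[symmetric] y_def[symmetric] main .
  qed
qed

theorem kernel_uniform_limit: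
  assumes nu: "\<nu> 0 = 0" and enc: "\<And>n. n \<ge> 1 \<Longrightarrow> encloses_once n (\<Sigma> n)" and S: "compact S"
  shows "uniform_limit (S \<times> S)
     (\<lambda>n (\<xi>, \<eta>). of_real (exp (- pi * \<xi> * cot \<phi>) / exp (- pi * \<eta> * cot \<phi>)) *
        of_real (real n ^ (M - 1) / rho M \<phi>) * ginibre_kernel M \<nu> n (\<Sigma> n) (window n \<xi>) (window n \<eta>))
     (\<lambda>(\<xi>, \<eta>). of_real (sine_kernel \<xi> \<eta>)) sequentially"
proof -
  obtain T where T: "T > 0" "\<And>t. t \<in> S \<Longrightarrow> \<bar>t\<bar> \<le> T"
    using compact_imp_bounded[OF S] unfolding bounded_pos by auto
  define k where "k = rho M \<phi> * x\<^sub>0"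
  have k: "k > 0" using bulk_constants(1) bulk_param_pos[OF \<phi>] by (simp add: k_def)
  have T1: "2 * T / k \<ge> 0" using T k by simp
  obtain C1 n1 where C1: "C1 > 0"
    "\<And>n \<xi> \<eta>. n \<ge> n1 \<Longrightarrow> \<bar>\<xi>\<bar> \<le> T \<Longrightarrow> \<bar>\<eta>\<bar> \<le> T \<Longrightarrow>
      norm (of_real (exp (- pi * \<xi> * cot \<phi>) / exp (- pi * \<eta> * cot \<phi>)) * of_real (real n ^ (M - 1) / rho M \<phi>) *
        (of_real (real n / (2 * pi)) * (LINT v|lborel. indicator {-b..b} v *\<^sub>R main_integrand n (window n \<xi>) (window n \<eta>) v))
        - of_real (sine_kernel \<xi> \<eta>)) \<le> C1 / real n"
    by (rule main_term_bound[OF less_imp_le[OF T(1)]]) blast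
  obtain C2 where C2: "C2 > 0"
    "\<And>n \<Sigma> x y e e'. encloses_once n \<Sigma> \<Longrightarrow> n \<ge> 1 \<Longrightarrow> x > 0 \<Longrightarrow> y > 0 \<Longrightarrow>
       ln x = real M * ln (real n) + ln x\<^sub>0 + e' \<Longrightarrow> ln y = real M * ln (real n) + ln x\<^sub>0 + e \<Longrightarrow>
       real n * \<bar>e\<bar> \<le> 2 * T / k \<Longrightarrow> real n * \<bar>e'\<bar> \<le> 2 * T / k \<Longrightarrow>
       norm (ginibre_kernel M \<nu> n \<Sigma> x y - of_real (real n / (2 * pi)) * (LINT v|lborel. indicator {-b..b} v *\<^sub>R main_integrand n x y v))
       \<le> real n / (2 * pi) * (C2 / real n ^ M * (LINT \<xi>|lborel. damped (\<Sum>j=1..M. \<nu> j) n \<xi>))"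
    by (rule kernel_main_term[where \<nu> = \<nu>, OF nu T1]) blast
  define J where "J = (\<lambda>n. LINT \<xi>|lborel. damped (\<Sum>j=1..M. \<nu> j) n \<xi>)"
  \<comment> \<open>Bounds the exponential prefactor, since |\<eta> - \<xi>| is at most 2 T on the
    compact set.\<close>
  define Cq where "Cq = exp (2 * pi * T * \<bar>cot \<phi>\<bar>)"
  \<comment> \<open>Uniform error: order 1/n from the main term, plus a fixed multiple of the
    integral of \<open>damped\<close>, which tends to 0. The powers of n cancel between the factor
    n^(M-1) of the statement, the substitution factor n and n^(-M).\<close>
  define r where "r = (\<lambda>n. C1 / real n + Cq / rho M \<phi> / (2 * pi) * C2 * J n)"
  have "r \<longlonglongrightarrow> 0 + Cq / rho M \<phi> / (2 * pi) * C2 * 0"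
    unfolding r_def J_def
    by (intro tendsto_intros damped_integral_tendsto_0 real_tendsto_divide_at_top[OF tendsto_const filterlim_real_sequentially])
  then have r: "r \<longlonglongrightarrow> 0" by simp
  define n2 where "n2 = max n1 (nat \<lceil>2 * T / k\<rceil> + 1)"
  have bound: "dist (of_real (exp (- pi * \<xi> * cot \<phi>) / exp (- pi * \<eta> * cot \<phi>)) * of_real (real n ^ (M - 1) / rho M \<phi>) *
        ginibre_kernel M \<nu> n (\<Sigma> n) (window n \<xi>) (window n \<eta>)) (of_real (sine_kernel \<xi> \<eta>)) \<le> r n"
    if n2: "n \<ge> n2" and S': "\<xi> \<in> S" "\<eta> \<in> S" for n \<xi> \<eta>
  proof -
    have n: "n \<ge> 1" "n \<ge> n1" using n2 by (auto simp: n2_def)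
    have "2 * T / k \<le> real n" using n2 unfolding n2_def by linarith
    then have nb: "2 * T \<le> real n * (rho M \<phi> * x\<^sub>0)" using k by (simp add: field_simps k_def[symmetric])
    note t = T(2)[OF S'(1)] T(2)[OF S'(2)]
    note wx = window_asymptotics[OF n(1) t(1) nb] and wy = window_asymptotics[OF n(1) t(2) nb]
    define p where "p = exp (- pi * \<xi> * cot \<phi>) / exp (- pi * \<eta> * cot \<phi>)"
    define q where "q = real n ^ (M - 1) / rho M \<phi>"
    define Kn where "Kn = ginibre_kernel M \<nu> n (\<Sigma> n) (window n \<xi>) (window n \<eta>)"
    define Kmain where "Kmain = of_real (real n / (2 * pi)) * (LINT v|lborel. indicator {-b..b} v *\<^sub>R main_integrand n (window n \<xi>) (window n \<eta>) v)"
    have pq: "p > 0" "q > 0" using n bulk_constants(1) by (simp_all add: p_def q_def)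
    have p: "p \<le> Cq"
    proof -
      have "p = exp (pi * (\<eta> - \<xi>) * cot \<phi>)" by (simp add: p_def algebra_simps flip: exp_diff)
      also have "pi * (\<eta> - \<xi>) * cot \<phi> \<le> \<bar>pi * (\<eta> - \<xi>) * cot \<phi>\<bar>" by simp
      also have "\<dots> = pi * \<bar>\<eta> - \<xi>\<bar> * \<bar>cot \<phi>\<bar>" by (simp add: abs_mult)
      also have "\<dots> \<le> pi * (2 * T) * \<bar>cot \<phi>\<bar>" using t by (intro mult_right_mono mult_left_mono) auto
      finally show ?thesis by (simp add: Cq_def mult_ac)
    qed
    have 1: "norm (of_real p * of_real q * Kmain - of_real (sine_kernel \<xi> \<eta>)) \<le> C1 / real n"
      unfolding p_def q_def Kmain_def by (rule C1(2)[OF n(2) t])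
    have 2: "norm (Kn - Kmain) \<le> real n / (2 * pi) * (C2 / real n ^ M * J n)"
      unfolding Kn_def Kmain_def J_def
      by (rule C2(2)[OF enc[OF n(1)] n(1) wx(1) wy(1) wx(2) wy(2)]) (use wx(3) wy(3) in \<open>simp_all add: k_def\<close>)
    have "norm (of_real p * of_real q * (Kn - Kmain)) \<le> Cq * q * (real n / (2 * pi) * (C2 / real n ^ M * J n))"
      unfolding norm_mult norm_of_real using pq p 2 by (intro mult_mono) auto
    also have "\<dots> = Cq / rho M \<phi> / (2 * pi) * C2 * J n"
    proof -
      have "real n ^ (M - 1) * real n = real n ^ M" using M by (metis power_eq_if mult.commute not_one_le_zero)
      then have "q * (real n / real n ^ M) = 1 / rho M \<phi>" using n by (simp add: q_def)
      moreover have "Cq * q * (real n / (2 * pi) * (C2 / real n ^ M * J n)) = Cq / (2 * pi) * C2 * J n * (q * (real n / real n ^ M))"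
        by simp
      ultimately show ?thesis by simp
    qed
    finally have 3: "norm (of_real p * of_real q * (Kn - Kmain)) \<le> Cq / rho M \<phi> / (2 * pi) * C2 * J n" .
    have "dist (of_real p * of_real q * Kn) (of_real (sine_kernel \<xi> \<eta>)) =
       norm ((of_real p * of_real q * Kmain - of_real (sine_kernel \<xi> \<eta>)) + of_real p * of_real q * (Kn - Kmain))"
      by (simp add: dist_norm algebra_simps)
    also have "\<dots> \<le> r n" unfolding r_def by (intro order.trans[OF norm_triangle_ineq] add_mono 1 3)
    finally show ?thesis by (simp add: p_def q_def Kn_def)
  qed
  show ?thesis
  proof (rule uniform_limitI)
    fix \<epsilon> :: real assume "\<epsilon> > 0"
    with r have "\<forall>\<^sub>F n in sequentially. r n < \<epsilon>" by (rule order_tendstoD)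
    moreover have "\<forall>\<^sub>F n in sequentially. n \<ge> n2" by (rule eventually_ge_at_top)
    ultimately show "\<forall>\<^sub>F n in sequentially. \<forall>p\<in>S \<times> S. dist
       ((\<lambda>(\<xi>, \<eta>). of_real (exp (- pi * \<xi> * cot \<phi>) / exp (- pi * \<eta> * cot \<phi>)) *
        of_real (real n ^ (M - 1) / rho M \<phi>) * ginibre_kernel M \<nu> n (\<Sigma> n) (window n \<xi>) (window n \<eta>)) p)
       (case p of (\<xi>, \<eta>) \<Rightarrow> of_real (sine_kernel \<xi> \<eta>)) < \<epsilon>"
    proof eventually_elim
      case (elim n)
      show ?case
      proof
        fix p assume "p \<in> S \<times> S"
        then obtain \<xi> \<eta> where p: "p = (\<xi>, \<eta>)" "\<xi> \<in> S" "\<eta> \<in> S" by auto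
        show "dist ((\<lambda>(\<xi>, \<eta>). of_real (exp (- pi * \<xi> * cot \<phi>) / exp (- pi * \<eta> * cot \<phi>)) *
        of_real (real n ^ (M - 1) / rho M \<phi>) * ginibre_kernel M \<nu> n (\<Sigma> n) (window n \<xi>) (window n \<eta>)) p)
       (case p of (\<xi>, \<eta>) \<Rightarrow> of_real (sine_kernel \<xi> \<eta>)) < \<epsilon>"
          unfolding p(1) case_prod_conv using bound[OF elim(2) p(2,3)] elim(1) by (rule order.strict_trans1)
      qed
    qed
  qed
qed

end

theorem theorem1p1:
  fixes M :: nat and \<nu> :: "nat \<Rightarrow> nat" and \<Sigma> :: "nat \<Rightarrow> real \<Rightarrow> complex"
    and x0 \<phi> :: real and C :: "real set"
  assumes "M \<ge> 1" and "\<nu> 0 = 0"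
    and "\<And>n. n \<ge> 1 \<Longrightarrow> encloses_once n (\<Sigma> n)"
    and "x0 \<in> {0 <..< real (M + 1) ^ (M + 1) / real M ^ M}"
    and "\<phi> \<in> {0 <..< pi / real (M + 1)}"
    and "x0 = sin (real (M + 1) * \<phi>) ^ (M + 1) / (sin \<phi> * sin (real M * \<phi>) ^ M)"
    and "compact C"
  shows "uniform_limit (C \<times> C)
     (\<lambda>n (\<xi>, \<eta>).
        of_real (exp (- pi * \<xi> * cot \<phi>) / exp (- pi * \<eta> * cot \<phi>)) *
        of_real (real n ^ (M - 1) / rho M \<phi>) *
        ginibre_kernel M \<nu> n (\<Sigma> n)
          (real n ^ M * (x0 + \<xi> / (real n * rho M \<phi>)))
          (real n ^ M * (x0 + \<eta> / (real n * rho M \<phi>))))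
     (\<lambda>(\<xi>, \<eta>). of_real (sine_kernel \<xi> \<eta>))
     sequentially"
proof -
  interpret factor_count M by standard (rule assms)
  interpret bulk_point M \<phi> by standard (use assms in \<open>auto simp: \<theta>max_def\<close>)
  have x0: "x0 = bulk_param M \<phi>" using assms by (simp add: bulk_param_def)
  show ?thesis
    using kernel_uniform_limit[of \<nu> \<Sigma> C] assms unfolding window_def x0 by simp
qed

end
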